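(* Let $\alpha,\beta$ satisfy $\alpha+\beta>0$ and $\lambda>0$, and assume that $\mathcal M$ and $L$ satisfy the equilibrium hypothesis, the weighted coercivity hypothesis and the large-velocity hypothesis described in the context. Then there are $\eta_0>0$ and $r_0\in(0,\lambda)$, explicit in terms of the constants in these hypotheses, such that for any $\eta\in(0,\eta_0)$ and any $\sigma\in\mathbb S^{d-1}$ there is a unique pair $\phi_\eta=\phi_\eta(v)\in L^2_v(\lfloor\cdot\rceil^{-\beta}\mathcal M)$ and $\mu(\eta)\in B(0,r_0)\subset\mathbb C$ solving $$-L^*\phi_\eta-i\eta\,(v\cdot\sigma)\,\phi_\eta=\mu(\eta)\,\lfloor v\rceil^{-\beta}\phi_\eta\qquad\text{with}\qquad\int_{\mathbb R^d}\phi_\eta(v)\,\mathcal M_\beta(v)\,dv=1 .$$ Moreover the branch $(\phi_\eta,\mu(\eta))$ connects to $(1,0)$ as $\eta\to0$, with $\mu(\eta)>0$ (in particular real) and $$\|\phi_\eta-1\|_{-\beta}\lesssim\mu(\eta)^{\frac12}\qquad\text{and}\qquad \mu(\eta)\in\big(\mathsf r_0\,\Theta(\eta),\ \mathsf r_1\,\Theta(\eta)\big)$$ for some constants $0<\mathsf r_0<\mathsf r_1$ (independent of $\eta$), where $$\Theta(\eta):=\begin{cases}\eta^2&\text{when }\alpha>2+\beta,\\ \eta^2|\ln\eta|&\text{when }\alpha=2+\beta,\\ \eta^{\frac{\alpha+\beta}{1+\beta}}&\text{when }-\beta<\alpha<2+\beta.\end{cases}$$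
   Context: Notation. $d\ge1$, $\lfloor v\rceil:=\sqrt{1+|v|^2}$ for $v\in\mathbb R^d$. $L^2_v(\mathcal M)=L^2(\mathbb R^d;\mathcal M\,dv)$ is a complex Hilbert space with scalar product $\langle g,h\rangle=\int g\bar h\,\mathcal M\,dv$; $\|h\|_k^2:=\int_{\mathbb R^d}|h|^2\lfloor v\rceil^k\mathcal M\,dv$ and $\|\cdot\|=\|\cdot\|_0$. $\mathcal M_\beta:=\lfloor\cdot\rceil^{-\beta}\mathcal M$. $L^*$ is the adjoint of $L$ in $L^2_v(\mathcal M)$. $A\lesssim B$ means $A\le cB$ with $c>0$ independent of $\eta,\sigma,R$. The eigenvalue equation is equivalent to saying that $\psi_\eta=\lfloor\cdot\rceil^{-\beta/2}\phi_\eta\in L^2_v(\mathcal M)$ is an eigenvector, with eigenvalue $-\mu(\eta)$, of $\tilde L^*+i\eta\lfloor v\rceil^\beta(v\cdot\sigma)$, with $\tilde L$ defined below. Equilibrium hypothesis. Either (i) $\alpha\in\mathbb R$ and $\mathcal M(v)=c_{\alpha,\beta}\lfloor v\rceil^{-(d+\alpha)}$ with $c_{\alpha,\beta}=\big(\int_{\mathbb R^d}\lfloor v\rceil^{-d-\alpha-\beta}dv\big)^{-1}$; or (ii) $\mathcal M$ is a smooth positive radially symmetric function decaying faster than any polynomial, a case denoted "$\alpha=+\infty$" (so $\alpha>2+\beta$). In both cases $\int\mathcal M_\beta\,dv=1$. Weighted coercivity hypothesis. $L$ is a linear operator acting on functions of $v$ only (independent of $t,x$), maps real-valued functions to real-valued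 functions, commutes with rotations in $v$ (when $d=1$: with $v\mapsto-v$), is closed and densely defined on $\mathrm{Dom}(L)\subset L^2_v(\mathcal M)$, and $L(1)=L^*(1)=0$. The operator $\tilde L:=\lfloor\cdot\rceil^{\beta/2}L(\lfloor\cdot\rceil^{\beta/2}\,\cdot\,)$ is closed and densely defined on $\mathrm{Dom}(\tilde L)\subset L^2_v(\mathcal M)$ and $-\mathrm{Re}\langle\tilde Lg,g\rangle\ge\lambda\|g\|^2$ for all $g\in\mathrm{Dom}(\tilde L)$ orthogonal to $\lfloor\cdot\rceil^{-\beta/2}$. In terms of $L$: $-\mathrm{Re}\langle Lh,h\rangle\ge\lambda\|h-\mathcal Ph\|_{-\beta}^2$ for $h\in\mathrm{Dom}(L)$, with $\mathcal Ph:=\int h\,\mathcal M_\beta\,dv$. Large-velocity hypothesis. Given a smooth $0\le\chi\le1$ equal to $1$ on $B(0,1)$ and $0$ outside $B(0,2)$, with $\chi_R:=\chi(\cdot/R)$ and $\tilde\chi_R:=(v\cdot\sigma)\lfloor v\rceil^\beta\chi_R$: $\|L(\chi_R)\|_\beta\lesssim R^{-\frac{\alpha+\beta}2}$ for $R\ge1$ (when $\alpha=+\infty$: faster than any power of $R^{-1}$), and $\|L(\tilde\chi_R)\|_\beta\lesssim R^{1+\beta-\frac{\alpha+\beta}2}$ for $R\ge1$ when $\alpha\in(-\beta,2+\beta)$, $\|L(\tilde\chi_R)\|_\beta\lesssim(\ln R)^{1/2}$ for $R\ge2$ when $\alpha=2+\beta$.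
   Formalization: Adds that, for η>0 and |σ|=1, L̃−iη⌊v⌉^β(v·σ) is densely defined on the common domain with dissipative adjoint; the eigenvalue equation is read via this adjoint. Else uniqueness fails: d=1, β=0, Gaussian M, Lh=h''−vh' with h'(±1)=0. *)

theory Defs
  imports "HOL-Analysis.Analysis"
begin

section \<open>Weighted spaces\<close>

definition jb :: "real^'n \<Rightarrow> real" where
  "jb v = sqrt (1 + (norm v)\<^sup>2)"

text \<open>The measure \<open>M dv\<close> on velocity space.\<close>

definition vmeas :: "(real^'n \<Rightarrow> real) \<Rightarrow> (real^'n) measure" where
  "vmeas M = density lborel (\<lambda>v. ennreal (M v))"

text \<open>The equilibrium \<open>M\<^sub>\<beta>\<close> weighted by \<open>jb\<close> to the power \<open>-\<beta>\<close>.\<close>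

definition wgt :: "real \<Rightarrow> (real^'n \<Rightarrow> real) \<Rightarrow> real^'n \<Rightarrow> real" where
  "wgt \<beta> M v = jb v powr (-\<beta>) * M v"

text \<open>
  Elements of \<open>L\<^sup>2\<close> are represented by Borel functions. Nothing is quotiented: two functions
  stand for the same element when they agree almost everywhere, and all operators below are
  required to respect this.
\<close>

definition L2 :: "'a measure \<Rightarrow> ('a \<Rightarrow> complex) set" where
  "L2 N = {h \<in> borel_measurable N. integrable N (\<lambda>v. (cmod (h v))\<^sup>2)}"

definition ip :: "'a measure \<Rightarrow> ('a \<Rightarrow> complex) \<Rightarrow> ('a \<Rightarrow> complex) \<Rightarrow> complex" where
  "ip N g h = (LINT v|N. g v * cnj (h v))"

definition nrm :: "'a measure \<Rightarrow> ('a \<Rightarrow> complex) \<Rightarrow> real" where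
  "nrm N h = sqrt (LINT v|N. (cmod (h v))\<^sup>2)"

text \<open>
  The norm with weight exponent \<open>k\<close>. As the Bochner integral of a non-integrable function is 0,
  this is only used on functions whose weighted norm is known to be finite.
\<close>

definition wnorm :: "(real^'n \<Rightarrow> real) \<Rightarrow> real \<Rightarrow> (real^'n \<Rightarrow> complex) \<Rightarrow> real" where
  "wnorm M k h = sqrt (LINT v|vmeas M. (cmod (h v))\<^sup>2 * jb v powr k)"

section \<open>Unbounded operators on \<open>L\<^sup>2\<close>\<close>

text \<open>An operator is given by its domain \<open>D\<close> and a map \<open>T\<close> whose values outside \<open>D\<close> are irrelevant.\<close>

definition L2_operator ::
    "'a measure \<Rightarrow> ('a \<Rightarrow> complex) set \<Rightarrow> (('a \<Rightarrow> complex) \<Rightarrow> ('a \<Rightarrow> complex)) \<Rightarrow> bool" where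
  "L2_operator N D T \<longleftrightarrow>
     D \<subseteq> L2 N \<and> D \<noteq> {} \<and> (\<forall>h\<in>D. T h \<in> L2 N) \<and>
     (\<forall>f\<in>D. \<forall>g\<in>borel_measurable N. (AE v in N. f v = g v) \<longrightarrow>
        g \<in> D \<and> (AE v in N. T f v = T g v)) \<and>
     (\<forall>f\<in>D. \<forall>g\<in>D. \<forall>a b. (\<lambda>v. a * f v + b * g v) \<in> D \<and>
        (AE v in N. T (\<lambda>u. a * f u + b * g u) v = a * T f v + b * T g v))"

definition densely_defined :: "'a measure \<Rightarrow> ('a \<Rightarrow> complex) set \<Rightarrow> bool" where
  "densely_defined N D \<longleftrightarrow>
     (\<forall>f\<in>L2 N. \<forall>\<epsilon>>0. \<exists>g\<in>D. nrm N (\<lambda>v. f v - g v) < \<epsilon>)"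

definition closed_operator ::
    "'a measure \<Rightarrow> ('a \<Rightarrow> complex) set \<Rightarrow> (('a \<Rightarrow> complex) \<Rightarrow> ('a \<Rightarrow> complex)) \<Rightarrow> bool" where
  "closed_operator N D T \<longleftrightarrow>
     (\<forall>h f g. (\<forall>n::nat. h n \<in> D) \<and> f \<in> L2 N \<and> g \<in> L2 N \<and>
        (\<lambda>n. nrm N (\<lambda>v. h n v - f v)) \<longlonglongrightarrow> 0 \<and> (\<lambda>n. nrm N (\<lambda>v. T (h n) v - g v)) \<longlonglongrightarrow> 0 \<longrightarrow>
        f \<in> D \<and> (AE v in N. T f v = g v))"

text \<open>\<open>is_adjoint N D T \<phi> \<zeta>\<close>: \<open>\<phi>\<close> is in the domain of the adjoint of \<open>(D, T)\<close>, which maps it to \<open>\<zeta>\<close>.\<close>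

definition is_adjoint ::
    "'a measure \<Rightarrow> ('a \<Rightarrow> complex) set \<Rightarrow> (('a \<Rightarrow> complex) \<Rightarrow> ('a \<Rightarrow> complex)) \<Rightarrow>
     ('a \<Rightarrow> complex) \<Rightarrow> ('a \<Rightarrow> complex) \<Rightarrow> bool" where
  "is_adjoint N D T \<phi> \<zeta> \<longleftrightarrow>
     \<phi> \<in> L2 N \<and> \<zeta> \<in> L2 N \<and> (\<forall>h\<in>D. ip N (T h) \<phi> = ip N h \<zeta>)"

text \<open>
  The domain of a real operator is understood to be stable under complex conjugation, and that of
  a rotation-invariant operator to be stable under rotations.
\<close>

definition real_operator ::
    "'a measure \<Rightarrow> ('a \<Rightarrow> complex) set \<Rightarrow> (('a \<Rightarrow> complex) \<Rightarrow> ('a \<Rightarrow> complex)) \<Rightarrow> bool" where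
  "real_operator N D T \<longleftrightarrow>
     (\<forall>h\<in>D. (\<lambda>v. cnj (h v)) \<in> D \<and>
        ((AE v in N. h v \<in> \<real>) \<longrightarrow> (AE v in N. T h v \<in> \<real>)))"

text \<open>In dimension 1 the reflection \<open>v \<mapsto> -v\<close> plays the role of the rotations.\<close>

definition rotation :: "(real^'n \<Rightarrow> real^'n) \<Rightarrow> bool" where
  "rotation Q \<longleftrightarrow> orthogonal_transformation Q \<and> (det (matrix Q) = 1 \<or> CARD('n) = 1)"

definition commutes_with_rotations ::
    "(real^'n) measure \<Rightarrow> (real^'n \<Rightarrow> complex) set \<Rightarrow>
     ((real^'n \<Rightarrow> complex) \<Rightarrow> (real^'n \<Rightarrow> complex)) \<Rightarrow> bool" where
  "commutes_with_rotations N D T \<longleftrightarrow>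
     (\<forall>Q. rotation Q \<longrightarrow> (\<forall>h\<in>D. h \<circ> Q \<in> D \<and> (AE v in N. T (h \<circ> Q) v = T h (Q v))))"

section \<open>Smooth functions\<close>

primrec Ck :: "nat \<Rightarrow> (real^'n \<Rightarrow> real) \<Rightarrow> bool" where
  "Ck 0 f \<longleftrightarrow> continuous_on UNIV f"
| "Ck (Suc k) f \<longleftrightarrow> (\<forall>v. f differentiable (at v)) \<and>
     (\<forall>b\<in>Basis. Ck k (\<lambda>v. frechet_derivative f (at v) b))"

definition smooth :: "(real^'n \<Rightarrow> real) \<Rightarrow> bool" where
  "smooth f \<longleftrightarrow> (\<forall>k. Ck k f)"

section \<open>Equilibrium hypothesis\<close>

text \<open>
  \<open>K\<close> collects the decay constants of \<open>M\<close> in the case \<open>\<alpha> = \<infinity>\<close>; it plays no role when \<open>\<alpha>\<close> is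
  finite.
\<close>

definition equilibrium ::
    "ereal \<Rightarrow> real \<Rightarrow> (real \<Rightarrow> real) \<Rightarrow> (real^'n \<Rightarrow> real) \<Rightarrow> bool" where
  "equilibrium \<alpha> \<beta> K M \<longleftrightarrow>
     ((\<exists>a::real. \<alpha> = ereal a \<and>
        (\<forall>v. M v = inverse (LINT u|lborel. jb (u::real^'n) powr (- real CARD('n) - a - \<beta>))
                     * jb v powr (- (real CARD('n) + a)))) \<or>
      (\<alpha> = \<infinity> \<and> smooth M \<and> (\<forall>v. 0 < M v) \<and> (\<forall>u v. norm u = norm v \<longrightarrow> M u = M v) \<and>
        (\<forall>p v. M v \<le> K p * jb v powr (- p)))) \<and>
     (LINT v|lborel. wgt \<beta> M v) = 1"

section \<open>Weighted coercivity hypothesis\<close>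

text \<open>The rescaled collision operator, and the function it has in its kernel.\<close>

definition Lt :: "real \<Rightarrow> ((real^'n \<Rightarrow> complex) \<Rightarrow> (real^'n \<Rightarrow> complex)) \<Rightarrow>
    (real^'n \<Rightarrow> complex) \<Rightarrow> (real^'n \<Rightarrow> complex)" where
  "Lt \<beta> L g = (\<lambda>v. of_real (jb v powr (\<beta>/2)) * L (\<lambda>u. of_real (jb u powr (\<beta>/2)) * g u) v)"

definition e0 :: "real \<Rightarrow> real^'n \<Rightarrow> complex" where
  "e0 \<beta> = (\<lambda>v. of_real (jb v powr (-\<beta>/2)))"

text \<open>
  \<open>D\<close> and \<open>Dt\<close> are the domains of \<open>L\<close> and of \<open>Lt \<beta> L\<close>. For \<open>\<alpha> \<le> 0\<close> the constant function 1 is not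
  in \<open>L\<^sup>2(M)\<close>, whereas \<open>e0 \<beta>\<close> always is: \<open>L(1) = L\<^sup>*(1) = 0\<close> is therefore expressed through
  \<open>Lt \<beta> L\<close>, and also literally when 1 is in \<open>L\<^sup>2(M)\<close>.
\<close>

definition weighted_coercivity ::
    "real \<Rightarrow> real \<Rightarrow> (real^'n \<Rightarrow> real) \<Rightarrow> (real^'n \<Rightarrow> complex) set \<Rightarrow> (real^'n \<Rightarrow> complex) set \<Rightarrow>
     ((real^'n \<Rightarrow> complex) \<Rightarrow> (real^'n \<Rightarrow> complex)) \<Rightarrow> bool" where
  "weighted_coercivity \<beta> lam M D Dt L \<longleftrightarrow>
     (let N = vmeas M; T = Lt \<beta> L; one = (\<lambda>_. 1) in
       L2_operator N D L \<and> real_operator N D L \<and> commutes_with_rotations N D L \<and>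
       closed_operator N D L \<and> densely_defined N D \<and>
       L2_operator N Dt T \<and> real_operator N Dt T \<and> commutes_with_rotations N Dt T \<and>
       closed_operator N Dt T \<and> densely_defined N Dt \<and>
       (one \<in> L2 N \<longrightarrow>
          one \<in> D \<and> (AE v in N. L one v = 0) \<and> is_adjoint N D L one (\<lambda>_. 0)) \<and>
       e0 \<beta> \<in> Dt \<and> (AE v in N. T (e0 \<beta>) v = 0) \<and> is_adjoint N Dt T (e0 \<beta>) (\<lambda>_. 0) \<and>
       (\<forall>g\<in>Dt. ip N g (e0 \<beta>) = 0 \<longrightarrow> - Re (ip N (T g) g) \<ge> lam * (nrm N g)\<^sup>2) \<and>
       (\<forall>h\<in>D. h \<in> L2 (vmeas (wgt \<beta> M)) \<and>
          - Re (ip N (L h) h) \<ge>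
            lam * (wnorm M (-\<beta>) (\<lambda>v. h v - (LINT u|vmeas (wgt \<beta> M). h u)))\<^sup>2))"

section \<open>Large-velocity hypothesis\<close>

definition cutoff :: "(real^'n \<Rightarrow> real) \<Rightarrow> bool" where
  "cutoff \<kappa> \<longleftrightarrow> smooth \<kappa> \<and> (\<forall>v. 0 \<le> \<kappa> v \<and> \<kappa> v \<le> 1) \<and>
     (\<forall>v\<in>ball 0 1. \<kappa> v = 1) \<and> (\<forall>v. v \<notin> ball 0 2 \<longrightarrow> \<kappa> v = 0)"

text \<open>The function \<open>v \<mapsto> (v \<bullet> \<sigma>) jb(v)\<^sup>\<beta>\<close>, the cutoff \<open>\<chi>\<^sub>R\<close> (\<open>cut\<close>), and
  the product of the two (\<open>cut_vel\<close>).\<close>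

definition vel :: "real \<Rightarrow> real^'n \<Rightarrow> real^'n \<Rightarrow> real" where
  "vel \<beta> \<sigma> v = (v \<bullet> \<sigma>) * jb v powr \<beta>"

definition cut :: "(real^'n \<Rightarrow> real) \<Rightarrow> real \<Rightarrow> real^'n \<Rightarrow> complex" where
  "cut \<kappa> R = (\<lambda>v. of_real (\<kappa> (v /\<^sub>R R)))"

definition cut_vel :: "real \<Rightarrow> (real^'n \<Rightarrow> real) \<Rightarrow> real^'n \<Rightarrow> real \<Rightarrow> real^'n \<Rightarrow> complex" where
  "cut_vel \<beta> \<kappa> \<sigma> R = (\<lambda>v. of_real (vel \<beta> \<sigma> v) * cut \<kappa> R v)"

text \<open>
  \<open>A\<close> and \<open>B\<close> are the constants of the two estimates, uniform in \<open>\<sigma>\<close> and \<open>R\<close>. That \<open>L\<close> applied to a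
  test function makes sense and has finite norm of weight \<open>\<beta>\<close> amounts to \<open>e0 \<beta>\<close> times this test
  function being in \<open>Dt\<close>.
\<close>

definition large_velocity ::
    "ereal \<Rightarrow> real \<Rightarrow> (real \<Rightarrow> real) \<Rightarrow> real \<Rightarrow> (real^'n \<Rightarrow> real) \<Rightarrow> (real^'n \<Rightarrow> real) \<Rightarrow>
     (real^'n \<Rightarrow> complex) set \<Rightarrow> ((real^'n \<Rightarrow> complex) \<Rightarrow> (real^'n \<Rightarrow> complex)) \<Rightarrow> bool" where
  "large_velocity \<alpha> \<beta> A B \<kappa> M Dt L \<longleftrightarrow>
     (\<forall>R\<ge>1. (\<lambda>v. e0 \<beta> v * cut \<kappa> R v) \<in> Dt) \<and>
     (\<forall>a::real. \<alpha> = ereal a \<longrightarrow>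
        (\<forall>R\<ge>1. wnorm M \<beta> (L (cut \<kappa> R)) \<le> A ((a + \<beta>)/2) * R powr (- ((a + \<beta>)/2)))) \<and>
     (\<alpha> = \<infinity> \<longrightarrow>
        (\<forall>p. \<forall>R\<ge>1. wnorm M \<beta> (L (cut \<kappa> R)) \<le> A p * R powr (- p))) \<and>
     (\<forall>a::real. \<alpha> = ereal a \<and> - \<beta> < a \<and> a < 2 + \<beta> \<longrightarrow>
        (\<forall>\<sigma>. norm \<sigma> = 1 \<longrightarrow> (\<forall>R\<ge>1.
           (\<lambda>v. e0 \<beta> v * cut_vel \<beta> \<kappa> \<sigma> R v) \<in> Dt \<and>
           wnorm M \<beta> (L (cut_vel \<beta> \<kappa> \<sigma> R)) \<le> B * R powr (1 + \<beta> - (a + \<beta>)/2)))) \<and>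
     (\<alpha> = ereal (2 + \<beta>) \<longrightarrow>
        (\<forall>\<sigma>. norm \<sigma> = 1 \<longrightarrow> (\<forall>R\<ge>2.
           (\<lambda>v. e0 \<beta> v * cut_vel \<beta> \<kappa> \<sigma> R v) \<in> Dt \<and>
           wnorm M \<beta> (L (cut_vel \<beta> \<kappa> \<sigma> R)) \<le> B * sqrt (ln R))))"

section \<open>The eigenvalue problem\<close>

text \<open>The operator \<open>Lt \<beta> L - i \<eta> (v \<bullet> \<sigma>) jb(v)\<^sup>\<beta>\<close>, on the intersection of the domains of its two terms.\<close>

definition dom_adv :: "real \<Rightarrow> (real^'n \<Rightarrow> real) \<Rightarrow> (real^'n \<Rightarrow> complex) set \<Rightarrow> real^'n \<Rightarrow>
    (real^'n \<Rightarrow> complex) set" where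
  "dom_adv \<beta> M Dt \<sigma> = {g \<in> Dt. (\<lambda>v. of_real (vel \<beta> \<sigma> v) * g v) \<in> L2 (vmeas M)}"

definition L_adv :: "real \<Rightarrow> ((real^'n \<Rightarrow> complex) \<Rightarrow> (real^'n \<Rightarrow> complex)) \<Rightarrow> real \<Rightarrow> real^'n \<Rightarrow>
    (real^'n \<Rightarrow> complex) \<Rightarrow> (real^'n \<Rightarrow> complex)" where
  "L_adv \<beta> L \<eta> \<sigma> g = (\<lambda>v. Lt \<beta> L g v - \<i> * of_real (\<eta> * vel \<beta> \<sigma> v) * g v)"

text \<open>
  The Fourier modes of the kinetic equation are well posed: the closure of each \<open>L_adv \<beta> L \<eta> \<sigma>\<close>,
  which coercivity makes dissipative, is maximal dissipative, that is, its adjoint is dissipative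
  as well. Coercivity on the domain of \<open>Lt \<beta> L\<close> does not imply this, since a closed dissipative
  operator may have proper dissipative extensions, and uniqueness of the eigenvalue fails without it.
  For instance, take \<open>d = 1\<close>, \<open>\<beta> = 0\<close>, \<open>M\<close> Gaussian and the operator \<open>h'' - v h'\<close> restricted
  to those \<open>h\<close> with \<open>h'(1) = h'(-1) = 0\<close>. The functions in the domain of its adjoint may jump at
  \<open>1\<close> and \<open>-1\<close>, and every complex number close to 0 is an eigenvalue of the problem below.
\<close>

definition modes_well_posed ::
    "real \<Rightarrow> (real^'n \<Rightarrow> real) \<Rightarrow> (real^'n \<Rightarrow> complex) set \<Rightarrow>
     ((real^'n \<Rightarrow> complex) \<Rightarrow> (real^'n \<Rightarrow> complex)) \<Rightarrow> bool" where
  "modes_well_posed \<beta> M Dt L \<longleftrightarrow>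
     (\<forall>\<eta>>0. \<forall>\<sigma>. norm \<sigma> = 1 \<longrightarrow>
        densely_defined (vmeas M) (dom_adv \<beta> M Dt \<sigma>) \<and>
        (\<forall>\<psi> \<zeta>. is_adjoint (vmeas M) (dom_adv \<beta> M Dt \<sigma>) (L_adv \<beta> L \<eta> \<sigma>) \<psi> \<zeta> \<longrightarrow>
           Re (ip (vmeas M) \<zeta> \<psi>) \<le> 0))"

text \<open>
  The equation \<open>- L\<^sup>* \<phi> - i \<eta> (v \<bullet> \<sigma>) \<phi> = \<mu> jb(v)\<^sup>-\<^sup>\<beta> \<phi>\<close> for \<open>\<phi>\<close> in \<open>L\<^sup>2(M\<^sub>\<beta>)\<close>, which need not be
  contained in \<open>L\<^sup>2(M)\<close>, with its normalisation. It says that \<open>\<psi> = jb\<^sup>-\<^sup>\<beta>\<^sup>/\<^sup>2 \<phi>\<close> is an eigenvector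
  with eigenvalue \<open>-\<mu>\<close> of the sum of the adjoint of \<open>Lt \<beta> L\<close> and of multiplication by
  \<open>i \<eta> (v \<bullet> \<sigma>) jb(v)\<^sup>\<beta>\<close>, this sum being realised as the adjoint of \<open>L_adv \<beta> L \<eta> \<sigma>\<close>. The two
  coincide if \<open>\<beta> \<le> -1\<close> or \<open>Lt \<beta> L\<close> is bounded; in general the adjoint extends the naive sum.
\<close>

definition fluid_mode ::
    "real \<Rightarrow> (real^'n \<Rightarrow> real) \<Rightarrow> (real^'n \<Rightarrow> complex) set \<Rightarrow>
     ((real^'n \<Rightarrow> complex) \<Rightarrow> (real^'n \<Rightarrow> complex)) \<Rightarrow> real \<Rightarrow> real^'n \<Rightarrow>
     (real^'n \<Rightarrow> complex) \<Rightarrow> complex \<Rightarrow> bool" where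
  "fluid_mode \<beta> M Dt L \<eta> \<sigma> \<phi> \<mu> \<longleftrightarrow>
     \<phi> \<in> L2 (vmeas (wgt \<beta> M)) \<and>
     is_adjoint (vmeas M) (dom_adv \<beta> M Dt \<sigma>) (L_adv \<beta> L \<eta> \<sigma>)
       (\<lambda>v. e0 \<beta> v * \<phi> v) (\<lambda>v. - \<mu> * (e0 \<beta> v * \<phi> v)) \<and>
     (LINT v|vmeas (wgt \<beta> M). \<phi> v) = 1"

definition theta :: "ereal \<Rightarrow> real \<Rightarrow> real \<Rightarrow> real" where
  "theta \<alpha> \<beta> \<eta> =
     (if \<alpha> > ereal (2 + \<beta>) then \<eta>\<^sup>2
      else if \<alpha> = ereal (2 + \<beta>) then \<eta>\<^sup>2 * \<bar>ln \<eta>\<bar>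
      else \<eta> powr ((real_of_ereal \<alpha> + \<beta>) / (1 + \<beta>)))"

end

theory Submission
  imports Defs
begin

text \<open>
  Write \<open>e = e0 \<beta>\<close>, a unit vector, \<open>P\<close> for the projection onto it, and \<open>S\<close> for the adjoint of
  the advected operator. Well-posedness of the modes upgrades coercivity from the operator to \<open>S\<close>,
  so \<open>S + \<mu> - lam P\<close> is boundedly invertible for \<open>\<bar>\<mu>\<bar> < lam\<close>. With \<open>\<psi>\<^sub>\<mu>\<close> the solution of
  \<open>(S + \<mu> - lam P) \<psi>\<^sub>\<mu> = - lam e\<close> and \<open>c(\<mu>) = \<langle>\<psi>\<^sub>\<mu>, e\<rangle>\<close>, the eigenvalue problem is the scalar equation
  \<open>c(\<mu>) = 1\<close>, that is, the fixed point equation \<open>\<mu> = lam - (lam - \<mu>) c(\<mu>)\<close>. Testing with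
  \<open>e \<chi>\<^sub>R\<close>, on which the advected operator is small for \<open>R\<close> large and then \<open>\<eta>\<close> small, shows that the
  right-hand side is a contraction of a ball. Uniqueness, conjugation and rotation symmetry
  make \<open>\<mu>\<close> real. By coercivity \<open>\<phi> - 1\<close> has norm at most a multiple of the square root of \<open>\<mu>\<close>, so
  testing the eigenvalue equation with \<open>e \<chi>\<^sub>R\<close> bounds \<open>\<mu>\<close> from above, and testing with \<open>e \<chi>\<^sub>R\<close> times
  the velocity \<open>(v \<bullet> \<sigma>) jb(v)\<^sup>\<beta>\<close> (or, if \<open>\<alpha> > 2 + \<beta>\<close>, with an approximation of \<open>e\<close> times the
  velocity from the domain) bounds it from below. In the heavy-tailed cases \<open>R\<close> is a
  multiple of \<open>\<eta>\<close> to the power \<open>-1/(1 + \<beta>)\<close>, which balances the two terms of the operator.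
\<close>

section \<open>Square integrable functions\<close>

text \<open>The null vector \<open>e\<close> of the unperturbed operator need not lie in the domain
  of the advected one: \<open>vel \<beta> \<sigma>\<close> times \<open>e\<close> is square
  integrable only when \<alpha> > 2 + \<beta>. So 0 cannot be treated as an isolated eigenvalue
  under a small relatively bounded perturbation, and there is no expansion in \<eta> to start from.
  Each estimate uses instead an element of the domain near \<open>e\<close>, or near
  \<open>e\<close> times the velocity. The second obstacle is that the domain of the adjoint is
  known only through its definition. Equations for an eigenvector are therefore kept in weak form,
  tested against the domain of the operator and solved by orthogonal projection, and the gap of the
  adjoint comes from resolvent bounds and not from an integration by parts. The threshold
  \<open>lam / (8 + 16 * lam)\<close> for the approximation of \<open>e\<close> is the value for
  which the fixed point map has Lipschitz constant 1/2 on the ball of radius \<open>lam / 2\<close>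
  and takes values of modulus at most \<open>lam / 4\<close>.\<close>

lemma L2_measurable: "f \<in> L2 N \<Longrightarrow> f \<in> borel_measurable N"
  by (simp add: L2_def)

lemma L2_integrable: "f \<in> L2 N \<Longrightarrow> integrable N (\<lambda>v. (cmod (f v))\<^sup>2)"
  by (simp add: L2_def)

lemma L2I:
  assumes "f \<in> borel_measurable N" "integrable N h" "AE v in N. (cmod (f v))\<^sup>2 \<le> h v"
  shows "f \<in> L2 N"
  unfolding L2_def using assms
  by (auto intro!: Bochner_Integration.integrable_bound[OF assms(2)])

lemma L2_add:
  assumes "f \<in> L2 N" "g \<in> L2 N"
  shows "(\<lambda>v. f v + g v) \<in> L2 N"
proof (rule L2I)
  show "integrable N (\<lambda>v. 2 * (cmod (f v))\<^sup>2 + 2 * (cmod (g v))\<^sup>2)"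
    using assms by (auto simp: L2_def)
  have "(cmod (a + b))\<^sup>2 \<le> 2 * (cmod a)\<^sup>2 + 2 * (cmod b)\<^sup>2" for a b
  proof -
    have "(cmod (a + b))\<^sup>2 \<le> (cmod a + cmod b)\<^sup>2"
      by (simp add: norm_triangle_ineq power_mono)
    also have "\<dots> \<le> 2 * (cmod a)\<^sup>2 + 2 * (cmod b)\<^sup>2"
      using sum_squares_bound[of "cmod a" "cmod b"] by (simp add: power2_sum)
    finally show ?thesis .
  qed
  then show "AE v in N. (cmod (f v + g v))\<^sup>2 \<le> 2 * (cmod (f v))\<^sup>2 + 2 * (cmod (g v))\<^sup>2" by simp
qed (use assms in \<open>auto simp: L2_def\<close>)

lemma L2_scale: "f \<in> L2 N \<Longrightarrow> (\<lambda>v. a * f v) \<in> L2 N"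
  by (auto simp: L2_def norm_mult power_mult_distrib)

lemma L2_uminus: "f \<in> L2 N \<Longrightarrow> (\<lambda>v. - f v) \<in> L2 N"
  by (auto simp: L2_def)

lemma L2_diff: "f \<in> L2 N \<Longrightarrow> g \<in> L2 N \<Longrightarrow> (\<lambda>v. f v - g v) \<in> L2 N"
  using L2_add[of f N "\<lambda>v. - g v"] L2_uminus by fastforce

lemma L2_zero: "(\<lambda>_. 0) \<in> L2 N"
  by (simp add: L2_def)

lemma borel_measurable_cnj [measurable (raw)]:
  "f \<in> borel_measurable N \<Longrightarrow> (\<lambda>v. cnj (f v)) \<in> borel_measurable N"
  by (rule borel_measurable_continuous_on[of cnj]) (intro continuous_intros)

lemma L2_cnj: "f \<in> L2 N \<Longrightarrow> (\<lambda>v. cnj (f v)) \<in> L2 N"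
  by (auto simp: L2_def)

lemmas L2_intros = L2_add L2_scale L2_uminus L2_diff L2_zero

lemma ip_integrable:
  assumes "f \<in> L2 N" "g \<in> L2 N"
  shows "integrable N (\<lambda>v. f v * cnj (g v))"
proof (rule Bochner_Integration.integrable_bound)
  show "integrable N (\<lambda>v. (cmod (f v))\<^sup>2 + (cmod (g v))\<^sup>2)"
    using assms by (auto simp: L2_def)
  have "cmod a * cmod b \<le> (cmod a)\<^sup>2 + (cmod b)\<^sup>2" for a b
  proof -
    have "0 \<le> cmod a * cmod b" by simp
    then show ?thesis using sum_squares_bound[of "cmod a" "cmod b"] by linarith
  qed
  then show "AE v in N. norm (f v * cnj (g v)) \<le> norm ((cmod (f v))\<^sup>2 + (cmod (g v))\<^sup>2)"
    by (simp add: norm_mult)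
qed (use assms in \<open>auto simp: L2_def\<close>)

lemma ip_add_left:
  "f \<in> L2 N \<Longrightarrow> g \<in> L2 N \<Longrightarrow> h \<in> L2 N \<Longrightarrow> ip N (\<lambda>v. f v + g v) h = ip N f h + ip N g h"
  unfolding ip_def by (simp add: distrib_right ip_integrable)

lemma ip_diff_left:
  "f \<in> L2 N \<Longrightarrow> g \<in> L2 N \<Longrightarrow> h \<in> L2 N \<Longrightarrow> ip N (\<lambda>v. f v - g v) h = ip N f h - ip N g h"
  unfolding ip_def by (simp add: left_diff_distrib ip_integrable)

lemma ip_scale_left: "ip N (\<lambda>v. a * f v) h = a * ip N f h"
  unfolding ip_def by (simp add: mult.assoc)

lemma ip_uminus_left: "ip N (\<lambda>v. - f v) h = - ip N f h"
  unfolding ip_def by simp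

lemma ip_cnj: "cnj (ip N f g) = ip N g f"
  unfolding ip_def by (subst Bochner_Integration.integral_cnj[symmetric]) (simp add: mult.commute)

lemma ip_add_right:
  "f \<in> L2 N \<Longrightarrow> g \<in> L2 N \<Longrightarrow> h \<in> L2 N \<Longrightarrow> ip N h (\<lambda>v. f v + g v) = ip N h f + ip N h g"
  unfolding ip_def by (simp add: distrib_left ip_integrable)

lemma ip_diff_right:
  "f \<in> L2 N \<Longrightarrow> g \<in> L2 N \<Longrightarrow> h \<in> L2 N \<Longrightarrow> ip N h (\<lambda>v. f v - g v) = ip N h f - ip N h g"
  unfolding ip_def by (simp add: right_diff_distrib ip_integrable)

lemma ip_scale_right: "ip N h (\<lambda>v. a * f v) = cnj a * ip N h f"
  unfolding ip_def by (simp add: mult.left_commute)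

lemma ip_uminus_right: "ip N h (\<lambda>v. - f v) = - ip N h f"
  unfolding ip_def by simp

lemma ip_zero_right [simp]: "ip N h (\<lambda>v. 0) = 0"
  by (simp add: ip_def)

lemma ip_zero_left [simp]: "ip N (\<lambda>v. 0) h = 0"
  by (simp add: ip_def)

lemmas ip_simps = ip_add_left ip_diff_left ip_scale_left ip_uminus_left
  ip_add_right ip_diff_right ip_scale_right ip_uminus_right

lemma ip_cong_AE:
  assumes "AE v in N. f v = f' v" "AE v in N. g v = g' v"
    and "f \<in> L2 N" "g \<in> L2 N" "f' \<in> L2 N" "g' \<in> L2 N"
  shows "ip N f g = ip N f' g'"
  unfolding ip_def
  by (rule integral_cong_AE) (use assms in \<open>auto simp: L2_def\<close>)

lemma nrm_cong_AE:
  assumes "AE v in N. f v = g v" "f \<in> L2 N" "g \<in> L2 N"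
  shows "nrm N f = nrm N g"
  unfolding nrm_def
  by (rule arg_cong[where f = sqrt], rule integral_cong_AE) (use assms in \<open>auto simp: L2_def\<close>)

lemma nrm_nonneg [simp]: "0 \<le> nrm N f"
  by (simp add: nrm_def)

lemma nrm_sq: "(nrm N f)\<^sup>2 = (LINT v|N. (cmod (f v))\<^sup>2)"
  by (simp add: nrm_def)

lemma ip_self: "ip N f f = of_real ((nrm N f)\<^sup>2)"
  unfolding nrm_sq ip_def by (simp flip: integral_complex_of_real complex_norm_square)

lemma nrm_scale: "nrm N (\<lambda>v. a * f v) = cmod a * nrm N f"
  by (simp add: nrm_def norm_mult power_mult_distrib real_sqrt_mult)

lemma nrm_uminus [simp]: "nrm N (\<lambda>v. - f v) = nrm N f"
  by (simp add: nrm_def)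

lemma nrm_minus_commute: "nrm N (\<lambda>v. f v - g v) = nrm N (\<lambda>v. g v - f v)"
  by (simp add: nrm_def norm_minus_commute)

lemma nrm_add_sq:
  assumes "f \<in> L2 N" "g \<in> L2 N"
  shows "(nrm N (\<lambda>v. f v + g v))\<^sup>2 = (nrm N f)\<^sup>2 + 2 * Re (ip N f g) + (nrm N g)\<^sup>2"
proof -
  have "ip N (\<lambda>v. f v + g v) (\<lambda>v. f v + g v) = ip N f f + (ip N f g + cnj (ip N f g)) + ip N g g"
    using assms by (simp add: ip_simps L2_intros ip_cnj)
  then have "complex_of_real ((nrm N (\<lambda>v. f v + g v))\<^sup>2) =
      of_real ((nrm N f)\<^sup>2 + 2 * Re (ip N f g) + (nrm N g)\<^sup>2)"
    by (simp add: ip_self complex_add_cnj)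
  then show ?thesis using of_real_eq_iff by blast
qed

lemma nrm_diff_sq:
  assumes "f \<in> L2 N" "g \<in> L2 N"
  shows "(nrm N (\<lambda>v. f v - g v))\<^sup>2 = (nrm N f)\<^sup>2 - 2 * Re (ip N f g) + (nrm N g)\<^sup>2"
  using nrm_add_sq[of f N "\<lambda>v. - g v"] assms by (simp add: L2_uminus ip_uminus_right)

lemma nrm_eq_0_imp_AE:
  assumes "f \<in> L2 N" "nrm N f = 0"
  shows "AE v in N. f v = 0"
proof -
  have "(LINT v|N. (cmod (f v))\<^sup>2) = 0" using assms by (simp flip: nrm_sq)
  then show ?thesis
    using integral_nonneg_eq_0_iff_AE[OF L2_integrable[OF assms(1)]] by auto
qed

lemma cauchy_schwarz:
  assumes "f \<in> L2 N" "g \<in> L2 N"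
  shows "cmod (ip N f g) \<le> nrm N f * nrm N g"
proof (cases "nrm N g = 0")
  case True
  have "AE v in N. g v = 0" by (rule nrm_eq_0_imp_AE) (use assms True in auto)
  then have "ip N f g = ip N f (\<lambda>_. 0)"
    by (intro ip_cong_AE) (use assms in \<open>auto simp: L2_intros\<close>)
  then show ?thesis by simp
next
  case False
  define t where "t = ip N f g / of_real ((nrm N g)\<^sup>2)"
  have "0 \<le> (nrm N (\<lambda>v. f v - t * g v))\<^sup>2" by simp
  also have "\<dots> = (nrm N f)\<^sup>2 - 2 * Re (cnj t * ip N f g) + (cmod t)\<^sup>2 * (nrm N g)\<^sup>2"
    using assms by (simp add: nrm_diff_sq L2_intros ip_scale_right nrm_scale power_mult_distrib)
  also have "cnj t * ip N f g = of_real ((cmod (ip N f g))\<^sup>2 / (nrm N g)\<^sup>2)"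
    using False complex_norm_square[of "ip N f g"] unfolding t_def
    by (simp add: mult.commute)
  also have "(cmod t)\<^sup>2 * (nrm N g)\<^sup>2 = (cmod (ip N f g))\<^sup>2 / (nrm N g)\<^sup>2"
  proof -
    have "cmod t = cmod (ip N f g) / (nrm N g)\<^sup>2" by (simp add: t_def norm_divide norm_power)
    then show ?thesis using False by (simp add: power2_eq_square)
  qed
  finally have "(cmod (ip N f g))\<^sup>2 / (nrm N g)\<^sup>2 \<le> (nrm N f)\<^sup>2"
    by simp
  then have "(cmod (ip N f g))\<^sup>2 \<le> (nrm N f * nrm N g)\<^sup>2"
    using False by (simp add: field_simps power_mult_distrib)
  then show ?thesis by (rule power2_le_imp_le) simp
qed

lemma nrm_triangle:
  assumes "f \<in> L2 N" "g \<in> L2 N"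
  shows "nrm N (\<lambda>v. f v + g v) \<le> nrm N f + nrm N g"
proof (rule power2_le_imp_le)
  have "Re (ip N f g) \<le> nrm N f * nrm N g"
    using cauchy_schwarz[OF assms] complex_Re_le_cmod order_trans by blast
  then show "(nrm N (\<lambda>v. f v + g v))\<^sup>2 \<le> (nrm N f + nrm N g)\<^sup>2"
    using assms by (simp add: nrm_add_sq power2_sum)
qed simp

lemma nrm_triangle_diff:
  assumes "f \<in> L2 N" "g \<in> L2 N"
  shows "nrm N (\<lambda>v. f v - g v) \<le> nrm N f + nrm N g"
  using nrm_triangle[of f N "\<lambda>v. - g v"] assms by (simp add: L2_uminus)

lemma nrm_diff_trans:
  assumes "f \<in> L2 N" "g \<in> L2 N" "h \<in> L2 N"
  shows "nrm N (\<lambda>v. f v - h v) \<le> nrm N (\<lambda>v. f v - g v) + nrm N (\<lambda>v. g v - h v)"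
  using nrm_triangle[of "\<lambda>v. f v - g v" N "\<lambda>v. g v - h v"] assms by (simp add: L2_intros)

lemma nrm_le_add_diff:
  assumes "f \<in> L2 N" "g \<in> L2 N"
  shows "nrm N f \<le> nrm N g + nrm N (\<lambda>v. f v - g v)"
  using nrm_triangle[of g N "\<lambda>v. f v - g v"] assms by (simp add: L2_intros)

lemma nrm_le_scale:
  assumes "f \<in> L2 N" "g \<in> borel_measurable N" "AE v in N. cmod (g v) \<le> C * cmod (f v)" "0 \<le> C"
  shows "g \<in> L2 N" "nrm N g \<le> C * nrm N f"
proof -
  have i: "integrable N (\<lambda>v. C\<^sup>2 * (cmod (f v))\<^sup>2)" using assms by (auto simp: L2_def)
  have le: "AE v in N. (cmod (g v))\<^sup>2 \<le> C\<^sup>2 * (cmod (f v))\<^sup>2"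
    using assms(3) by eventually_elim (metis norm_ge_zero power_mono power_mult_distrib)
  show g: "g \<in> L2 N" by (rule L2I[OF assms(2) i le])
  have "(nrm N g)\<^sup>2 \<le> (C * nrm N f)\<^sup>2"
    unfolding nrm_sq power_mult_distrib
    using integral_mono_AE[OF L2_integrable[OF g] i le] by simp
  then show "nrm N g \<le> C * nrm N f"
    by (rule power2_le_imp_le) (use assms in simp)
qed

section \<open>Completeness and projection\<close>

text \<open>
  For an infinite measure, \<open>L\<^sup>2\<close> is not contained in \<open>L\<^sup>1\<close>; multiplication by a fixed square
  integrable function without zeros reduces completeness to convergence in \<open>L\<^sup>1\<close>.
\<close>

lemma L2_complete:
  assumes e: "e \<in> L2 N" "\<And>v. e v \<noteq> 0"
    and s: "\<And>n. s n \<in> L2 N"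
    and C: "\<And>\<epsilon>. \<epsilon> > 0 \<Longrightarrow> \<exists>n0. \<forall>i\<ge>n0. \<forall>j\<ge>n0. nrm N (\<lambda>v. s i v - s j v) < \<epsilon>"
  shows "\<exists>f\<in>L2 N. (\<lambda>n. nrm N (\<lambda>v. s n v - f v)) \<longlonglongrightarrow> 0"
proof -
  define t where "t n v = s n v * cnj (e v)" for n v
  have t_int: "integrable N (t n)" for n
    unfolding t_def by (intro ip_integrable s e)
  have "\<exists>n0. \<forall>i\<ge>n0. \<forall>j\<ge>n0. (LINT v|N. norm (t i v - t j v)) < \<epsilon>" if "\<epsilon> > 0" for \<epsilon>
  proof -
    have "0 < \<epsilon> / (nrm N e + 1)" using that by (simp add: add_nonneg_pos)
    then obtain n0 where n0: "\<And>i j. i \<ge> n0 \<Longrightarrow> j \<ge> n0 \<Longrightarrow> nrm N (\<lambda>v. s i v - s j v) < \<epsilon> / (nrm N e + 1)"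
      using C by blast
    have "(LINT v|N. norm (t i v - t j v)) < \<epsilon>" if ij: "i \<ge> n0" "j \<ge> n0" for i j
    proof -
      have a: "(\<lambda>v. complex_of_real (cmod (s i v - s j v))) \<in> L2 N"
        using L2_diff[OF s s, of i j] unfolding L2_def by auto
      have b: "(\<lambda>v. complex_of_real (cmod (e v))) \<in> L2 N"
        using e(1) unfolding L2_def by auto
      have "(LINT v|N. norm (t i v - t j v)) = Re (ip N (\<lambda>v. complex_of_real (cmod (s i v - s j v))) (\<lambda>v. complex_of_real (cmod (e v))))"
        unfolding ip_def t_def by (simp flip: of_real_mult left_diff_distrib add: norm_mult)
      also have "\<dots> \<le> nrm N (\<lambda>v. s i v - s j v) * nrm N e"
        using order_trans[OF complex_Re_le_cmod cauchy_schwarz[OF a b]] by (simp add: nrm_def)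
      also have "\<dots> \<le> \<epsilon> / (nrm N e + 1) * nrm N e"
        using n0[OF ij] by (intro mult_right_mono) auto
      also have "\<dots> < \<epsilon>"
      proof -
        have "nrm N e + 1 > 0" by (simp add: add_nonneg_pos)
        then show ?thesis using \<open>\<epsilon> > 0\<close> by (simp add: pos_divide_less_eq distrib_left)
      qed
      finally show ?thesis .
    qed
    then show ?thesis by blast
  qed
  then obtain r where r: "strict_mono r" "AE v in N. Cauchy (\<lambda>i. t (r i) v)"
    using cauchy_L1_AE_cauchy_subseq[of N t] t_int by metis
  define f where "f v = lim (\<lambda>i. s (r i) v)" for v
  have lim: "AE v in N. (\<lambda>i. s (r i) v) \<longlonglongrightarrow> f v"
    using r(2)
  proof eventually_elim
    case (elim v)
    then have "convergent (\<lambda>i. t (r i) v)" by (simp add: Cauchy_convergent_iff)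
    then have "convergent (\<lambda>i. t (r i) v * (1 / cnj (e v)))"
      by (intro convergent_mult convergent_const)
    then have "convergent (\<lambda>i. s (r i) v)" using e(2) unfolding t_def by simp
    then show ?case unfolding f_def by (simp add: convergent_LIMSEQ_iff)
  qed
  have sm: "s n \<in> borel_measurable N" for n using s by (rule L2_measurable)
  have f_meas: "f \<in> borel_measurable N"
    unfolding f_def by (intro borel_measurable_lim_metric sm)
  have key: "(\<lambda>v. s n v - f v) \<in> L2 N \<and> nrm N (\<lambda>v. s n v - f v) \<le> \<epsilon>"
    if "\<epsilon> > 0" and n0: "\<And>i j. i \<ge> n0 \<Longrightarrow> j \<ge> n0 \<Longrightarrow> nrm N (\<lambda>v. s i v - s j v) < \<epsilon>" and "n \<ge> n0" for \<epsilon> n0 n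
  proof -
    \<comment> \<open>Fatou's lemma along the subsequence turns the Cauchy estimate into a bound on
      the distance to the pointwise limit \<open>f\<close>.\<close>
    have "(\<integral>\<^sup>+v. ennreal ((cmod (s n v - f v))\<^sup>2) \<partial>N) = (\<integral>\<^sup>+v. liminf (\<lambda>i. ennreal ((cmod (s n v - s (r i) v))\<^sup>2)) \<partial>N)"
    proof (rule nn_integral_cong_AE, use lim in eventually_elim)
      fix v assume "(\<lambda>i. s (r i) v) \<longlonglongrightarrow> f v"
      then have "(\<lambda>i. ennreal ((cmod (s n v - s (r i) v))\<^sup>2)) \<longlonglongrightarrow> ennreal ((cmod (s n v - f v))\<^sup>2)"
        by (intro tendsto_ennrealI tendsto_intros)
      then show "ennreal ((cmod (s n v - f v))\<^sup>2) = liminf (\<lambda>i. ennreal ((cmod (s n v - s (r i) v))\<^sup>2))"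
        by (rule lim_imp_Liminf[OF trivial_limit_sequentially, symmetric])
    qed
    also have "\<dots> \<le> liminf (\<lambda>i. (\<integral>\<^sup>+v. ennreal ((cmod (s n v - s (r i) v))\<^sup>2) \<partial>N))"
      using sm by (intro nn_integral_liminf) measurable
    also have "\<dots> \<le> ennreal (\<epsilon>\<^sup>2)"
    proof (rule Liminf_le, simp, rule eventually_sequentiallyI)
      fix i assume "i \<ge> n0"
      then have "r i \<ge> n0" using seq_suble[OF r(1), of i] by simp
      have "(\<integral>\<^sup>+v. ennreal ((cmod (s n v - s (r i) v))\<^sup>2) \<partial>N) = ennreal (LINT v|N. (cmod (s n v - s (r i) v))\<^sup>2)"
        using L2_diff[OF s s, of n "r i"] by (intro nn_integral_eq_integral) (auto simp: L2_def)
      also have "\<dots> \<le> ennreal (\<epsilon>\<^sup>2)"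
        unfolding nrm_sq[symmetric]
        using n0[OF \<open>n \<ge> n0\<close> \<open>r i \<ge> n0\<close>] by (intro ennreal_leI power_mono) auto
      finally show "(\<integral>\<^sup>+v. ennreal ((cmod (s n v - s (r i) v))\<^sup>2) \<partial>N) \<le> ennreal (\<epsilon>\<^sup>2)" .
    qed
    finally have le: "(\<integral>\<^sup>+v. ennreal ((cmod (s n v - f v))\<^sup>2) \<partial>N) \<le> ennreal (\<epsilon>\<^sup>2)" .
    then have int: "integrable N (\<lambda>v. (cmod (s n v - f v))\<^sup>2)"
      using sm f_meas by (intro integrableI_bounded) (auto simp: le_less_trans[OF le])
    then have L2: "(\<lambda>v. s n v - f v) \<in> L2 N"
      using sm f_meas by (auto simp: L2_def)
    have "ennreal ((nrm N (\<lambda>v. s n v - f v))\<^sup>2) \<le> ennreal (\<epsilon>\<^sup>2)"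
      unfolding nrm_sq using le nn_integral_eq_integral[OF int] by simp
    then have "(nrm N (\<lambda>v. s n v - f v))\<^sup>2 \<le> \<epsilon>\<^sup>2" by (rule ennreal_le_iff[THEN iffD1, rotated]) simp
    then have "nrm N (\<lambda>v. s n v - f v) \<le> \<epsilon>"
      by (rule power2_le_imp_le) (use \<open>\<epsilon> > 0\<close> in simp)
    with L2 show ?thesis by simp
  qed
  obtain n1 where n1: "\<And>i j. i \<ge> n1 \<Longrightarrow> j \<ge> n1 \<Longrightarrow> nrm N (\<lambda>v. s i v - s j v) < 1"
    using C[OF zero_less_one] by blast
  have "(\<lambda>v. s n1 v - f v) \<in> L2 N" using key[OF zero_less_one n1 order_refl] by simp
  from L2_diff[OF s[of n1] this] have f: "f \<in> L2 N" by simp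
  have "(\<lambda>n. nrm N (\<lambda>v. s n v - f v)) \<longlonglongrightarrow> 0"
  proof (rule LIMSEQ_I)
    fix \<epsilon> :: real assume "\<epsilon> > 0"
    then have "\<epsilon> / 2 > 0" by simp
    from C[OF this] obtain n0 where "\<And>i j. i \<ge> n0 \<Longrightarrow> j \<ge> n0 \<Longrightarrow> nrm N (\<lambda>v. s i v - s j v) < \<epsilon> / 2"
      by blast
    from key[OF \<open>\<epsilon> / 2 > 0\<close> this] show "\<exists>n0. \<forall>n\<ge>n0. norm (nrm N (\<lambda>v. s n v - f v) - 0) < \<epsilon>"
      using \<open>\<epsilon> > 0\<close> by (intro exI[of _ n0]) fastforce
  qed
  with f show ?thesis by blast
qed

definition subspace_L2 :: "'a measure \<Rightarrow> ('a \<Rightarrow> complex) set \<Rightarrow> bool" where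
  "subspace_L2 N V \<longleftrightarrow> V \<subseteq> L2 N \<and> V \<noteq> {} \<and> (\<forall>f\<in>V. \<forall>g\<in>V. \<forall>a b. (\<lambda>v. a * f v + b * g v) \<in> V)"

text \<open>A minimising sequence for the distance from \<open>f\<close> to \<open>V\<close> is
  Cauchy by the parallelogram law. In the applications \<open>V\<close> is a range, with no reason
  to be closed, so the nearest point \<open>q\<close> is placed only in the closure; the second
  conclusion records this.\<close>

lemma projection_L2:
  assumes e: "e \<in> L2 N" "\<And>v. e v \<noteq> 0"
    and V: "subspace_L2 N V" and f: "f \<in> L2 N"
  shows "\<exists>q\<in>L2 N. (\<forall>g\<in>V. ip N g (\<lambda>v. f v - q v) = 0) \<and>
    (\<forall>\<epsilon>>0. \<exists>g\<in>V. nrm N (\<lambda>v. g v - q v) < \<epsilon>)"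
proof -
  have VL: "\<And>g. g \<in> V \<Longrightarrow> g \<in> L2 N"
    and V_lin: "\<And>g h a b. g \<in> V \<Longrightarrow> h \<in> V \<Longrightarrow> (\<lambda>v. a * g v + b * h v) \<in> V"
    and V_ne: "V \<noteq> {}"
    using V unfolding subspace_L2_def by auto
  define d where "d = (INF g\<in>V. (nrm N (\<lambda>v. f v - g v))\<^sup>2)"
  have bdd: "bdd_below ((\<lambda>g. (nrm N (\<lambda>v. f v - g v))\<^sup>2) ` V)" by (intro bdd_belowI[of _ 0]) auto
  have d_le: "d \<le> (nrm N (\<lambda>v. f v - g v))\<^sup>2" if "g \<in> V" for g
    unfolding d_def by (rule cINF_lower[OF bdd that])
  have "\<exists>g\<in>V. (nrm N (\<lambda>v. f v - g v))\<^sup>2 < d + 1 / Suc n" for n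
    using cINF_less_iff[OF V_ne bdd, of "d + 1 / Suc n"] unfolding d_def by simp
  then obtain s where s: "\<And>n. s n \<in> V" "\<And>n. (nrm N (\<lambda>v. f v - s n v))\<^sup>2 < d + 1 / Suc n"
    by metis
  \<comment> \<open>The midpoint of \<open>s i\<close> and \<open>s j\<close> is in
    \<open>V\<close>, so its squared distance to \<open>f\<close> is at least \<open>d\<close>; the
    parallelogram law then leaves little room for the other diagonal.\<close>
  have par: "(nrm N (\<lambda>v. s i v - s j v))\<^sup>2 \<le> 2 / Suc i + 2 / Suc j" for i j
  proof -
    let ?a = "\<lambda>v. f v - s i v" and ?b = "\<lambda>v. f v - s j v"
    have ab: "?a \<in> L2 N" "?b \<in> L2 N" using f s VL by (auto intro: L2_diff)
    have "(nrm N (\<lambda>v. ?a v - ?b v))\<^sup>2 + (nrm N (\<lambda>v. ?a v + ?b v))\<^sup>2 = 2 * (nrm N ?a)\<^sup>2 + 2 * (nrm N ?b)\<^sup>2"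
      by (simp only: nrm_add_sq[OF ab] nrm_diff_sq[OF ab])
    moreover have "(nrm N (\<lambda>v. ?a v - ?b v))\<^sup>2 = (nrm N (\<lambda>v. s i v - s j v))\<^sup>2"
      by (subst nrm_minus_commute) simp
    moreover have "(nrm N (\<lambda>v. ?a v + ?b v))\<^sup>2 = 4 * (nrm N (\<lambda>v. f v - (1/2 * s i v + 1/2 * s j v)))\<^sup>2"
    proof -
      have "nrm N (\<lambda>v. ?a v + ?b v) = nrm N (\<lambda>v. 2 * (f v - (1/2 * s i v + 1/2 * s j v)))"
        by (rule arg_cong[where f = "nrm N"]) (auto simp: algebra_simps)
      then show ?thesis unfolding nrm_scale by (simp add: power_mult_distrib)
    qed
    moreover have "d \<le> (nrm N (\<lambda>v. f v - (1/2 * s i v + 1/2 * s j v)))\<^sup>2"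
      by (intro d_le V_lin s)
    moreover have "2 / real (Suc i) = 2 * (1 / real (Suc i))" "2 / real (Suc j) = 2 * (1 / real (Suc j))" by simp_all
    ultimately show ?thesis using s(2)[of i] s(2)[of j] by linarith
  qed
  have "\<exists>n0. \<forall>i\<ge>n0. \<forall>j\<ge>n0. nrm N (\<lambda>v. s i v - s j v) < \<epsilon>" if "\<epsilon> > 0" for \<epsilon>
  proof -
    obtain n0 :: nat where n0: "4 / \<epsilon>\<^sup>2 < n0" using reals_Archimedean2 by blast
    have "nrm N (\<lambda>v. s i v - s j v) < \<epsilon>" if "i \<ge> n0" "j \<ge> n0" for i j
    proof -
      have n0p: "real n0 > 0" using n0 \<open>\<epsilon> > 0\<close> by (meson divide_pos_pos less_trans zero_less_numeral zero_less_power)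
      have "2 / real (Suc i) \<le> 2 / n0" "2 / real (Suc j) \<le> 2 / n0"
        using that n0p by (auto intro!: divide_left_mono)
      then have "(nrm N (\<lambda>v. s i v - s j v))\<^sup>2 \<le> 4 / n0" using par[of i j] by simp
      also have "\<dots> < \<epsilon>\<^sup>2" using n0 \<open>\<epsilon> > 0\<close> n0p by (simp add: field_simps)
      finally show ?thesis using power2_less_imp_less less_imp_le[OF \<open>\<epsilon> > 0\<close>] by blast
    qed
    then show ?thesis by blast
  qed
  from L2_complete[OF e VL[OF s(1)] this]
  obtain q where q: "q \<in> L2 N" "(\<lambda>n. nrm N (\<lambda>v. s n v - q v)) \<longlonglongrightarrow> 0" by blast
  have r: "(\<lambda>v. f v - q v) \<in> L2 N" using f q by (simp add: L2_diff)
  have dist_q: "(nrm N (\<lambda>v. f v - q v))\<^sup>2 \<le> d"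
  proof -
    have "nrm N (\<lambda>v. f v - q v) \<le> sqrt (d + 1 / Suc n) + nrm N (\<lambda>v. s n v - q v)" for n
    proof -
      have "nrm N (\<lambda>v. f v - s n v) \<le> sqrt (d + 1 / Suc n)"
        using s(2)[of n] by (simp add: less_imp_le real_le_rsqrt)
      then show ?thesis
        using nrm_diff_trans[of f N "s n" q] f q VL[OF s(1)] by fastforce
    qed
    moreover have "(\<lambda>n. sqrt (d + 1 / Suc n) + nrm N (\<lambda>v. s n v - q v)) \<longlonglongrightarrow> sqrt (d + 0) + 0"
      by (intro tendsto_intros q lim_1_over_n[THEN LIMSEQ_Suc])
    ultimately have "nrm N (\<lambda>v. f v - q v) \<le> sqrt (d + 0) + 0"
      by (intro LIMSEQ_le_const) auto
    then have "nrm N (\<lambda>v. f v - q v) \<le> sqrt d" by simp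
    moreover have "0 \<le> d" unfolding d_def by (intro cINF_greatest V_ne) auto
    ultimately show ?thesis using power_mono[of "nrm N (\<lambda>v. f v - q v)" "sqrt d" 2] by simp
  qed
  have orth: "ip N g (\<lambda>v. f v - q v) = 0" if g: "g \<in> V" for g
  proof -
    have gL: "g \<in> L2 N" using g VL by blast
    define z where "z = ip N (\<lambda>v. f v - q v) g"
    \<comment> \<open>Minimality is available only for elements of \<open>V\<close>; it is applied
      to \<open>s n\<close> plus \<open>t\<close> times \<open>g\<close> and passes to the limit
      \<open>q\<close>.\<close>
    have low: "d \<le> (nrm N (\<lambda>v. (f v - q v) - t * g v))\<^sup>2" for t
    proof -
      have "d \<le> (nrm N (\<lambda>v. (f v - q v) - t * g v) + nrm N (\<lambda>v. s n v - q v))\<^sup>2" for n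
      proof -
        have "d \<le> (nrm N (\<lambda>v. f v - (1 * s n v + t * g v)))\<^sup>2" by (intro d_le V_lin s g)
        also have "\<dots> \<le> (nrm N (\<lambda>v. (f v - q v) - t * g v) + nrm N (\<lambda>v. s n v - q v))\<^sup>2"
        proof (rule power_mono)
          have "nrm N (\<lambda>v. ((f v - q v) - t * g v) - (s n v - q v)) \<le>
             nrm N (\<lambda>v. (f v - q v) - t * g v) + nrm N (\<lambda>v. s n v - q v)"
            by (intro nrm_triangle_diff L2_intros r gL VL s q)
          moreover have "(\<lambda>v. ((f v - q v) - t * g v) - (s n v - q v)) = (\<lambda>v. f v - (1 * s n v + t * g v))"
            by (auto simp: algebra_simps)
          ultimately show "nrm N (\<lambda>v. f v - (1 * s n v + t * g v)) \<le>
             nrm N (\<lambda>v. (f v - q v) - t * g v) + nrm N (\<lambda>v. s n v - q v)" by simp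
        qed simp
        finally show ?thesis .
      qed
      moreover have "(\<lambda>n. (nrm N (\<lambda>v. (f v - q v) - t * g v) + nrm N (\<lambda>v. s n v - q v))\<^sup>2) \<longlonglongrightarrow>
          (nrm N (\<lambda>v. (f v - q v) - t * g v) + 0)\<^sup>2"
        by (intro tendsto_intros q)
      ultimately have "d \<le> (nrm N (\<lambda>v. (f v - q v) - t * g v) + 0)\<^sup>2"
        by (intro LIMSEQ_le_const) auto
      then show ?thesis by simp
    qed
    \<comment> \<open>Moving from \<open>q\<close> by \<open>z / G\<close> times \<open>g\<close>
      would lower the squared distance by at least \<open>(cmod z)\<^sup>2 / G\<close>. The added 1
      keeps \<open>G\<close> positive for a null \<open>g\<close>.\<close>
    define G where "G = (nrm N g)\<^sup>2 + 1"
    have G: "G > 0" unfolding G_def by (simp add: add_nonneg_pos)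
    have "d \<le> (nrm N (\<lambda>v. f v - q v))\<^sup>2 - 2 * Re (cnj (z / of_real G) * z) + (cmod (z / of_real G))\<^sup>2 * (nrm N g)\<^sup>2"
      using low[of "z / of_real G"]
      unfolding nrm_diff_sq[OF r L2_scale[OF gL]] ip_scale_right nrm_scale power_mult_distrib z_def .
    moreover have "Re (cnj (z / of_real G) * z) = (cmod z)\<^sup>2 / G"
      using cmod_power2[of z] by (simp add: power2_eq_square flip: add_divide_distrib)
    moreover have "(cmod (z / of_real G))\<^sup>2 * (nrm N g)\<^sup>2 \<le> (cmod z)\<^sup>2 / G"
    proof -
      have "(nrm N g)\<^sup>2 \<le> G" by (simp add: G_def)
      then have "(cmod (z / of_real G))\<^sup>2 * (nrm N g)\<^sup>2 \<le> (cmod (z / of_real G))\<^sup>2 * G"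
        by (intro mult_left_mono) auto
      also have "\<dots> = (cmod z)\<^sup>2 / G" using G by (simp add: norm_divide power_divide power2_eq_square)
      finally show ?thesis .
    qed
    ultimately have "(cmod z)\<^sup>2 / G \<le> 0" using dist_q by linarith
    then have "z = 0" using G by (simp add: divide_le_0_iff)
    then show ?thesis using ip_cnj[of N "\<lambda>v. f v - q v" g] unfolding z_def by simp
  qed
  have "\<exists>g\<in>V. nrm N (\<lambda>v. g v - q v) < \<epsilon>" if "\<epsilon> > 0" for \<epsilon>
  proof -
    obtain n0 where "\<forall>n\<ge>n0. norm (nrm N (\<lambda>v. s n v - q v) - 0) < \<epsilon>"
      using LIMSEQ_D[OF q(2) \<open>\<epsilon> > 0\<close>] by blast
    then show ?thesis using s(1)[of n0] by (intro bexI[of _ "s n0"]) auto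
  qed
  with orth q(1) show ?thesis by blast
qed

section \<open>Eigenvalues of perturbed dissipative operators\<close>

text \<open>\<open>e\<close> need not belong to \<open>Dom\<close>, so \<open>gap\<close> measures
  the component of \<open>g\<close> orthogonal to \<open>e\<close> and says nothing of
  \<open>T e\<close>. \<open>adjoint_dissipative\<close> is the half of maximal dissipativity that
  coercivity on \<open>Dom\<close> cannot supply.\<close>

locale gap_operator =
  fixes N :: "'a measure" and e :: "'a \<Rightarrow> complex" and Dom T and lam :: real
  assumes e_L2: "e \<in> L2 N" and e_nz: "e v \<noteq> 0" and e_nrm: "nrm N e = 1"
    and lam_pos: "lam > 0"
    and Dom: "subspace_L2 N Dom"
    and T_L2: "g \<in> Dom \<Longrightarrow> T g \<in> L2 N"
    and T_lin: "f \<in> Dom \<Longrightarrow> g \<in> Dom \<Longrightarrow>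
      AE v in N. T (\<lambda>u. a * f u + b * g u) v = a * T f v + b * T g v"
    and gap: "g \<in> Dom \<Longrightarrow> Re (ip N (T g) g) \<le> - lam * (nrm N (\<lambda>v. g v - ip N g e * e v))\<^sup>2"
    and adjoint_dissipative: "is_adjoint N Dom T \<psi> \<zeta> \<Longrightarrow> Re (ip N \<zeta> \<psi>) \<le> 0"
begin

section \<open>Rank one perturbation of an operator with a spectral gap\<close>

lemma Dom_L2: "g \<in> Dom \<Longrightarrow> g \<in> L2 N"
  using Dom by (auto simp: subspace_L2_def)

lemma Dom_lin: "f \<in> Dom \<Longrightarrow> g \<in> Dom \<Longrightarrow> (\<lambda>v. a * f v + b * g v) \<in> Dom"
  using Dom by (auto simp: subspace_L2_def)

lemma ip_e_e: "ip N e e = 1"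
  by (simp add: ip_self e_nrm)

lemma pythagoras:
  assumes "g \<in> L2 N"
  shows "(nrm N g)\<^sup>2 = (cmod (ip N g e))\<^sup>2 + (nrm N (\<lambda>v. g v - ip N g e * e v))\<^sup>2"
  unfolding nrm_diff_sq[OF assms L2_scale[OF e_L2]] ip_scale_right nrm_scale
  using cmod_power2[of "ip N g e"] by (simp add: e_nrm power2_eq_square)

lemma ip_complement_self:
  assumes "g \<in> L2 N"
  shows "Re (ip N (\<lambda>v. g v - ip N g e * e v) g) = (nrm N (\<lambda>v. g v - ip N g e * e v))\<^sup>2"
proof -
  have "ip N (\<lambda>v. g v - ip N g e * e v) g = ip N g g - ip N g e * cnj (ip N g e)"
    using assms by (simp add: ip_simps L2_intros e_L2 ip_cnj)
  also have "Re \<dots> = (nrm N g)\<^sup>2 - (cmod (ip N g e))\<^sup>2"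
    using cmod_power2[of "ip N g e"] by (simp add: ip_self power2_eq_square)
  finally show ?thesis using pythagoras[OF assms] by simp
qed

text \<open>
  The rank one term turns the spectral gap into coercivity on the whole space. The second slot
  of \<open>ip\<close> is conjugate linear, whence \<open>cnj a\<close> on the side of the adjoint.
\<close>

definition A :: "complex \<Rightarrow> ('a \<Rightarrow> complex) \<Rightarrow> 'a \<Rightarrow> complex" where
  "A a g = (\<lambda>v. T g v + a * g v - of_real lam * ip N g e * e v)"

lemma A_L2: "g \<in> Dom \<Longrightarrow> A a g \<in> L2 N"
  unfolding A_def by (intro L2_intros T_L2 Dom_L2 e_L2)

lemma A_lin:
  assumes "f \<in> Dom" "g \<in> Dom"
  shows "AE v in N. A a (\<lambda>u. b * f u + c * g u) v = b * A a f v + c * A a g v"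
  using T_lin[OF assms, of b c]
proof eventually_elim
  case (elim v)
  have "ip N (\<lambda>u. b * f u + c * g u) e = b * ip N f e + c * ip N g e"
    using assms by (simp add: ip_simps L2_intros e_L2 Dom_L2)
  with elim show ?case unfolding A_def by (simp add: algebra_simps)
qed

lemma ip_A_lin:
  assumes "f \<in> Dom" "g \<in> Dom" "h \<in> L2 N"
  shows "ip N (A a (\<lambda>u. b * f u + c * g u)) h = b * ip N (A a f) h + c * ip N (A a g) h"
proof -
  have "ip N (A a (\<lambda>u. b * f u + c * g u)) h = ip N (\<lambda>v. b * A a f v + c * A a g v) h"
    by (intro ip_cong_AE A_lin A_L2 Dom_lin L2_intros assms) auto
  then show ?thesis using assms by (simp add: ip_simps L2_intros A_L2)
qed

text \<open>In the real part of \<open>ip N (A a g) g\<close> the gap controls the component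
  orthogonal to \<open>e\<close> and the rank one term controls the component along
  \<open>e\<close>, both with constant \<open>lam\<close>; they add up to the full norm, and
  Cauchy-Schwarz removes one factor.\<close>

lemma A_coercive:
  assumes "g \<in> Dom"
  shows "(lam - Re a) * nrm N g \<le> nrm N (A a g)"
proof -
  have g: "g \<in> L2 N" using assms by (rule Dom_L2)
  have "ip N (A a g) g = ip N (T g) g + a * of_real ((nrm N g)\<^sup>2) - of_real lam * of_real ((cmod (ip N g e))\<^sup>2)"
    unfolding A_def using g T_L2[OF assms]
    by (simp add: ip_simps L2_intros e_L2 ip_self complex_norm_square ip_cnj[symmetric, of N e g] del: of_real_power)
  then have "Re (ip N (A a g) g) = Re (ip N (T g) g) + Re a * (nrm N g)\<^sup>2 - lam * (cmod (ip N g e))\<^sup>2"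
    by (simp del: of_real_power)
  then have "(lam - Re a) * (nrm N g)\<^sup>2 \<le> - Re (ip N (A a g) g)"
    using gap[OF assms] pythagoras[OF g] by (simp add: algebra_simps)
  also have "\<dots> \<le> cmod (ip N (A a g) g)" using abs_Re_le_cmod[of "ip N (A a g) g"] by linarith
  also have "\<dots> \<le> nrm N (A a g) * nrm N g" by (intro cauchy_schwarz A_L2 assms g)
  finally have *: "((lam - Re a) * nrm N g) * nrm N g \<le> nrm N (A a g) * nrm N g"
    by (simp add: power2_eq_square mult.assoc)
  show ?thesis
  proof (cases "nrm N g = 0")
    case False
    then have "nrm N g > 0" using nrm_nonneg[of N g] by linarith
    then show ?thesis using * by (rule mult_right_le_imp_le[rotated])
  qed simp
qed

lemma A_adjoint:
  assumes "is_adjoint N Dom T \<psi> \<zeta>" "g \<in> Dom"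
  shows "ip N (A a g) \<psi> = ip N g (\<lambda>v. \<zeta> v + cnj a * \<psi> v - of_real lam * ip N \<psi> e * e v)"
  using assms unfolding A_def is_adjoint_def
  by (simp add: ip_simps L2_intros e_L2 T_L2 Dom_L2 ip_cnj)

text \<open>\<open>A a\<close> differs from \<open>T\<close> by bounded terms, so a weak solution
  for \<open>A a\<close> lies in the domain of the adjoint of \<open>T\<close>. With
  \<open>A_adjoint\<close> this passes between the two forms of an equation.\<close>

lemma A_adjoint_imp:
  assumes "\<psi> \<in> L2 N" "f \<in> L2 N" "\<And>g. g \<in> Dom \<Longrightarrow> ip N (A a g) \<psi> = ip N g f"
  shows "is_adjoint N Dom T \<psi> (\<lambda>v. f v - cnj a * \<psi> v + of_real lam * ip N \<psi> e * e v)"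
  unfolding is_adjoint_def
proof (intro conjI ballI)
  fix g assume g: "g \<in> Dom"
  have "ip N (A a g) \<psi> = ip N (T g) \<psi> + a * ip N g \<psi> - of_real lam * ip N g e * ip N e \<psi>"
    unfolding A_def using assms g by (simp add: ip_simps L2_intros e_L2 T_L2 Dom_L2)
  then show "ip N (T g) \<psi> = ip N g (\<lambda>v. f v - cnj a * \<psi> v + of_real lam * ip N \<psi> e * e v)"
    using assms g assms(3)[OF g] by (simp add: ip_simps L2_intros e_L2 Dom_L2 ip_cnj)
qed (use assms in \<open>auto intro!: L2_intros e_L2\<close>)

text \<open>\<open>A a\<close> is linear only almost everywhere, so all representatives of the
  values are included to obtain a subspace. The predicate \<open>P\<close> restricts the preimages:
  it is trivial for density of the range, and orthogonality to \<open>f\<close> when the equation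
  with right-hand side \<open>f\<close> is solved.\<close>

definition A_range :: "(('a \<Rightarrow> complex) \<Rightarrow> bool) \<Rightarrow> complex \<Rightarrow> ('a \<Rightarrow> complex) set" where
  "A_range P a = {h \<in> L2 N. \<exists>g\<in>Dom. P g \<and> (AE v in N. h v = A a g v)}"

lemma subspace_A_range:
  assumes "P g0" "g0 \<in> Dom"
    and P: "\<And>f g b c. f \<in> Dom \<Longrightarrow> g \<in> Dom \<Longrightarrow> P f \<Longrightarrow> P g \<Longrightarrow> P (\<lambda>v. b * f v + c * g v)"
  shows "subspace_L2 N (A_range P a)"
  unfolding subspace_L2_def
proof (intro conjI ballI allI)
  show "A_range P a \<subseteq> L2 N" by (auto simp: A_range_def)
  have "A a g0 \<in> A_range P a" unfolding A_range_def using assms A_L2 by auto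
  then show "A_range P a \<noteq> {}" by blast
  fix f g b c assume "f \<in> A_range P a" "g \<in> A_range P a"
  then obtain f' g' where *: "f \<in> L2 N" "g \<in> L2 N" "f' \<in> Dom" "g' \<in> Dom" "P f'" "P g'"
    "AE v in N. f v = A a f' v" "AE v in N. g v = A a g' v"
    unfolding A_range_def by blast
  have "AE v in N. b * f v + c * g v = A a (\<lambda>u. b * f' u + c * g' u) v"
    using *(7,8) A_lin[OF *(3,4), of a b c] by eventually_elim simp
  then show "(\<lambda>v. b * f v + c * g v) \<in> A_range P a"
    unfolding A_range_def using * by (auto intro!: L2_intros bexI[of _ "\<lambda>v. b * f' v + c * g' v"] P Dom_lin)
qed

text \<open>The residual of the projection onto the closed range is orthogonal to the range, that
  is, in the kernel of the adjoint, which the first assumption makes trivial.\<close>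

lemma A_range_dense:
  assumes "\<And>\<psi>. \<psi> \<in> L2 N \<Longrightarrow> (\<And>g. g \<in> Dom \<Longrightarrow> ip N (A a g) \<psi> = 0) \<Longrightarrow> nrm N \<psi> = 0"
    and f: "f \<in> L2 N" and "\<epsilon> > 0"
  shows "\<exists>g\<in>Dom. nrm N (\<lambda>v. A a g v - f v) < \<epsilon>"
proof -
  obtain g0 where g0: "g0 \<in> Dom" using Dom by (auto simp: subspace_L2_def)
  have sub: "subspace_L2 N (A_range (\<lambda>_. True) a)" by (rule subspace_A_range[OF _ g0]) auto
  obtain q where q: "q \<in> L2 N" "\<And>g. g \<in> A_range (\<lambda>_. True) a \<Longrightarrow> ip N g (\<lambda>v. f v - q v) = 0"
    "\<And>\<epsilon>. \<epsilon> > 0 \<Longrightarrow> \<exists>g\<in>A_range (\<lambda>_. True) a. nrm N (\<lambda>v. g v - q v) < \<epsilon>"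
    using projection_L2[OF e_L2 e_nz sub f] by blast
  have r: "(\<lambda>v. f v - q v) \<in> L2 N" by (intro L2_intros f q)
  have "nrm N (\<lambda>v. f v - q v) = 0"
  proof (rule assms(1)[OF r])
    fix g assume "g \<in> Dom"
    then have "A a g \<in> A_range (\<lambda>_. True) a" unfolding A_range_def using A_L2 by auto
    then show "ip N (A a g) (\<lambda>v. f v - q v) = 0" by (rule q)
  qed
  then have fq: "nrm N (\<lambda>v. q v - f v) = 0" by (subst nrm_minus_commute)
  obtain h g where h: "h \<in> L2 N" "nrm N (\<lambda>v. h v - q v) < \<epsilon>" "g \<in> Dom" "AE v in N. h v = A a g v"
    using q(3)[OF \<open>\<epsilon> > 0\<close>] unfolding A_range_def by blast
  have "nrm N (\<lambda>v. A a g v - f v) = nrm N (\<lambda>v. h v - f v)"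
  proof (rule nrm_cong_AE)
    show "AE v in N. A a g v - f v = h v - f v" using h(4) by eventually_elim simp
  qed (intro L2_intros A_L2 h f)+
  also have "\<dots> < \<epsilon>" using nrm_diff_trans[OF h(1) q(1) f] h(2) fq by simp
  finally show ?thesis using h(3) by blast
qed

text \<open>At this stage the adjoint is known to be dissipative but not to have a gap. That
  suffices for \<open>Re a < 0\<close>, because the rank one term then appears with the same sign as
  the shift.\<close>

lemma A_adjoint_injective_neg:
  assumes "Re a < 0" "\<psi> \<in> L2 N" "\<And>g. g \<in> Dom \<Longrightarrow> ip N (A a g) \<psi> = 0"
  shows "nrm N \<psi> = 0"
proof -
  let ?\<zeta> = "\<lambda>v. 0 - cnj a * \<psi> v + of_real lam * ip N \<psi> e * e v"
  have "is_adjoint N Dom T \<psi> ?\<zeta>"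
    by (rule A_adjoint_imp) (use assms L2_zero in auto)
  then have "Re (ip N ?\<zeta> \<psi>) \<le> 0" by (rule adjoint_dissipative)
  moreover have "ip N ?\<zeta> \<psi> = - cnj a * of_real ((nrm N \<psi>)\<^sup>2) + of_real lam * of_real ((cmod (ip N \<psi> e))\<^sup>2)"
    using assms(2) by (simp add: ip_simps L2_intros e_L2 ip_self complex_norm_square ip_cnj[symmetric, of N e \<psi>] del: of_real_power)
  ultimately have "- Re a * (nrm N \<psi>)\<^sup>2 + lam * (cmod (ip N \<psi> e))\<^sup>2 \<le> 0"
    by (simp del: of_real_power)
  moreover have "0 \<le> lam * (cmod (ip N \<psi> e))\<^sup>2" using lam_pos by simp
  ultimately have "- Re a * (nrm N \<psi>)\<^sup>2 \<le> 0" by linarith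
  then have "(nrm N \<psi>)\<^sup>2 \<le> 0" using assms(1) by (simp add: zero_le_mult_iff)
  then show ?thesis by simp
qed

text \<open>
  The adjoint of the \<open>m\<close>-dissipative operator \<open>T + lam (1 - P)\<close> is dissipative as well: its
  resolvent at \<open>z\<close> is bounded by \<open>1/z\<close>, and \<open>z \<rightarrow> \<infinity>\<close> gives the claim.
\<close>

lemma adjoint_gap:
  assumes adj: "is_adjoint N Dom T \<psi> \<zeta>"
  shows "Re (ip N \<zeta> \<psi>) \<le> - lam * (nrm N (\<lambda>v. \<psi> v - ip N \<psi> e * e v))\<^sup>2"
proof -
  have psi: "\<psi> \<in> L2 N" and zeta: "\<zeta> \<in> L2 N" using adj by (auto simp: is_adjoint_def)
  define \<zeta>' where "\<zeta>' = (\<lambda>v. \<zeta> v + of_real lam * (\<psi> v - ip N \<psi> e * e v))"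
  have zeta': "\<zeta>' \<in> L2 N" unfolding \<zeta>'_def by (intro L2_intros psi zeta e_L2)
  have bound: "z * nrm N \<psi> \<le> nrm N (\<lambda>v. \<zeta>' v - of_real z * \<psi> v)" if z: "z > lam" for z
  proof -
    \<comment> \<open>With this shift \<open>A a\<close> is T + lam (1 - P) - z, coercive with
      constant \<open>z\<close>, and \<open>?F\<close> is what its adjoint assigns to
      \<open>\<psi>\<close>.\<close>
    define a where "a = complex_of_real (lam - z)"
    let ?F = "\<lambda>v. \<zeta>' v - of_real z * \<psi> v"
    have F: "?F \<in> L2 N" by (intro L2_intros zeta' psi)
    have F_eq: "?F = (\<lambda>v. \<zeta> v + cnj a * \<psi> v - of_real lam * ip N \<psi> e * e v)"
      unfolding \<zeta>'_def a_def by (auto simp: algebra_simps)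
    have le: "z * (nrm N \<psi>)\<^sup>2 \<le> nrm N \<psi> * nrm N ?F + \<epsilon> * (nrm N ?F + z * nrm N \<psi>)" if "\<epsilon> > 0" for \<epsilon>
    proof -
      have "Re a < 0" using z by (simp add: a_def)
      \<comment> \<open>\<open>g\<close> stands for the resolvent applied to \<open>\<psi>\<close>;
        only density of the range is at hand, so it is exact up to
        \<open>\<epsilon>\<close>.\<close>
      then obtain g where g: "g \<in> Dom" "nrm N (\<lambda>v. A a g v - \<psi> v) < \<epsilon>"
        using A_range_dense[OF A_adjoint_injective_neg[of a] psi \<open>\<epsilon> > 0\<close>] by blast
      have d: "(\<lambda>v. A a g v - \<psi> v) \<in> L2 N" by (intro L2_intros A_L2 g psi)
      have "ip N g ?F = ip N (A a g) \<psi>" unfolding F_eq using A_adjoint[OF adj g(1)] by simp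
      also have "\<dots> = ip N \<psi> \<psi> + ip N (\<lambda>v. A a g v - \<psi> v) \<psi>"
        using psi A_L2[OF g(1)] by (simp add: ip_simps)
      finally have "of_real ((nrm N \<psi>)\<^sup>2) = ip N g ?F - ip N (\<lambda>v. A a g v - \<psi> v) \<psi>"
        by (simp add: ip_self)
      then have "cmod (of_real ((nrm N \<psi>)\<^sup>2)) \<le> cmod (ip N g ?F) + cmod (ip N (\<lambda>v. A a g v - \<psi> v) \<psi>)"
        using norm_triangle_ineq4 by metis
      also have "cmod (of_real ((nrm N \<psi>)\<^sup>2)) = (nrm N \<psi>)\<^sup>2" unfolding norm_of_real by simp
      finally have 1: "(nrm N \<psi>)\<^sup>2 \<le> nrm N g * nrm N ?F + \<epsilon> * nrm N \<psi>"
        using cauchy_schwarz[OF Dom_L2[OF g(1)] F] cauchy_schwarz[OF d psi]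
          mult_right_mono[OF less_imp_le[OF g(2)] nrm_nonneg[of N \<psi>]] by linarith
      have "z * nrm N g \<le> nrm N (A a g)" using A_coercive[OF g(1), of a] by (simp add: a_def)
      also have "\<dots> \<le> nrm N \<psi> + \<epsilon>" using nrm_le_add_diff[OF A_L2[OF g(1)] psi, of a] g(2) by linarith
      finally have "z * nrm N g * nrm N ?F \<le> (nrm N \<psi> + \<epsilon>) * nrm N ?F"
        by (rule mult_right_mono) simp
      moreover have "z * (nrm N \<psi>)\<^sup>2 \<le> z * (nrm N g * nrm N ?F + \<epsilon> * nrm N \<psi>)"
        using 1 z lam_pos by (intro mult_left_mono) auto
      ultimately show ?thesis by (simp add: algebra_simps)
    qed
    have "z * (nrm N \<psi>)\<^sup>2 \<le> nrm N \<psi> * nrm N ?F"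
    proof (rule field_le_epsilon)
      fix \<delta> :: real assume "\<delta> > 0"
      define s where "s = nrm N ?F + z * nrm N \<psi>"
      have s: "s \<ge> 0" unfolding s_def using z lam_pos by simp
      have "\<delta> / (s + 1) > 0" using s \<open>\<delta> > 0\<close> by simp
      from le[OF this] have "z * (nrm N \<psi>)\<^sup>2 \<le> nrm N \<psi> * nrm N ?F + \<delta> / (s + 1) * s"
        unfolding s_def .
      moreover have "\<delta> / (s + 1) * s \<le> \<delta>" using s \<open>\<delta> > 0\<close> by (simp add: field_simps)
      ultimately show "z * (nrm N \<psi>)\<^sup>2 \<le> nrm N \<psi> * nrm N ?F + \<delta>" by linarith
    qed
    then have *: "(z * nrm N \<psi>) * nrm N \<psi> \<le> nrm N ?F * nrm N \<psi>"
      by (simp add: power2_eq_square mult_ac)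
    show ?thesis
    proof (cases "nrm N \<psi> = 0")
      case False
      then have "nrm N \<psi> > 0" using nrm_nonneg[of N \<psi>] by linarith
      then show ?thesis using * by (rule mult_right_le_imp_le[rotated])
    qed simp
  qed
  \<comment> \<open>When the square on the right is expanded, the terms of order \<open>z\<close>
    squared cancel and the real part is left with the factor \<open>2 * z\<close>.\<close>
  have le: "Re (ip N \<zeta>' \<psi>) \<le> (nrm N \<zeta>')\<^sup>2 / (2 * z)" if z: "z > lam" for z
  proof -
    have "(z * nrm N \<psi>)\<^sup>2 \<le> (nrm N (\<lambda>v. \<zeta>' v - of_real z * \<psi> v))\<^sup>2"
      using bound[OF z] z lam_pos by (intro power_mono) auto
    also have "\<dots> = (nrm N \<zeta>')\<^sup>2 - 2 * (z * Re (ip N \<zeta>' \<psi>)) + (z * nrm N \<psi>)\<^sup>2"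
      unfolding nrm_diff_sq[OF zeta' L2_scale[OF psi]] ip_scale_right nrm_scale
      by (simp add: power_mult_distrib)
    finally show ?thesis using z lam_pos by (simp add: field_simps)
  qed
  have "Re (ip N \<zeta>' \<psi>) \<le> 0"
  proof (rule field_le_epsilon)
    fix \<delta> :: real assume d: "\<delta> > 0"
    define z where "z = lam + 1 + (nrm N \<zeta>')\<^sup>2 / \<delta>"
    have z: "z > lam" unfolding z_def using d by (simp add: add_pos_nonneg)
    have "\<delta> * z \<ge> (nrm N \<zeta>')\<^sup>2" unfolding z_def using d lam_pos by (simp add: distrib_left)
    moreover have "0 \<le> \<delta> * z" using d z lam_pos by simp
    ultimately have "(nrm N \<zeta>')\<^sup>2 \<le> \<delta> * (2 * z)" by linarith
    then have "(nrm N \<zeta>')\<^sup>2 / (2 * z) \<le> \<delta>" using z lam_pos by (simp add: pos_divide_le_eq)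
    then show "Re (ip N \<zeta>' \<psi>) \<le> 0 + \<delta>" using le[OF z] by linarith
  qed
  moreover have "ip N \<zeta>' \<psi> = ip N \<zeta> \<psi> + of_real lam * ip N (\<lambda>v. \<psi> v - ip N \<psi> e * e v) \<psi>"
    unfolding \<zeta>'_def
    by (subst ip_add_left) (intro L2_intros zeta psi e_L2 | simp add: ip_scale_left)+
  ultimately show ?thesis using ip_complement_self[OF psi] by simp
qed

text \<open>The gap of the adjoint and the rank one term again add up to the full norm, now for weak
  solutions. The estimate serves three times below: for the size of a solution, for its dependence
  on the parameter, and for uniqueness.\<close>

lemma solution_bound:
  assumes "\<psi> \<in> L2 N" "f \<in> L2 N" "\<And>g. g \<in> Dom \<Longrightarrow> ip N (A a g) \<psi> = ip N g f"
  shows "(lam - Re a) * nrm N \<psi> \<le> nrm N f"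
proof -
  let ?\<zeta> = "\<lambda>v. f v - cnj a * \<psi> v + of_real lam * ip N \<psi> e * e v"
  have "is_adjoint N Dom T \<psi> ?\<zeta>"
    by (rule A_adjoint_imp) (use assms in auto)
  from adjoint_gap[OF this] have "Re (ip N ?\<zeta> \<psi>) \<le> - lam * (nrm N (\<lambda>v. \<psi> v - ip N \<psi> e * e v))\<^sup>2" .
  moreover have "ip N ?\<zeta> \<psi> = ip N f \<psi> - cnj a * of_real ((nrm N \<psi>)\<^sup>2) + of_real lam * of_real ((cmod (ip N \<psi> e))\<^sup>2)"
    using assms(1,2) by (simp add: ip_simps L2_intros e_L2 ip_self complex_norm_square ip_cnj[symmetric, of N e \<psi>] del: of_real_power)
  ultimately have "Re (ip N f \<psi>) - Re a * (nrm N \<psi>)\<^sup>2 + lam * (cmod (ip N \<psi> e))\<^sup>2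
      \<le> - lam * (nrm N (\<lambda>v. \<psi> v - ip N \<psi> e * e v))\<^sup>2"
    by (simp del: of_real_power)
  then have "Re (ip N f \<psi>) - Re a * (nrm N \<psi>)\<^sup>2 + lam * (nrm N \<psi>)\<^sup>2 \<le> 0"
    unfolding pythagoras[OF assms(1)] by (simp add: distrib_left)
  moreover have "- Re (ip N f \<psi>) \<le> nrm N f * nrm N \<psi>"
    using cauchy_schwarz[OF assms(2,1)] abs_Re_le_cmod[of "ip N f \<psi>"] by linarith
  ultimately have *: "((lam - Re a) * nrm N \<psi>) * nrm N \<psi> \<le> nrm N f * nrm N \<psi>"
    by (simp add: power2_eq_square algebra_simps)
  show ?thesis
  proof (cases "nrm N \<psi> = 0")
    case False
    then have "nrm N \<psi> > 0" using nrm_nonneg[of N \<psi>] by linarith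
    then show ?thesis using * by (rule mult_right_le_imp_le[rotated])
  qed simp
qed

text \<open>Coercivity makes the functional taking \<open>A a g\<close> to \<open>ip N g f\<close>
  well defined and bounded on the range, and the solution is its Riesz vector. It is found as a
  multiple of the part of \<open>A a g1\<close> orthogonal to the image of the kernel of the
  functional.\<close>

lemma solution_exists:
  assumes a: "Re a < lam" and f: "f \<in> L2 N"
  shows "\<exists>\<psi>\<in>L2 N. \<forall>g\<in>Dom. ip N (A a g) \<psi> = ip N g f"
proof (cases "\<forall>g\<in>Dom. ip N g f = 0")
  case True
  then show ?thesis by (intro bexI[of _ "\<lambda>_. 0"]) (auto simp: L2_zero)
next
  case False
  then obtain g1 where g1: "g1 \<in> Dom" "ip N g1 f \<noteq> 0" by blast
  let ?P = "\<lambda>g. ip N g f = 0"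
  have "?P (\<lambda>v. 0 * g1 v + 0 * g1 v)" by simp
  then have sub: "subspace_L2 N (A_range ?P a)"
    by (rule subspace_A_range[OF _ Dom_lin[OF g1(1) g1(1)]]) (use f Dom_L2 in \<open>simp add: ip_simps L2_intros\<close>)
  obtain q where q: "q \<in> L2 N" "\<And>g. g \<in> A_range ?P a \<Longrightarrow> ip N g (\<lambda>v. A a g1 v - q v) = 0"
    "\<And>\<epsilon>. \<epsilon> > 0 \<Longrightarrow> \<exists>g\<in>A_range ?P a. nrm N (\<lambda>v. g v - q v) < \<epsilon>"
    using projection_L2[OF e_L2 e_nz sub A_L2[OF g1(1)], of a] by blast
  define r where "r = (\<lambda>v. A a g1 v - q v)"
  have r: "r \<in> L2 N" unfolding r_def by (intro L2_intros A_L2 g1 q)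
  \<comment> \<open>Otherwise \<open>A a g1\<close> would be approximated by values
    \<open>A a g\<close> with \<open>ip N g f = 0\<close>. Coercivity would make
    \<open>g - g1\<close> small, against the fixed value of \<open>ip N g1 f\<close>;
    \<open>\<epsilon>\<close> is set at the size where this becomes a contradiction.\<close>
  have r_nz: "nrm N r \<noteq> 0"
  proof
    assume r0: "nrm N r = 0"
    define \<epsilon> where "\<epsilon> = (lam - Re a) * cmod (ip N g1 f) / (nrm N f + 1)"
    have \<epsilon>: "\<epsilon> > 0" unfolding \<epsilon>_def using a g1 nrm_nonneg[of N f] by (simp add: add_nonneg_pos)
    obtain h g where h: "h \<in> L2 N" "nrm N (\<lambda>v. h v - q v) < \<epsilon>" "g \<in> Dom" "ip N g f = 0"
        "AE v in N. h v = A a g v"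
      using q(3)[OF \<epsilon>] unfolding A_range_def by blast
    define g2 where "g2 = (\<lambda>v. 1 * g v + (-1) * g1 v)"
    have g2: "g2 \<in> Dom" unfolding g2_def by (intro Dom_lin h g1)
    have "nrm N (A a g2) = nrm N (\<lambda>v. (h v - q v) - r v)"
    proof (rule nrm_cong_AE)
      show "AE v in N. A a g2 v = (h v - q v) - r v"
        using A_lin[OF h(3) g1(1), of a 1 "-1"] h(5)
        by eventually_elim (simp add: g2_def r_def)
    qed (intro L2_intros A_L2 g2 h q r)+
    also have "\<dots> \<le> nrm N (\<lambda>v. h v - q v) + nrm N r" by (intro nrm_triangle_diff L2_intros h q r)
    finally have lt: "nrm N (A a g2) < \<epsilon>" using r0 h(2) by simp
    have "ip N g2 f = - ip N g1 f" unfolding g2_def using h(3,4) g1(1) f by (simp add: ip_simps L2_intros Dom_L2)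
    then have "cmod (ip N g1 f) \<le> nrm N g2 * nrm N f"
      using cauchy_schwarz[OF Dom_L2[OF g2] f] by simp
    then have "(lam - Re a) * cmod (ip N g1 f) \<le> (lam - Re a) * nrm N g2 * nrm N f"
      using a by (simp add: mult.assoc)
    also have "\<dots> \<le> nrm N (A a g2) * nrm N f" by (intro mult_right_mono A_coercive g2) simp
    also have "\<dots> \<le> \<epsilon> * nrm N f" using lt by (intro mult_right_mono) auto
    also have "\<dots> < \<epsilon> * (nrm N f + 1)" using \<epsilon> by simp
    also have "\<dots> = (lam - Re a) * cmod (ip N g1 f)"
    proof -
      have "nrm N f + 1 \<noteq> 0" using nrm_nonneg[of N f] by linarith
      then show ?thesis unfolding \<epsilon>_def by simp
    qed
    finally show False by simp
  qed
  have "ip N q r = 0"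
  proof -
    have "cmod (ip N q r) \<le> 0 + \<delta>" if "\<delta> > 0" for \<delta>
    proof -
      have "\<delta> / nrm N r > 0" using that r_nz nrm_nonneg[of N r] by (simp add: less_eq_real_def)
      then obtain h where h: "h \<in> A_range ?P a" "nrm N (\<lambda>v. h v - q v) < \<delta> / nrm N r"
        using q(3) by blast
      have hL: "h \<in> L2 N" using h by (simp add: A_range_def)
      have "ip N h r = 0" using q(2)[OF h(1)] by (simp add: r_def)
      then have "ip N (\<lambda>v. h v - q v) r = - ip N q r" using hL q r by (simp add: ip_simps)
      then have "cmod (ip N q r) \<le> nrm N (\<lambda>v. h v - q v) * nrm N r"
        using cauchy_schwarz[OF L2_diff[OF hL q(1)] r] by simp
      also have "\<dots> \<le> \<delta> / nrm N r * nrm N r" using h(2) by (intro mult_right_mono) auto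
      finally show ?thesis using r_nz by simp
    qed
    then have "cmod (ip N q r) \<le> 0" by (rule field_le_epsilon)
    then show ?thesis by simp
  qed
  moreover have "ip N (A a g1) r = ip N q r + ip N r r"
    unfolding r_def using q A_L2[OF g1(1)] by (simp add: ip_simps L2_intros)
  ultimately have Ag1: "ip N (A a g1) r = of_real ((nrm N r)\<^sup>2)" by (simp add: ip_self)
  \<comment> \<open>The factor giving the correct value at \<open>A a g1\<close>; it is conjugated
    because it sits in the second slot of \<open>ip\<close>.\<close>
  define t where "t = cnj (ip N g1 f) / of_real ((nrm N r)\<^sup>2)"
  have "ip N (A a g) (\<lambda>v. t * r v) = ip N g f" if g: "g \<in> Dom" for g
  proof -
    \<comment> \<open>Removing \<open>k\<close> times \<open>g1\<close> from \<open>g\<close> leaves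
      an element of the kernel of the functional, whose image is orthogonal to
      \<open>r\<close>.\<close>
    define k where "k = ip N g f / ip N g1 f"
    define g2 where "g2 = (\<lambda>v. 1 * g v + (- k) * g1 v)"
    have g2: "g2 \<in> Dom" unfolding g2_def by (intro Dom_lin g g1)
    have "ip N g2 f = ip N g f - k * ip N g1 f"
      unfolding g2_def using g g1 f by (simp add: ip_simps L2_intros Dom_L2)
    then have "ip N g2 f = 0" using g1 by (simp add: k_def)
    then have "A a g2 \<in> A_range ?P a" unfolding A_range_def using g2 A_L2 by auto
    then have "ip N (A a g2) r = 0" unfolding r_def by (rule q)
    then have "ip N (A a g) r = k * ip N (A a g1) r"
      using ip_A_lin[OF g g1(1) r, of a 1 "-k"] unfolding g2_def by simp
    then show ?thesis unfolding ip_scale_right Ag1 t_def k_def using r_nz g1 by simp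
  qed
  then show ?thesis using r by (intro bexI[of _ "\<lambda>v. t * r v"]) (auto intro: L2_intros)
qed

text \<open>If \<open>e\<close> were in \<open>Dom\<close> with \<open>T e = 0\<close>, the adjoint
  would take values orthogonal to \<open>e\<close>. The approximate null vector \<open>g\<close>
  replaces it and leaves an error proportional to \<open>\<epsilon>\<close>.\<close>

lemma adjoint_defect:
  assumes "is_adjoint N Dom T \<psi> \<zeta>"
    and g: "g \<in> Dom" "nrm N (\<lambda>v. g v - e v) \<le> \<epsilon>" "nrm N (T g) \<le> \<epsilon>"
  shows "cmod (ip N \<zeta> e) \<le> \<epsilon> * (nrm N \<psi> + nrm N \<zeta>)"
proof -
  have psi: "\<psi> \<in> L2 N" and zeta: "\<zeta> \<in> L2 N" and eq: "ip N (T g) \<psi> = ip N g \<zeta>"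
    using assms by (auto simp: is_adjoint_def)
  have d: "(\<lambda>v. g v - e v) \<in> L2 N" by (intro L2_intros Dom_L2 g e_L2)
  have "ip N e \<zeta> = ip N (T g) \<psi> - ip N (\<lambda>v. g v - e v) \<zeta>"
    using eq zeta Dom_L2[OF g(1)] e_L2 by (simp add: ip_simps)
  then have "cmod (ip N e \<zeta>) \<le> cmod (ip N (T g) \<psi>) + cmod (ip N (\<lambda>v. g v - e v) \<zeta>)"
    by (metis norm_triangle_ineq4)
  also have "\<dots> \<le> nrm N (T g) * nrm N \<psi> + nrm N (\<lambda>v. g v - e v) * nrm N \<zeta>"
    by (intro add_mono cauchy_schwarz T_L2 g psi d zeta)
  also have "\<dots> \<le> \<epsilon> * nrm N \<psi> + \<epsilon> * nrm N \<zeta>"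
    by (intro add_mono mult_right_mono g) auto
  finally show ?thesis using complex_mod_cnj[of "ip N e \<zeta>"] by (simp add: ip_cnj distrib_left)
qed

text \<open>The fixed point map is minus the \<open>e\<close>-component of the adjoint applied to
  the solution. By \<open>adjoint_defect\<close> this component is small, and so are its increments:
  this yields both invariance of a ball and contraction, without any regularity in
  \<open>\<mu>\<close> beyond \<open>solution_bound\<close>.\<close>

lemma eigenvalue_exists_unique:
  assumes g: "g \<in> Dom" "nrm N (\<lambda>v. g v - e v) \<le> lam / (8 + 16 * lam)" "nrm N (T g) \<le> lam / (8 + 16 * lam)"
  shows "\<exists>\<psi> \<mu>. \<mu> \<in> ball 0 (lam / 2) \<and> is_adjoint N Dom T \<psi> (\<lambda>v. - \<mu> * \<psi> v) \<and> ip N \<psi> e = 1 \<and>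
    (\<forall>\<psi>' \<mu>'. \<mu>' \<in> ball 0 (lam / 2) \<and> is_adjoint N Dom T \<psi>' (\<lambda>v. - \<mu>' * \<psi>' v) \<and> ip N \<psi>' e = 1 \<longrightarrow>
      \<mu>' = \<mu> \<and> (AE v in N. \<psi>' v = \<psi> v))"
proof -
  \<comment> \<open>\<open>eps1\<close> will be the Lipschitz constant of \<open>\<delta>\<close>
    and \<open>eps2\<close> the bound on its modulus.\<close>
  define \<epsilon> where "\<epsilon> = lam / (8 + 16 * lam)"
  have \<epsilon>: "\<epsilon> > 0" unfolding \<epsilon>_def using lam_pos by simp
  have eps1: "\<epsilon> * (4 / lam + 8) = 1 / 2"
  proof -
    have "8 + 16 * lam > 0" using lam_pos by linarith
    then show ?thesis unfolding \<epsilon>_def using lam_pos by (simp add: divide_simps)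
  qed
  have eps2: "\<epsilon> * (2 + 4 * lam) = lam / 4"
  proof -
    have "\<epsilon> * (2 + 4 * lam) = (lam / 2) * (\<epsilon> * (4 / lam + 8))" using lam_pos by (simp add: field_simps)
    then show ?thesis unfolding eps1 by simp
  qed
  have rhs: "(\<lambda>v. - of_real lam * e v) \<in> L2 N" by (intro L2_intros e_L2)
  have "\<exists>\<psi>\<in>L2 N. \<forall>g\<in>Dom. ip N (A (cnj \<mu>) g) \<psi> = ip N g (\<lambda>v. - of_real lam * e v)"
    if "cmod \<mu> < lam" for \<mu>
    by (rule solution_exists[OF _ rhs]) (use that complex_Re_le_cmod[of \<mu>] in auto)
  then obtain \<Psi> where Psi: "\<And>\<mu>. cmod \<mu> < lam \<Longrightarrow> \<Psi> \<mu> \<in> L2 N"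
    "\<And>\<mu> g. cmod \<mu> < lam \<Longrightarrow> g \<in> Dom \<Longrightarrow> ip N (A (cnj \<mu>) g) (\<Psi> \<mu>) = ip N g (\<lambda>v. - of_real lam * e v)"
    by metis
  define c where "c \<mu> = ip N (\<Psi> \<mu>) e" for \<mu>
  \<comment> \<open>Chosen so that \<open>\<delta> \<mu> = \<mu>\<close> says
    \<open>(lam - \<mu>) * (c \<mu> - 1) = 0\<close>, while \<open>- \<delta> \<mu>\<close> is the
    component along \<open>e\<close> that \<open>adjoint_defect\<close> bounds.\<close>
  define \<delta> where "\<delta> \<mu> = of_real lam - (of_real lam - \<mu>) * c \<mu>" for \<mu>
  let ?\<zeta> = "\<lambda>\<mu> v. - of_real lam * e v - \<mu> * \<Psi> \<mu> v + of_real lam * c \<mu> * e v"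
  have adj: "is_adjoint N Dom T (\<Psi> \<mu>) (?\<zeta> \<mu>)" if "cmod \<mu> < lam" for \<mu>
    using A_adjoint_imp[OF Psi(1)[OF that] rhs Psi(2)[OF that]] by (simp add: c_def)
  have Psi_bound: "nrm N (\<Psi> \<mu>) \<le> 2" if "cmod \<mu> < lam / 2" for \<mu>
  proof -
    have m: "cmod \<mu> < lam" using that lam_pos by linarith
    have "(lam - Re (cnj \<mu>)) * nrm N (\<Psi> \<mu>) \<le> nrm N (\<lambda>v. - of_real lam * e v)"
      by (rule solution_bound[OF Psi(1)[OF m] rhs Psi(2)[OF m]])
    then have "(lam - Re \<mu>) * nrm N (\<Psi> \<mu>) \<le> lam"
      using lam_pos unfolding nrm_scale by (simp add: e_nrm)
    moreover have "lam / 2 * nrm N (\<Psi> \<mu>) \<le> (lam - Re \<mu>) * nrm N (\<Psi> \<mu>)"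
      using complex_Re_le_cmod[of \<mu>] that by (intro mult_right_mono) auto
    ultimately have "lam * nrm N (\<Psi> \<mu>) \<le> lam * 2" by linarith
    then show ?thesis using lam_pos by simp
  qed
  have ip_le: "cmod (ip N f e) \<le> nrm N f" if "f \<in> L2 N" for f
    using cauchy_schwarz[OF that e_L2] by (simp add: e_nrm)
  have zeta_e: "ip N (?\<zeta> \<mu>) e = - \<delta> \<mu>" if "cmod \<mu> < lam" for \<mu>
  proof -
    have "ip N (?\<zeta> \<mu>) e = - of_real lam - \<mu> * c \<mu> + of_real lam * c \<mu>"
      using Psi(1)[OF that] by (simp add: ip_simps L2_intros e_L2 ip_e_e c_def)
    then show ?thesis unfolding \<delta>_def by (simp add: algebra_simps)
  qed
  have \<delta>_bound: "cmod (\<delta> \<mu>) \<le> lam / 4" if mu: "cmod \<mu> < lam / 2" for \<mu>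
  proof -
    have m: "cmod \<mu> < lam" using mu lam_pos by linarith
    have P: "\<Psi> \<mu> \<in> L2 N" by (rule Psi(1)[OF m])
    have "nrm N (?\<zeta> \<mu>) \<le> nrm N (\<lambda>v. - of_real lam * e v) + nrm N (\<lambda>v. \<mu> * \<Psi> \<mu> v) + nrm N (\<lambda>v. of_real lam * c \<mu> * e v)"
      by (rule order_trans[OF nrm_triangle add_right_mono[OF nrm_triangle_diff]]) (intro L2_intros e_L2 P)+
    also have "\<dots> = lam + cmod \<mu> * nrm N (\<Psi> \<mu>) + lam * cmod (c \<mu>)"
      unfolding nrm_scale e_nrm using lam_pos by (simp add: norm_mult)
    also have "\<dots> \<le> lam + lam / 2 * 2 + lam * 2"
      using mu Psi_bound[OF mu] lam_pos ip_le[OF P] unfolding c_def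
      by (intro add_mono mult_mono) auto
    finally have "nrm N (?\<zeta> \<mu>) \<le> 4 * lam" by simp
    moreover have "cmod (ip N (?\<zeta> \<mu>) e) \<le> \<epsilon> * (nrm N (\<Psi> \<mu>) + nrm N (?\<zeta> \<mu>))"
      by (rule adjoint_defect[OF adj[OF m] g[folded \<epsilon>_def]])
    ultimately have "cmod (\<delta> \<mu>) \<le> \<epsilon> * (2 + 4 * lam)"
      unfolding zeta_e[OF m] using \<epsilon> Psi_bound[OF mu]
      by (smt (verit, best) mult_left_mono norm_minus_cancel)
    then show ?thesis using eps2 by simp
  qed
  have \<delta>_lip: "cmod (\<delta> \<mu> - \<delta> \<nu>) \<le> 1 / 2 * cmod (\<mu> - \<nu>)" if mu: "cmod \<mu> < lam / 2" "cmod \<nu> < lam / 2" for \<mu> \<nu>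
  proof -
    have m: "cmod \<mu> < lam" "cmod \<nu> < lam" using mu lam_pos by linarith+
    have P: "\<Psi> \<mu> \<in> L2 N" "\<Psi> \<nu> \<in> L2 N" by (rule Psi(1)[OF m(1)], rule Psi(1)[OF m(2)])
    let ?d = "\<lambda>v. \<Psi> \<mu> v - \<Psi> \<nu> v"
    have d: "?d \<in> L2 N" by (intro L2_intros P)
    have R: "(\<lambda>v. - (\<mu> - \<nu>) * \<Psi> \<nu> v) \<in> L2 N" by (intro L2_intros P)
    \<comment> \<open>Resolvent identity in weak form: the difference of two solutions solves the
      equation for \<open>\<mu>\<close> with right-hand side proportional to
      \<open>\<mu> - \<nu>\<close>, so \<open>solution_bound\<close> applies to it.\<close>
    have eq: "ip N (A (cnj \<mu>) g) ?d = ip N g (\<lambda>v. - (\<mu> - \<nu>) * \<Psi> \<nu> v)" if g: "g \<in> Dom" for g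
    proof -
      have "A (cnj \<mu>) g = (\<lambda>v. A (cnj \<nu>) g v + cnj (\<mu> - \<nu>) * g v)"
        unfolding A_def by (auto simp: algebra_simps)
      then have "ip N (A (cnj \<mu>) g) (\<Psi> \<nu>) = ip N (A (cnj \<nu>) g) (\<Psi> \<nu>) + cnj (\<mu> - \<nu>) * ip N g (\<Psi> \<nu>)"
        using A_L2[OF g] Dom_L2[OF g] P by (simp add: ip_simps L2_intros)
      moreover have "ip N g (\<lambda>v. - (\<mu> - \<nu>) * \<Psi> \<nu> v) = - cnj (\<mu> - \<nu>) * ip N g (\<Psi> \<nu>)"
        unfolding ip_scale_right by simp
      ultimately show ?thesis
        unfolding ip_diff_right[OF P A_L2[OF g]] using Psi(2)[OF m(1) g] Psi(2)[OF m(2) g]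
        by (simp add: left_diff_distrib)
    qed
    have "(lam - Re (cnj \<mu>)) * nrm N ?d \<le> nrm N (\<lambda>v. - (\<mu> - \<nu>) * \<Psi> \<nu> v)"
      by (rule solution_bound[OF d R eq])
    also have "\<dots> = cmod (\<mu> - \<nu>) * nrm N (\<Psi> \<nu>)" unfolding nrm_scale by (simp only: norm_minus_cancel)
    also have "\<dots> \<le> cmod (\<mu> - \<nu>) * 2" by (intro mult_left_mono Psi_bound mu) simp
    finally have 1: "(lam - Re \<mu>) * nrm N ?d \<le> cmod (\<mu> - \<nu>) * 2" by simp
    have "lam / 2 * nrm N ?d \<le> (lam - Re \<mu>) * nrm N ?d"
      using complex_Re_le_cmod[of \<mu>] mu by (intro mult_right_mono) auto
    with 1 have d_le: "nrm N ?d \<le> 4 / lam * cmod (\<mu> - \<nu>)" using lam_pos by (simp add: field_simps)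
    let ?z = "\<lambda>v. - (\<mu> - \<nu>) * \<Psi> \<nu> v - cnj (cnj \<mu>) * ?d v + of_real lam * ip N ?d e * e v"
    have adj_d: "is_adjoint N Dom T ?d ?z" by (rule A_adjoint_imp[OF d R eq])
    have z_e: "ip N ?z e = - (\<delta> \<mu> - \<delta> \<nu>)"
    proof -
      have Z: "ip N ?z e = - (\<mu> - \<nu>) * c \<nu> - \<mu> * (c \<mu> - c \<nu>) + of_real lam * (c \<mu> - c \<nu>)"
        using P by (simp add: ip_simps L2_intros e_L2 ip_e_e c_def)
      show ?thesis unfolding Z \<delta>_def by (simp add: algebra_simps)
    qed
    have "nrm N ?z \<le> nrm N (\<lambda>v. - (\<mu> - \<nu>) * \<Psi> \<nu> v) + nrm N (\<lambda>v. cnj (cnj \<mu>) * ?d v) + nrm N (\<lambda>v. of_real lam * ip N ?d e * e v)"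
      by (rule order_trans[OF nrm_triangle add_right_mono[OF nrm_triangle_diff]]) (intro L2_intros e_L2 P)+
    also have "\<dots> = cmod (\<mu> - \<nu>) * nrm N (\<Psi> \<nu>) + cmod \<mu> * nrm N ?d + lam * cmod (ip N ?d e)"
      unfolding nrm_scale e_nrm norm_minus_cancel using lam_pos by (simp add: norm_mult)
    also have "\<dots> \<le> cmod (\<mu> - \<nu>) * 2 + lam / 2 * (4 / lam * cmod (\<mu> - \<nu>)) + lam * (4 / lam * cmod (\<mu> - \<nu>))"
      using mu Psi_bound[OF mu(2)] lam_pos order_trans[OF ip_le[OF d] d_le] d_le
      by (intro add_mono mult_mono) auto
    also have "\<dots> = 8 * cmod (\<mu> - \<nu>)" using lam_pos by simp
    finally have z_le: "nrm N ?z \<le> 8 * cmod (\<mu> - \<nu>)" .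
    have "cmod (ip N ?z e) \<le> \<epsilon> * (nrm N ?d + nrm N ?z)"
      by (rule adjoint_defect[OF adj_d g[folded \<epsilon>_def]])
    also have "\<dots> \<le> \<epsilon> * (4 / lam * cmod (\<mu> - \<nu>) + 8 * cmod (\<mu> - \<nu>))"
      using \<epsilon> d_le z_le by (intro mult_left_mono add_mono) auto
    also have "\<dots> = \<epsilon> * (4 / lam + 8) * cmod (\<mu> - \<nu>)" by (simp add: algebra_simps)
    finally show ?thesis unfolding z_e eps1 norm_minus_cancel .
  qed
  have eigen_iff: "\<delta> \<mu> = \<mu> \<longleftrightarrow> c \<mu> = 1" if "cmod \<mu> < lam" for \<mu>
  proof -
    have "of_real lam - \<mu> \<noteq> 0" using that lam_pos by auto
    moreover have "\<delta> \<mu> = \<mu> \<longleftrightarrow> (of_real lam - \<mu>) * c \<mu> = (of_real lam - \<mu>) * 1"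
      unfolding \<delta>_def by (auto simp: algebra_simps)
    ultimately show ?thesis by simp
  qed
  \<comment> \<open>The closed ball of half the radius gives completeness; the contraction estimate
    on the larger open ball is kept for uniqueness there.\<close>
  have "\<exists>!\<mu>. \<mu> \<in> cball 0 (lam / 4) \<and> \<delta> \<mu> = \<mu>"
  proof (rule Banach_fix[of _ "1/2"])
    show "complete (cball (0::complex) (lam / 4))" by (simp add: compact_imp_complete)
    show "\<delta> ` cball 0 (lam / 4) \<subseteq> cball 0 (lam / 4)" using \<delta>_bound lam_pos by auto
    show "dist (\<delta> x) (\<delta> y) \<le> 1 / 2 * dist x y" if "x \<in> cball 0 (lam / 4)" "y \<in> cball 0 (lam / 4)" for x y
      using \<delta>_lip[of x y] that lam_pos by (simp add: dist_norm)
  qed (use lam_pos in auto)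
  then obtain \<mu> where mu: "cmod \<mu> \<le> lam / 4" "\<delta> \<mu> = \<mu>" by auto
  have mu2: "cmod \<mu> < lam / 2" and mu1: "cmod \<mu> < lam" using mu lam_pos by linarith+
  have c1: "c \<mu> = 1" using eigen_iff[OF mu1] mu by simp
  show ?thesis
  proof (rule exI[of _ "\<Psi> \<mu>"], rule exI[of _ \<mu>], intro conjI allI impI)
    show "\<mu> \<in> ball 0 (lam / 2)" using mu2 by simp
    show "ip N (\<Psi> \<mu>) e = 1" using c1 by (simp add: c_def)
    show "is_adjoint N Dom T (\<Psi> \<mu>) (\<lambda>v. - \<mu> * \<Psi> \<mu> v)" using adj[OF mu1] by (simp add: c1)
    fix \<psi>' \<mu>' assume "\<mu>' \<in> ball 0 (lam / 2) \<and> is_adjoint N Dom T \<psi>' (\<lambda>v. - \<mu>' * \<psi>' v) \<and> ip N \<psi>' e = 1"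
    then have *: "cmod \<mu>' < lam / 2" "is_adjoint N Dom T \<psi>' (\<lambda>v. - \<mu>' * \<psi>' v)" "ip N \<psi>' e = 1" by auto
    have m': "cmod \<mu>' < lam" using * lam_pos by linarith
    have psi': "\<psi>' \<in> L2 N" using * by (simp add: is_adjoint_def)
    have d: "(\<lambda>v. \<psi>' v - \<Psi> \<mu>' v) \<in> L2 N" by (intro L2_intros psi' Psi m')
    have "(lam - Re (cnj \<mu>')) * nrm N (\<lambda>v. \<psi>' v - \<Psi> \<mu>' v) \<le> nrm N (\<lambda>_. 0::complex)"
    proof (rule solution_bound[OF d L2_zero])
      fix g assume g: "g \<in> Dom"
      \<comment> \<open>The normalisation turns the rank one term into the constant right-hand side,
        so any normalised eigenvector solves the equation that defines
        \<open>\<Psi> \<mu>'\<close>.\<close>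
      have "ip N (A (cnj \<mu>') g) \<psi>' = ip N g (\<lambda>v. - of_real lam * e v)"
        using A_adjoint[OF *(2) g, of "cnj \<mu>'"] by (simp add: *(3))
      then show "ip N (A (cnj \<mu>') g) (\<lambda>v. \<psi>' v - \<Psi> \<mu>' v) = ip N g (\<lambda>_. 0)"
        using Psi(2)[OF m' g] psi' Psi(1)[OF m'] A_L2[OF g] by (simp add: ip_diff_right)
    qed
    then have "(lam - Re \<mu>') * nrm N (\<lambda>v. \<psi>' v - \<Psi> \<mu>' v) \<le> 0" by (simp add: nrm_def)
    moreover have "lam - Re \<mu>' > 0" using m' complex_Re_le_cmod[of \<mu>'] by linarith
    ultimately have "nrm N (\<lambda>v. \<psi>' v - \<Psi> \<mu>' v) = 0"
      using nrm_nonneg[of N "\<lambda>v. \<psi>' v - \<Psi> \<mu>' v"] by (simp add: mult_le_0_iff)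
    then have AE: "AE v in N. \<psi>' v = \<Psi> \<mu>' v" using nrm_eq_0_imp_AE[OF d] by simp
    then have "c \<mu>' = 1"
      unfolding c_def *(3)[symmetric] using ip_cong_AE[OF AE, of e e] psi' Psi(1)[OF m'] e_L2 by simp
    then have "\<delta> \<mu>' = \<mu>'" using eigen_iff[OF m'] by simp
    then have "cmod (\<mu>' - \<mu>) \<le> 1 / 2 * cmod (\<mu>' - \<mu>)" using \<delta>_lip[OF *(1) mu2] mu(2) by simp
    then show "\<mu>' = \<mu>" by simp
    then show "AE v in N. \<psi>' v = \<Psi> \<mu> v" using AE by simp
  qed
qed

text \<open>With \<open>w\<close> the squared distance from \<open>\<psi>\<close> to
  \<open>e\<close>, the normalisation gives squared norm \<open>1 + w\<close> and the gap of the
  adjoint gives \<open>lam * w \<le> Re \<mu> * (1 + w)\<close>. As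
  \<open>Re \<mu> \<le> lam / 2\<close>, half of the left side absorbs the term with
  \<open>w\<close>.\<close>

lemma eigenvector_bounds:
  assumes eig: "is_adjoint N Dom T \<psi> (\<lambda>v. - \<mu> * \<psi> v)" "ip N \<psi> e = 1" and mu: "cmod \<mu> < lam / 2"
  shows "0 \<le> Re \<mu>" "(nrm N (\<lambda>v. \<psi> v - e v))\<^sup>2 \<le> 2 / lam * Re \<mu>" "nrm N \<psi> \<le> 2"
proof -
  define w where "w = (nrm N (\<lambda>v. \<psi> v - e v))\<^sup>2"
  have psi: "\<psi> \<in> L2 N" using eig by (simp add: is_adjoint_def)
  have sq: "(nrm N \<psi>)\<^sup>2 = 1 + w" using pythagoras[OF psi] eig(2) by (simp add: w_def)
  have "Re (ip N (\<lambda>v. - \<mu> * \<psi> v) \<psi>) \<le> - lam * w"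
    using adjoint_gap[OF eig(1)] eig(2) by (simp add: w_def)
  then have le: "lam * w \<le> Re \<mu> * (1 + w)"
    unfolding ip_scale_left ip_self sq[symmetric] by simp
  have w: "w \<ge> 0" by (simp add: w_def)
  then have "0 \<le> Re \<mu> * (1 + w)" using le lam_pos by (meson mult_nonneg_nonneg less_imp_le order_trans)
  then show re: "0 \<le> Re \<mu>" using w by (simp add: zero_le_mult_iff)
  have lt: "Re \<mu> \<le> lam / 2" using mu complex_Re_le_cmod[of \<mu>] by linarith
  have "Re \<mu> * w \<le> lam / 2 * w" using lt w by (rule mult_right_mono)
  then have *: "lam / 2 * w \<le> Re \<mu>" using le by (simp add: algebra_simps)
  then show "(nrm N (\<lambda>v. \<psi> v - e v))\<^sup>2 \<le> 2 / lam * Re \<mu>"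
    using lam_pos unfolding w_def[symmetric] by (simp add: field_simps)
  have "lam / 2 * w \<le> lam / 2 * 1" using * lt by linarith
  then have "w \<le> 1" using lam_pos by simp
  then have "(nrm N \<psi>)\<^sup>2 \<le> 2\<^sup>2" using sq by simp
  then show "nrm N \<psi> \<le> 2" by (rule power2_le_imp_le) simp
qed

text \<open>
  Taking the real part removes the contribution of the advection term tested against \<open>e\<close>.
\<close>

lemma eigenvalue_upper_bound:
  assumes eig: "is_adjoint N Dom T \<psi> (\<lambda>v. - \<mu> * \<psi> v)" "ip N \<psi> e = 1" and mu: "cmod \<mu> < lam / 2" "Im \<mu> = 0"
    and g: "g \<in> Dom" "nrm N (\<lambda>v. g v - e v) \<le> 1 / 4" "Re (ip N (T g) e) = 0"
  shows "Re \<mu> \<le> 8 / lam * (nrm N (T g))\<^sup>2"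
proof -
  note b = eigenvector_bounds[OF eig mu(1)]
  define w where "w = nrm N (\<lambda>v. \<psi> v - e v)"
  have psi: "\<psi> \<in> L2 N" using eig by (simp add: is_adjoint_def)
  have d: "(\<lambda>v. g v - e v) \<in> L2 N" "(\<lambda>v. \<psi> v - e v) \<in> L2 N" by (intro L2_intros Dom_L2 g e_L2 psi)+
  have mu_real: "\<mu> = of_real (Re \<mu>)" using mu by (simp add: complex_eq_iff)
  have "ip N (T g) \<psi> = ip N g (\<lambda>v. - \<mu> * \<psi> v)" using eig g by (simp add: is_adjoint_def)
  then have "ip N (T g) \<psi> = - cnj \<mu> * ip N g \<psi>" unfolding ip_scale_right by simp
  also have "cnj \<mu> = of_real (Re \<mu>)" by (subst mu_real) simp
  finally have 1: "Re (ip N (T g) \<psi>) = - Re \<mu> * Re (ip N g \<psi>)" by simp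
  have "ip N (T g) \<psi> = ip N (T g) e + ip N (T g) (\<lambda>v. \<psi> v - e v)"
    using T_L2[OF g(1)] psi e_L2 by (simp add: ip_simps)
  then have "Re \<mu> * Re (ip N g \<psi>) = - Re (ip N (T g) (\<lambda>v. \<psi> v - e v))" using 1 g(3) by simp
  also have "\<dots> \<le> nrm N (T g) * w"
    using cauchy_schwarz[OF T_L2[OF g(1)] d(2)] abs_Re_le_cmod[of "ip N (T g) (\<lambda>v. \<psi> v - e v)"]
    unfolding w_def by linarith
  finally have 2: "Re \<mu> * Re (ip N g \<psi>) \<le> nrm N (T g) * w" .
  \<comment> \<open>\<open>g\<close> is within 1/4 of \<open>e\<close> and \<open>\<psi>\<close> has
    norm at most 2, so the pairing differs from 1 by at most 1/2.\<close>
  have "ip N g \<psi> = 1 + ip N (\<lambda>v. g v - e v) \<psi>"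
    using Dom_L2[OF g(1)] psi e_L2 ip_cnj[of N \<psi> e] eig(2) by (simp add: ip_simps)
  moreover have "cmod (ip N (\<lambda>v. g v - e v) \<psi>) \<le> 1 / 4 * 2"
    by (rule order_trans[OF cauchy_schwarz[OF d(1) psi] mult_mono[OF g(2) b(3)]]) auto
  ultimately have "1 / 2 \<le> Re (ip N g \<psi>)"
    using abs_Re_le_cmod[of "ip N (\<lambda>v. g v - e v) \<psi>"] by simp
  then have "Re \<mu> * (1 / 2) \<le> Re \<mu> * Re (ip N g \<psi>)" using b(1) by (rule mult_left_mono)
  then have "Re \<mu> / 2 \<le> nrm N (T g) * w" using 2 by simp
  \<comment> \<open>Squaring lets the bound on \<open>w\<close> return a factor
    \<open>Re \<mu>\<close>, which is then cancelled: the estimate becomes quadratic in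
    \<open>T g\<close>.\<close>
  then have "(Re \<mu> / 2)\<^sup>2 \<le> (nrm N (T g) * w)\<^sup>2" using b(1) by (intro power_mono) auto
  also have "\<dots> = (nrm N (T g))\<^sup>2 * w\<^sup>2" by (rule power_mult_distrib)
  also have "\<dots> \<le> (nrm N (T g))\<^sup>2 * (2 / lam * Re \<mu>)"
    using b(2) by (intro mult_left_mono) (auto simp: w_def)
  finally have 3: "Re \<mu> * Re \<mu> \<le> (8 / lam * (nrm N (T g))\<^sup>2) * Re \<mu>"
    by (simp add: power2_eq_square)
  show ?thesis
  proof (cases "Re \<mu> = 0")
    case False
    then have "Re \<mu> > 0" using b(1) by linarith
    then show ?thesis using 3 by (rule mult_right_le_imp_le[rotated])
  qed (use lam_pos in simp)
qed

text \<open>The eigenvalue equation expresses \<open>ip N (T g) e\<close> by a term with factor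
  \<open>\<mu>\<close> and a pairing with \<open>\<psi> - e\<close>. Both are of order
  \<open>sqrt (Re \<mu>)\<close>, so a test function with a sizeable pairing forces the eigenvalue
  away from 0.\<close>

lemma eigenvalue_lower_bound:
  assumes eig: "is_adjoint N Dom T \<psi> (\<lambda>v. - \<mu> * \<psi> v)" "ip N \<psi> e = 1" and mu: "cmod \<mu> < lam / 2" "Im \<mu> = 0"
    and g: "g \<in> Dom"
  shows "cmod (ip N (T g) e) \<le> sqrt (Re \<mu>) * (sqrt (2 / lam) * nrm N (T g) + 2 * sqrt lam * nrm N g)"
proof -
  note b = eigenvector_bounds[OF eig mu(1)]
  have psi: "\<psi> \<in> L2 N" using eig by (simp add: is_adjoint_def)
  have d: "(\<lambda>v. \<psi> v - e v) \<in> L2 N" by (intro L2_intros e_L2 psi)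
  have cmod_mu: "cmod \<mu> = Re \<mu>" using mu b(1) by (simp add: cmod_def)
  have "ip N (T g) \<psi> = - cnj \<mu> * ip N g \<psi>"
    using eig g unfolding is_adjoint_def ip_scale_right by simp
  moreover have "ip N (T g) \<psi> = ip N (T g) e + ip N (T g) (\<lambda>v. \<psi> v - e v)"
    using T_L2[OF g] psi e_L2 by (simp add: ip_simps)
  ultimately have "ip N (T g) e = - cnj \<mu> * ip N g \<psi> - ip N (T g) (\<lambda>v. \<psi> v - e v)"
    by (simp add: algebra_simps)
  then have "cmod (ip N (T g) e) \<le> cmod (- cnj \<mu> * ip N g \<psi>) + cmod (ip N (T g) (\<lambda>v. \<psi> v - e v))"
    using norm_triangle_ineq4 by metis
  also have "\<dots> \<le> Re \<mu> * (nrm N g * 2) + nrm N (T g) * nrm N (\<lambda>v. \<psi> v - e v)"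
    unfolding norm_mult norm_minus_cancel complex_mod_cnj cmod_mu
    using order_trans[OF cauchy_schwarz[OF Dom_L2[OF g] psi] mult_left_mono[OF b(3)]] b(1)
      cauchy_schwarz[OF T_L2[OF g] d]
    by (intro add_mono mult_left_mono) auto
  also have "\<dots> \<le> (sqrt (Re \<mu>) * sqrt lam) * (nrm N g * 2) + nrm N (T g) * (sqrt (2 / lam) * sqrt (Re \<mu>))"
  proof (intro add_mono mult_right_mono mult_left_mono)
    have "Re \<mu> * Re \<mu> \<le> Re \<mu> * lam"
      using b(1) mu(1) cmod_mu lam_pos by (intro mult_left_mono) auto
    then show "Re \<mu> \<le> sqrt (Re \<mu>) * sqrt lam"
      unfolding real_sqrt_mult[symmetric] by (simp add: real_le_rsqrt power2_eq_square)
    show "nrm N (\<lambda>v. \<psi> v - e v) \<le> sqrt (2 / lam) * sqrt (Re \<mu>)"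
      unfolding real_sqrt_mult[symmetric] using b(2) by (rule real_le_rsqrt)
  qed auto
  finally show ?thesis by (simp add: algebra_simps)
qed

end

section \<open>Rotation invariance of Lebesgue measure\<close>

text \<open>
  The library proves this only for index types with a wellorder. Here it follows, as in the proof
  of uniqueness of Haar measure, by computing the integral of
  \<open>indicator X (Q x) * indicator B (y - Q x)\<close> over all \<open>x\<close> and \<open>y\<close>, for the unit ball \<open>B\<close>, in
  both orders.
\<close>

lemma nn_integral_lborel_translate:
  fixes f :: "'a::euclidean_space \<Rightarrow> ennreal"
  assumes [measurable]: "f \<in> borel_measurable borel"
  shows "(\<integral>\<^sup>+x. f (c + x) \<partial>lborel) = (\<integral>\<^sup>+x. f x \<partial>lborel)"
  by (subst (2) lborel_distr_plus[of c, symmetric]) (simp add: nn_integral_distr)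

lemma lborel_distr_orthogonal:
  fixes Q :: "'a::euclidean_space \<Rightarrow> 'a"
  assumes Q: "orthogonal_transformation Q"
  shows "distr lborel borel Q = lborel"
proof (rule measure_eqI)
  fix X :: "'a set" assume "X \<in> sets (distr lborel borel Q)"
  then have X[measurable]: "X \<in> sets borel" by simp
  have lin: "linear Q" using Q by (rule orthogonal_transformation_linear)
  have Qm[measurable]: "Q \<in> borel_measurable borel"
    using lin by (intro borel_measurable_continuous_onI linear_continuous_on linear_conv_bounded_linear[THEN iffD1])
  obtain P where P: "\<And>y. Q (P y) = y"
    using orthogonal_transformation_surj[OF Q] by (metis surjD)
  define B where "B = ball (0::'a) 1"
  have B[measurable]: "B \<in> sets borel" by (simp add: B_def)
  let ?F = "\<lambda>x y. indicator X (Q x) * indicator B (y - Q x) :: ennreal"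
  have "(\<integral>\<^sup>+x. \<integral>\<^sup>+y. ?F x y \<partial>lborel \<partial>lborel) = (\<integral>\<^sup>+x. indicator X (Q x) * emeasure lborel B \<partial>lborel)"
  proof (rule nn_integral_cong)
    fix x
    have "(\<integral>\<^sup>+y. ?F x y \<partial>lborel) = indicator X (Q x) * (\<integral>\<^sup>+y. indicator B (- Q x + y) \<partial>lborel)"
      by (simp add: nn_integral_cmult)
    also have "(\<integral>\<^sup>+y. indicator B (- Q x + y) \<partial>lborel) = emeasure lborel B"
      by (subst nn_integral_lborel_translate) auto
    finally show "(\<integral>\<^sup>+y. ?F x y \<partial>lborel) = indicator X (Q x) * emeasure lborel B" .
  qed
  also have "\<dots> = emeasure (distr lborel borel Q) X * emeasure lborel B"
  proof -
    have "(\<integral>\<^sup>+x. indicator X (Q x) \<partial>lborel) = emeasure (distr lborel borel Q) X"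
      by (simp flip: nn_integral_indicator add: nn_integral_distr)
    then show ?thesis by (simp add: nn_integral_multc)
  qed
  finally have 1: "(\<integral>\<^sup>+x. \<integral>\<^sup>+y. ?F x y \<partial>lborel \<partial>lborel) = emeasure (distr lborel borel Q) X * emeasure lborel B" .
  \<comment> \<open>In the other order \<open>x\<close> is translated by \<open>P y\<close>, a
    preimage of \<open>y\<close>. Then \<open>y - Q x\<close> becomes \<open>- Q x\<close>, and the
    ball is invariant under \<open>Q\<close> and under reflection.\<close>
  have "(\<integral>\<^sup>+x. \<integral>\<^sup>+y. ?F x y \<partial>lborel \<partial>lborel) = (\<integral>\<^sup>+y. \<integral>\<^sup>+x. ?F x y \<partial>lborel \<partial>lborel)"
    by (rule lborel_pair.Fubini'[symmetric]) measurable
  also have "\<dots> = (\<integral>\<^sup>+y. \<integral>\<^sup>+x. indicator X (Q x + y) * indicator B x \<partial>lborel \<partial>lborel)"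
  proof (rule nn_integral_cong)
    fix y
    have "(\<integral>\<^sup>+x. ?F x y \<partial>lborel) = (\<integral>\<^sup>+x. ?F (P y + x) y \<partial>lborel)"
      by (rule nn_integral_lborel_translate[symmetric]) measurable
    also have "\<dots> = (\<integral>\<^sup>+x. indicator X (Q x + y) * indicator B x \<partial>lborel)"
    proof (rule nn_integral_cong)
      fix x
      have "indicator B (y - Q (P y + x)) = (indicator B x :: ennreal)"
        using orthogonal_transformation_norm[OF Q, of x]
        by (simp add: linear_add[OF lin] P B_def indicator_def)
      then show "?F (P y + x) y = indicator X (Q x + y) * indicator B x"
        by (simp add: linear_add[OF lin] P add.commute)
    qed
    finally show "(\<integral>\<^sup>+x. ?F x y \<partial>lborel) = (\<integral>\<^sup>+x. indicator X (Q x + y) * indicator B x \<partial>lborel)" .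
  qed
  also have "\<dots> = (\<integral>\<^sup>+x. \<integral>\<^sup>+y. indicator X (Q x + y) * indicator B x \<partial>lborel \<partial>lborel)"
    by (rule lborel_pair.Fubini') measurable
  also have "\<dots> = (\<integral>\<^sup>+x. emeasure lborel X * indicator B x \<partial>lborel)"
  proof (rule nn_integral_cong)
    fix x
    have "(\<integral>\<^sup>+y. indicator X (Q x + y) \<partial>lborel) = emeasure lborel X"
      by (subst nn_integral_lborel_translate) auto
    then show "(\<integral>\<^sup>+y. indicator X (Q x + y) * indicator B x \<partial>lborel) = emeasure lborel X * indicator B x"
      by (simp add: nn_integral_multc)
  qed
  also have "\<dots> = emeasure lborel X * emeasure lborel B" by (simp add: nn_integral_cmult)
  finally have "emeasure (distr lborel borel Q) X * emeasure lborel B = emeasure lborel X * emeasure lborel B"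
    using 1 by simp
  \<comment> \<open>Cancelling the volume of the ball requires it to be positive and finite.\<close>
  moreover have "emeasure lborel B \<noteq> 0"
  proof
    assume "emeasure lborel B = 0"
    then have "measure lborel B = 0" by (simp add: measure_def)
    then show False using content_ball_gt_0_iff[of "0::'a" 1] by (simp add: B_def)
  qed
  moreover have "emeasure lborel B \<noteq> top" unfolding B_def using emeasure_lborel_ball_finite[of "0::'a" 1] by simp
  ultimately show "emeasure (distr lborel borel Q) X = emeasure lborel X"
    by (simp add: mult.commute[of _ "emeasure lborel B"] ennreal_mult_cancel_left)
qed simp

text \<open>In dimension one no map of determinant 1 exchanges the two unit vectors; there the
  reflection counts as a rotation by definition.\<close>

lemma rotation_exists_unit:
  fixes a b :: "real^'n"
  assumes "norm a = 1" "norm b = 1"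
  shows "\<exists>Q. rotation Q \<and> Q a = b"
proof (cases "CARD('n) = 1")
  case True
  obtain f where "orthogonal_transformation f" "f a = b"
    using orthogonal_transformation_exists_1[OF assms] .
  with True show ?thesis by (auto simp: rotation_def)
next
  case False
  moreover have "CARD('n) > 0" by simp
  ultimately have "2 \<le> CARD('n)" by linarith
  from rotation_exists_1[OF this assms]
  obtain f where "orthogonal_transformation f" "det(matrix f) = 1" "f a = b" .
  then show ?thesis by (auto simp: rotation_def)
qed

section \<open>Moments of power weights\<close>

lemma jb_ge_1: "1 \<le> jb v"
  by (simp add: jb_def)

lemma jb_pos: "0 < jb v"
  using jb_ge_1[of v] by linarith

lemma norm_le_jb: "norm v \<le> jb v"
  unfolding jb_def by (rule real_le_rsqrt) simp

lemma jb_le: "jb v \<le> 1 + norm v"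
  unfolding jb_def by (rule real_le_lsqrt) (auto simp: power2_sum)

lemma jb_continuous: "continuous_on S jb"
  unfolding jb_def by (intro continuous_intros)

lemma jb_measurable [measurable]: "jb \<in> borel_measurable borel"
  by (intro borel_measurable_continuous_onI jb_continuous)

lemma ball_borel [measurable]: "ball x r \<in> sets borel"
  by (rule borel_open) simp

lemma powr_between:
  fixes x R c t :: real
  assumes "1 \<le> c" "0 < R" "R / c \<le> x" "x \<le> c * R"
  shows "x powr t \<le> c powr \<bar>t\<bar> * R powr t" "c powr - \<bar>t\<bar> * R powr t \<le> x powr t"
proof -
  have x: "x > 0" using assms by (meson divide_pos_pos less_le_trans zero_less_one)
  have up: "x powr u \<le> c powr u * R powr u" and lo: "c powr - u * R powr u \<le> x powr u" if "u \<ge> 0" for u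
  proof -
    have "x powr u \<le> (c * R) powr u" using assms x that by (intro powr_mono2) auto
    then show "x powr u \<le> c powr u * R powr u" using assms by (simp add: powr_mult)
    have "(R / c) powr u \<le> x powr u" using assms that by (intro powr_mono2) auto
    then show "c powr - u * R powr u \<le> x powr u" using assms by (simp add: powr_divide powr_minus field_simps)
  qed
  show "x powr t \<le> c powr \<bar>t\<bar> * R powr t"
  proof (cases "t \<ge> 0")
    case False
    then have "c powr - (- t) * R powr - t \<le> x powr - t" by (intro lo) auto
    then show ?thesis using False assms x by (simp add: powr_minus field_simps)
  qed (use up in auto)
  show "c powr - \<bar>t\<bar> * R powr t \<le> x powr t"
  proof (cases "t \<ge> 0")
    case False
    then have "x powr - t \<le> c powr - t * R powr - t" by (intro up) auto
    then show ?thesis using False assms x by (simp add: powr_minus field_simps)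
  qed (use lo in auto)
qed

text \<open>Taken in \<open>ennreal\<close>, so that bounds can be proved before integrability is
  known. Exponents below have the form \<open>s\<close> minus the dimension: over a ball of radius R
  the integral is then bounded, logarithmic or of order R to the power \<open>s\<close>, according
  to the sign of \<open>s\<close>.\<close>

definition jint :: "real \<Rightarrow> (real^'n) set \<Rightarrow> ennreal" where
  "jint t X = (\<integral>\<^sup>+v. ennreal (jb v powr t) * indicator X v \<partial>lborel)"

lemma emeasure_ball_scaled:
  fixes c :: "real^'n"
  assumes "r \<ge> 0"
  shows "emeasure lborel (ball c r) = ennreal (unit_ball_vol (real CARD('n)) * r powr real CARD('n))"
  using assms by (cases "r = 0") (auto simp: emeasure_ball powr_realpow)

text \<open>On \<open>X\<close> the weight is comparable to a constant, since \<open>jb v\<close>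
  lies between \<open>R\<close> and \<open>3 * R\<close>. The lower bound is asked of
  \<open>jb v\<close> and not of \<open>norm v\<close> so that the unit ball, with
  \<open>R = 1\<close>, is covered too.\<close>

lemma jint_annulus_le:
  assumes "R \<ge> 1" "X \<subseteq> ball (0::real^'n) (2 * R)" "\<And>v. v \<in> X \<Longrightarrow> R \<le> jb v" "X \<in> sets borel"
  shows "jint (s - real CARD('n)) X \<le>
    ennreal (3 powr \<bar>s - real CARD('n)\<bar> * unit_ball_vol (real CARD('n)) * 2 powr real CARD('n) * R powr s)"
proof -
  let ?d = "real CARD('n)" and ?t = "s - real CARD('n)"
  have "jint ?t X \<le> (\<integral>\<^sup>+v. ennreal (3 powr \<bar>?t\<bar> * R powr ?t) * indicator (ball (0::real^'n) (2 * R)) v \<partial>lborel)"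
    unfolding jint_def
  proof (rule nn_integral_mono)
    fix v :: "real^'n"
    show "ennreal (jb v powr ?t) * indicator X v \<le> ennreal (3 powr \<bar>?t\<bar> * R powr ?t) * indicator (ball 0 (2 * R)) v"
    proof (cases "v \<in> X")
      case True
      then have n: "norm v < 2 * R" using assms(2) by auto
      have "jb v powr ?t \<le> 3 powr \<bar>?t\<bar> * R powr ?t"
      proof (rule powr_between)
        show "jb v \<le> 3 * R" using jb_le[of v] n assms(1) by linarith
        show "R / 3 \<le> jb v" using assms(3)[OF True] assms(1) by linarith
      qed (use assms in auto)
      then show ?thesis using True assms(2) by (auto simp: indicator_def intro: ennreal_leI)
    qed simp
  qed
  also have "\<dots> = ennreal (3 powr \<bar>?t\<bar> * R powr ?t) * ennreal (unit_ball_vol ?d * (2 * R) powr ?d)"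
    using assms(1) emeasure_ball_scaled[of "2 * R" "0::real^'n"] by (subst nn_integral_cmult_indicator) auto
  also have "\<dots> = ennreal ((3 powr \<bar>?t\<bar> * R powr ?t) * (unit_ball_vol ?d * (2 * R) powr ?d))"
    by (simp add: ennreal_mult'')
  also have "(3 powr \<bar>?t\<bar> * R powr ?t) * (unit_ball_vol ?d * (2 * R) powr ?d) =
      3 powr \<bar>?t\<bar> * unit_ball_vol ?d * 2 powr ?d * R powr s"
  proof -
    have "R powr s = R powr ?t * R powr ?d" by (simp flip: powr_add)
    then show ?thesis using assms(1) by (simp add: powr_mult)
  qed
  finally show ?thesis .
qed

lemma jint_Un_le:
  assumes "X \<in> sets borel" "Y \<in> sets borel" "Z \<subseteq> X \<union> Y"
  shows "jint t Z \<le> jint t X + jint t Y"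
proof -
  have "jint t Z \<le> (\<integral>\<^sup>+v. ennreal (jb v powr t) * indicator X v + ennreal (jb v powr t) * indicator Y v \<partial>lborel)"
    unfolding jint_def using assms(3) by (intro nn_integral_mono) (auto simp: indicator_def)
  also have "\<dots> = jint t X + jint t Y"
  proof -
    note [measurable] = assms(1,2)
    show ?thesis unfolding jint_def by (intro nn_integral_add) measurable
  qed
  finally show ?thesis .
qed

lemma jint_mono: "X \<subseteq> Y \<Longrightarrow> jint t X \<le> jint t Y"
  unfolding jint_def by (intro nn_integral_mono mult_left_mono) (auto simp: indicator_def)

text \<open>The ball is the unit ball, which accounts for the 1, together with \<open>n\<close>
  dyadic annuli, each scaling like its radius to the power \<open>s\<close>. One geometric sum thus
  covers all signs of \<open>s\<close>.\<close>

lemma jint_dyadic_le: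
  "\<exists>C>0. \<forall>n. jint (s - real CARD('n)) (ball (0::real^'n) (2 ^ n)) \<le> ennreal (C * (1 + (\<Sum>k<n. (2 powr s) ^ k)))"
proof -
  let ?d = "real CARD('n)"
  define C where "C = 3 powr \<bar>s - ?d\<bar> * unit_ball_vol ?d * 2 powr ?d"
  have C: "C > 0" unfolding C_def by (simp add: unit_ball_vol_pos)
  have "jint (s - ?d) (ball (0::real^'n) (2 ^ n)) \<le> ennreal (C * (1 + (\<Sum>k<n. (2 powr s) ^ k)))" for n
  proof (induction n)
    case 0
    have "ball (0::real^'n) 1 \<subseteq> ball 0 (2 * 1)" by auto
    from jint_annulus_le[OF _ this, of s] show ?case by (simp add: C_def jb_ge_1)
  next
    case (Suc n)
    let ?X = "ball (0::real^'n) (2 ^ Suc n) - ball 0 (2 ^ n)"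
    have "jint (s - ?d) (ball (0::real^'n) (2 ^ Suc n)) \<le> jint (s - ?d) (ball (0::real^'n) (2 ^ n)) + jint (s - ?d) ?X"
      by (rule jint_Un_le) auto
    also have "\<dots> \<le> ennreal (C * (1 + (\<Sum>k<n. (2 powr s) ^ k))) + ennreal (C * (2 ^ n) powr s)"
    proof (rule add_mono[OF Suc.IH])
      show "jint (s - ?d) ?X \<le> ennreal (C * (2 ^ n) powr s)"
        unfolding C_def
      proof (rule jint_annulus_le)
        fix v assume "v \<in> ?X"
        then show "2 ^ n \<le> jb v" using norm_le_jb[of v] by auto
      qed auto
    qed
    also have "\<dots> = ennreal (C * (1 + (\<Sum>k<n. (2 powr s) ^ k)) + C * (2 ^ n) powr s)"
      using C by (intro ennreal_plus[symmetric] mult_nonneg_nonneg add_nonneg_nonneg sum_nonneg) auto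
    also have "((2::real) ^ n) powr s = (2 powr s) ^ n"
      by (simp add: powr_powr mult.commute flip: powr_realpow)
    finally show ?case by (simp add: algebra_simps)
  qed
  with C show ?thesis by blast
qed

lemma dyadic_exponent:
  assumes "R \<ge> (1::real)"
  obtains n where "R < 2 ^ Suc n" "2 ^ n \<le> R" "real n \<le> log 2 R" "log 2 R < real n + 1"
proof
  define n where "n = nat \<lfloor>log 2 R\<rfloor>"
  have l: "0 \<le> log 2 R" using assms by simp
  show le: "real n \<le> log 2 R" and lt: "log 2 R < real n + 1" unfolding n_def using l by linarith+
  have "2 powr real n \<le> 2 powr log 2 R" using le by (intro powr_mono) auto
  then show "2 ^ n \<le> R" using assms by (simp add: powr_realpow)
  have "2 powr log 2 R < 2 powr real (Suc n)" using lt by (intro powr_less_mono) auto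
  then show "R < 2 ^ Suc n" using assms by (simp add: powr_realpow del: power_Suc of_nat_Suc)
qed

lemma integrable_jb_powr:
  assumes "s < 0"
  shows "integrable lborel (\<lambda>v::real^'n. jb v powr (s - real CARD('n)))"
proof (rule integrableI_bounded)
  let ?t = "s - real CARD('n)"
  obtain C where C: "C > 0" "\<And>n. jint ?t (ball (0::real^'n) (2 ^ n)) \<le> ennreal (C * (1 + (\<Sum>k<n. (2 powr s) ^ k)))"
    using jint_dyadic_le[of s] by blast
  define q where "q = (2::real) powr s"
  have q: "0 < q" "q < 1" unfolding q_def using assms powr_less_mono[of s 0 2] by auto
  have "(\<integral>\<^sup>+v. ennreal (norm (jb (v::real^'n) powr ?t)) \<partial>lborel) = (\<integral>\<^sup>+v. (SUP n. ennreal (jb v powr ?t) * indicator (ball (0::real^'n) (2 ^ n)) v) \<partial>lborel)"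
  proof (rule nn_integral_cong)
    fix v :: "real^'n"
    obtain n where "norm v < 2 ^ n" using real_arch_pow[of 2 "norm v"] by auto
    then have "ennreal (jb v powr ?t) \<le> ennreal (jb v powr ?t) * indicator (ball 0 (2 ^ n)) v" by simp
    then have "ennreal (jb v powr ?t) \<le> (SUP n. ennreal (jb v powr ?t) * indicator (ball 0 (2 ^ n)) v)"
      by (rule SUP_upper2[OF UNIV_I])
    moreover have "(SUP n. ennreal (jb v powr ?t) * indicator (ball 0 (2 ^ n)) v) \<le> ennreal (jb v powr ?t)"
      by (rule SUP_least) (simp add: indicator_def)
    ultimately show "ennreal (norm (jb v powr ?t)) = (SUP n. ennreal (jb v powr ?t) * indicator (ball 0 (2 ^ n)) v)"
      by simp
  qed
  also have "\<dots> = (SUP n. jint ?t (ball (0::real^'n) (2 ^ n)))"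
    unfolding jint_def
  proof (rule nn_integral_monotone_convergence_SUP)
    show "incseq (\<lambda>n v. ennreal (jb v powr ?t) * indicator (ball (0::real^'n) (2 ^ n)) v)"
    proof (intro incseq_SucI le_funI mult_left_mono)
      fix n and v :: "real^'n"
      have "norm v < 2 * 2 ^ n" if "norm v < 2 ^ n" using that norm_ge_zero[of v] by linarith
      then show "indicator (ball 0 (2 ^ n)) v \<le> (indicator (ball 0 (2 ^ Suc n)) v :: ennreal)"
        by (auto simp: indicator_def)
    qed simp
  qed measurable
  also have "\<dots> \<le> ennreal (C * (1 + 1 / (1 - q)))"
  proof (rule SUP_least)
    fix n
    have "(\<Sum>k<n. q ^ k) \<le> 1 / (1 - q)"
      using q sum_le_suminf[OF summable_geometric, of q "{..<n}"] by (simp add: suminf_geometric)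
    then have "C * (1 + (\<Sum>k<n. q ^ k)) \<le> C * (1 + 1 / (1 - q))" using C by simp
    then show "jint ?t (ball (0::real^'n) (2 ^ n)) \<le> ennreal (C * (1 + 1 / (1 - q)))"
      using C(2)[of n] unfolding q_def by (meson ennreal_leI order_trans)
  qed
  also have "\<dots> < \<infinity>" by simp
  finally show "(\<integral>\<^sup>+v. ennreal (norm (jb (v::real^'n) powr ?t)) \<partial>lborel) < \<infinity>" .
qed measurable

text \<open>For \<open>s > 0\<close> the geometric sum has ratio larger than 1 and is comparable to
  its last term.\<close>

lemma jint_ball_le_powr:
  assumes "s > 0"
  shows "\<exists>C>0. \<forall>R\<ge>1. jint (s - real CARD('n)) (ball (0::real^'n) R) \<le> ennreal (C * R powr s)"
proof -
  let ?t = "s - real CARD('n)"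
  obtain C where C: "C > 0" "\<And>n. jint ?t (ball (0::real^'n) (2 ^ n)) \<le> ennreal (C * (1 + (\<Sum>k<n. (2 powr s) ^ k)))"
    using jint_dyadic_le[of s] by blast
  define q where "q = (2::real) powr s"
  have q: "1 < q" unfolding q_def using assms powr_less_mono[of 0 s 2] by auto
  have "jint ?t (ball (0::real^'n) R) \<le> ennreal (C * (1 + q / (q - 1)) * R powr s)" if R: "R \<ge> 1" for R
  proof -
    obtain n where n: "R < 2 ^ Suc n" "2 ^ n \<le> R" using dyadic_exponent[OF R] .
    have "q ^ Suc n = q * (2 ^ n) powr s"
      unfolding q_def by (simp add: powr_powr mult.commute flip: powr_realpow)
    also have "\<dots> \<le> q * R powr s" using n q assms by (intro mult_left_mono powr_mono2) auto
    finally have qn: "q ^ Suc n \<le> q * R powr s" .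
    have "(\<Sum>k<Suc n. q ^ k) = (q ^ Suc n - 1) / (q - 1)"
      using q geometric_sum[of q "Suc n"] by simp
    also have "\<dots> \<le> (q * R powr s) / (q - 1)" using qn q by (intro divide_right_mono) linarith+
    finally have 1: "(\<Sum>k<Suc n. q ^ k) \<le> q / (q - 1) * R powr s" by simp
    have "1 \<le> R powr s" using R assms by (simp add: ge_one_powr_ge_zero)
    then have "1 + (\<Sum>k<Suc n. q ^ k) \<le> (1 + q / (q - 1)) * R powr s" using 1 by (simp add: distrib_right)
    then have "C * (1 + (\<Sum>k<Suc n. q ^ k)) \<le> C * (1 + q / (q - 1)) * R powr s" using C by (simp add: mult.assoc)
    moreover have "jint ?t (ball (0::real^'n) R) \<le> jint ?t (ball (0::real^'n) (2 ^ Suc n))"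
      using n by (intro jint_mono) auto
    ultimately show ?thesis using C(2)[of "Suc n"] unfolding q_def by (meson ennreal_leI order_trans)
  qed
  moreover have "C * (1 + q / (q - 1)) > 0" using C q by (simp add: add_pos_pos)
  ultimately show ?thesis by blast
qed

text \<open>For \<open>s = 0\<close> every term of the sum is 1, and the number of annuli is of
  order \<open>log 2 R\<close>. The restriction \<open>R \<ge> 2\<close> lets the logarithm absorb
  the additive constants.\<close>

lemma jint_ball_le_ln:
  "\<exists>C>0. \<forall>R\<ge>2. jint (- real CARD('n)) (ball (0::real^'n) R) \<le> ennreal (C * ln R)"
proof -
  let ?t = "- real CARD('n)"
  obtain C where C: "C > 0" "\<And>n. jint ?t (ball (0::real^'n) (2 ^ n)) \<le> ennreal (C * (1 + (\<Sum>k<n. (2 powr 0) ^ k)))"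
    using jint_dyadic_le[of 0, where 'n = 'n] by auto
  have "jint ?t (ball (0::real^'n) R) \<le> ennreal (3 * C / ln 2 * ln R)" if R: "R \<ge> 2" for R
  proof -
    have "R \<ge> 1" using R by simp
    from dyadic_exponent[OF this] obtain n where n: "R < 2 ^ Suc n" "real n \<le> log 2 R" by metis
    have "1 \<le> log 2 R" using R by simp
    then have "1 + real (Suc n) \<le> 3 * log 2 R" using n by simp
    then have "C * (1 + (\<Sum>k<Suc n. (2 powr 0) ^ k)) \<le> C * (3 * log 2 R)"
      using C by (intro mult_left_mono) auto
    also have "\<dots> = 3 * C / ln 2 * ln R" by (simp add: log_def)
    finally have *: "C * (1 + (\<Sum>k<Suc n. (2 powr 0) ^ k)) \<le> 3 * C / ln 2 * ln R" .
    have "jint ?t (ball (0::real^'n) R) \<le> jint ?t (ball (0::real^'n) (2 ^ Suc n))"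
      using n by (intro jint_mono) auto
    then show ?thesis using C(2)[of "Suc n"] ennreal_leI[OF *] by (meson order_trans)
  qed
  moreover have "3 * C / ln 2 > 0" using C by simp
  ultimately show ?thesis by blast
qed

text \<open>
  The ball with centre \<open>3/4 r \<sigma>\<close> and radius \<open>r/8\<close> lies in the annulus \<open>r/2 \<le> norm v < r\<close>, and
  \<open>v \<bullet> \<sigma>\<close> is comparable to \<open>r\<close> on it.
\<close>

lemma second_moment_annulus_ge:
  "\<exists>c>0. \<forall>\<sigma>::real^'n. \<forall>r\<ge>1. norm \<sigma> = 1 \<longrightarrow>
    ennreal (c * r powr s) \<le> (\<integral>\<^sup>+v. ennreal ((v \<bullet> \<sigma>)\<^sup>2 * jb v powr (s - 2 - real CARD('n))) * indicator (ball 0 r - ball 0 (r / 2)) v \<partial>lborel)"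
proof -
  let ?d = "real CARD('n)" and ?t = "s - 2 - real CARD('n)"
  define c where "c = (5/8)\<^sup>2 * 2 powr - \<bar>?t\<bar> * (unit_ball_vol ?d * (1/8) powr ?d)"
  have c: "c > 0" unfolding c_def by (simp add: unit_ball_vol_pos)
  have "ennreal (c * r powr s) \<le> (\<integral>\<^sup>+v. ennreal ((v \<bullet> \<sigma>)\<^sup>2 * jb v powr ?t) * indicator (ball 0 r - ball 0 (r / 2)) v \<partial>lborel)"
    if s: "norm \<sigma> = 1" and r: "r \<ge> 1" for \<sigma> :: "real^'n" and r
  proof -
    let ?B = "ball ((3 / 4 * r) *\<^sub>R \<sigma>) (r / 8)"
    have "c * r powr s = ((5/8 * r)\<^sup>2 * (2 powr - \<bar>?t\<bar> * r powr ?t)) * (unit_ball_vol ?d * (r / 8) powr ?d)"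
    proof -
      have "r powr s = r powr (2 + ?t + ?d)" by simp
      also have "\<dots> = r\<^sup>2 * r powr ?t * r powr ?d"
        using r by (subst powr_add, subst powr_add) (simp add: powr_numeral)
      finally show ?thesis using r unfolding c_def by (simp add: powr_divide power_mult_distrib power_divide field_simps)
    qed
    then have "ennreal (c * r powr s) = ennreal ((5/8 * r)\<^sup>2 * (2 powr - \<bar>?t\<bar> * r powr ?t)) * emeasure lborel ?B"
      using r by (simp add: emeasure_ball_scaled ennreal_mult'')
    also have "\<dots> = (\<integral>\<^sup>+v. ennreal ((5/8 * r)\<^sup>2 * (2 powr - \<bar>?t\<bar> * r powr ?t)) * indicator ?B v \<partial>lborel)"
      by (simp add: nn_integral_cmult_indicator)
    also have "\<dots> \<le> (\<integral>\<^sup>+v. ennreal ((v \<bullet> \<sigma>)\<^sup>2 * jb v powr ?t) * indicator (ball 0 r - ball 0 (r / 2)) v \<partial>lborel)"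
    proof (rule nn_integral_mono)
      fix v :: "real^'n"
      show "ennreal ((5/8 * r)\<^sup>2 * (2 powr - \<bar>?t\<bar> * r powr ?t)) * indicator ?B v \<le>
        ennreal ((v \<bullet> \<sigma>)\<^sup>2 * jb v powr ?t) * indicator (ball 0 r - ball 0 (r / 2)) v"
      proof (cases "v \<in> ?B")
        case True
        define z where "z = v - (3 / 4 * r) *\<^sub>R \<sigma>"
        have z: "norm z < r / 8" using True by (simp add: z_def dist_norm norm_minus_commute)
        have v: "v = (3 / 4 * r) *\<^sub>R \<sigma> + z" by (simp add: z_def)
        have "\<bar>z \<bullet> \<sigma>\<bar> \<le> norm z" using Cauchy_Schwarz_ineq2[of z \<sigma>] s by simp
        moreover have "v \<bullet> \<sigma> = 3 / 4 * r + z \<bullet> \<sigma>"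
          using s unfolding v inner_add_left by (simp add: norm_eq_1)
        ultimately have vs: "5/8 * r \<le> v \<bullet> \<sigma>" using z by linarith
        have "\<bar>v \<bullet> \<sigma>\<bar> \<le> norm v" using Cauchy_Schwarz_ineq2[of v \<sigma>] s by simp
        then have lo: "r / 2 \<le> norm v" using vs r by linarith
        have "norm v \<le> norm ((3 / 4 * r) *\<^sub>R \<sigma>) + norm z" unfolding v by (rule norm_triangle_ineq)
        then have hi: "norm v < r" using z s r by simp
        \<comment> \<open>Here \<open>jb v\<close> is between \<open>r / 2\<close> and
          \<open>1 + r\<close>, hence at most \<open>2 * r\<close>; this is where
          \<open>r \<ge> 1\<close> enters.\<close>
        have "2 powr - \<bar>?t\<bar> * r powr ?t \<le> jb v powr ?t"
          by (rule powr_between(2)) (use r lo hi norm_le_jb[of v] jb_le[of v] in auto)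
        moreover have "(5/8 * r)\<^sup>2 \<le> (v \<bullet> \<sigma>)\<^sup>2" using vs r by (intro power_mono) auto
        ultimately have "(5/8 * r)\<^sup>2 * (2 powr - \<bar>?t\<bar> * r powr ?t) \<le> (v \<bullet> \<sigma>)\<^sup>2 * jb v powr ?t"
          by (intro mult_mono) auto
        then show ?thesis using True lo hi by (auto simp: indicator_def intro!: ennreal_leI)
      qed simp
    qed
    finally show ?thesis .
  qed
  with c show ?thesis by blast
qed

text \<open>At the critical exponent each dyadic annulus contributes at least the same constant, so
  the sum grows with the number of annuli.\<close>

lemma second_moment_ge_ln:
  "\<exists>c>0. \<forall>\<sigma>::real^'n. \<forall>R\<ge>2. norm \<sigma> = 1 \<longrightarrow>
    ennreal (c * ln R) \<le> (\<integral>\<^sup>+v. ennreal ((v \<bullet> \<sigma>)\<^sup>2 * jb v powr (- 2 - real CARD('n))) * indicator (ball 0 R) v \<partial>lborel)"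
proof -
  let ?t = "- 2 - real CARD('n)"
  obtain c where c: "c > 0" "\<And>(\<sigma>::real^'n) r. r \<ge> 1 \<Longrightarrow> norm \<sigma> = 1 \<Longrightarrow>
    ennreal c \<le> (\<integral>\<^sup>+v. ennreal ((v \<bullet> \<sigma>)\<^sup>2 * jb v powr ?t) * indicator (ball 0 r - ball 0 (r / 2)) v \<partial>lborel)"
    using second_moment_annulus_ge[of 0, where 'n = 'n] by auto
  have dy: "ennreal (c * real n) \<le> (\<integral>\<^sup>+v. ennreal ((v \<bullet> \<sigma>)\<^sup>2 * jb v powr ?t) * indicator (ball 0 (2 ^ n)) v \<partial>lborel)"
    if "norm \<sigma> = 1" for \<sigma> :: "real^'n" and n
  proof (induction n)
    case (Suc n)
    let ?f = "\<lambda>v. ennreal ((v \<bullet> \<sigma>)\<^sup>2 * jb v powr ?t)"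
    have "ennreal (c * real (Suc n)) = ennreal (c * real n) + ennreal c"
      using c by (subst ennreal_plus[symmetric]) (auto simp: algebra_simps)
    also have "\<dots> \<le> (\<integral>\<^sup>+v. ?f v * indicator (ball 0 (2 ^ n)) v \<partial>lborel) +
        (\<integral>\<^sup>+v. ?f v * indicator (ball 0 (2 ^ Suc n) - ball 0 (2 ^ Suc n / 2)) v \<partial>lborel)"
      using that by (intro add_mono Suc c(2) one_le_power) auto
    also have "\<dots> = (\<integral>\<^sup>+v. ?f v * indicator (ball 0 (2 ^ n)) v + ?f v * indicator (ball 0 (2 ^ Suc n) - ball 0 (2 ^ Suc n / 2)) v \<partial>lborel)"
      by (rule nn_integral_add[symmetric]) measurable
    also have "\<dots> = (\<integral>\<^sup>+v. ?f v * indicator (ball 0 (2 ^ Suc n)) v \<partial>lborel)"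
    proof (rule nn_integral_cong)
      fix v :: "real^'n"
      have "norm v < 2 * 2 ^ n" if "norm v < 2 ^ n" using that norm_ge_zero[of v] by linarith
      then show "?f v * indicator (ball 0 (2 ^ n)) v + ?f v * indicator (ball 0 (2 ^ Suc n) - ball 0 (2 ^ Suc n / 2)) v =
        ?f v * indicator (ball 0 (2 ^ Suc n)) v"
        by (auto simp: indicator_def)
    qed
    finally show ?case .
  qed simp
  have "ennreal (c / (2 * ln 2) * ln R) \<le> (\<integral>\<^sup>+v. ennreal ((v \<bullet> \<sigma>)\<^sup>2 * jb v powr ?t) * indicator (ball 0 R) v \<partial>lborel)"
    if s: "norm \<sigma> = 1" and R: "R \<ge> 2" for \<sigma> :: "real^'n" and R
  proof -
    have "R \<ge> 1" using R by simp
    from dyadic_exponent[OF this] obtain n where n: "2 ^ n \<le> R" "log 2 R < real n + 1" by metis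
    have "1 \<le> log 2 R" using R by simp
    \<comment> \<open>At least one full annulus fits into the ball, which allows
      \<open>n + 1\<close> to be replaced by \<open>2 * n\<close>.\<close>
    then have "n \<noteq> 0" using n(2) by auto
    then have "log 2 R \<le> 2 * real n" using n(2) by linarith
    then have "c / 2 * log 2 R \<le> c * real n" using c by simp
    then have "ennreal (c / (2 * ln 2) * ln R) \<le> ennreal (c * real n)" by (intro ennreal_leI) (simp add: log_def)
    also have "\<dots> \<le> (\<integral>\<^sup>+v. ennreal ((v \<bullet> \<sigma>)\<^sup>2 * jb v powr ?t) * indicator (ball 0 (2 ^ n)) v \<partial>lborel)"
      by (rule dy[OF s])
    also have "\<dots> \<le> (\<integral>\<^sup>+v. ennreal ((v \<bullet> \<sigma>)\<^sup>2 * jb v powr ?t) * indicator (ball 0 R) v \<partial>lborel)"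
      using n(1) by (intro nn_integral_mono mult_left_mono) (auto simp: indicator_def)
    finally show ?thesis .
  qed
  moreover have "c / (2 * ln 2) > 0" using c by simp
  ultimately show ?thesis by blast
qed

section \<open>The kinetic operator\<close>

lemma L2_mult_bounded:
  assumes "f \<in> L2 N" "m \<in> borel_measurable N" "\<And>v. \<bar>m v\<bar> \<le> C"
  shows "(\<lambda>v. of_real (m v) * f v) \<in> L2 N" "nrm N (\<lambda>v. of_real (m v) * f v) \<le> C * nrm N f"
proof -
  have "0 \<le> C" using assms(3) abs_ge_zero order_trans by blast
  moreover have "AE v in N. cmod (of_real (m v) * f v) \<le> C * cmod (f v)"
    using assms(3) by (auto simp: norm_mult intro!: mult_right_mono)
  moreover have "(\<lambda>v. complex_of_real (m v) * f v) \<in> borel_measurable N"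
    using assms(2) L2_measurable[OF assms(1)] by measurable
  ultimately show "(\<lambda>v. of_real (m v) * f v) \<in> L2 N" "nrm N (\<lambda>v. of_real (m v) * f v) \<le> C * nrm N f"
    using nrm_le_scale[OF assms(1), of "\<lambda>v. of_real (m v) * f v" C] by auto
qed

lemma ip_real_mult: "ip N (\<lambda>v. of_real (m v) * f v) g = ip N f (\<lambda>v. of_real (m v) * g v)"
  unfolding ip_def by (simp add: mult_ac)

lemma Im_ip_real_mult_self: "Im (ip N (\<lambda>v. of_real (m v) * f v) f) = 0"
proof -
  have "ip N (\<lambda>v. of_real (m v) * f v) f = (LINT v|N. of_real (m v * (cmod (f v))\<^sup>2))"
    unfolding ip_def
    by (rule arg_cong[where f = "integral\<^sup>L N"]) (auto simp: complex_norm_square mult.assoc simp flip: of_real_power)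
  then show ?thesis unfolding integral_complex_of_real by (simp only: Im_complex_of_real)
qed

lemma vel_measurable [measurable]: "vel \<beta> \<sigma> \<in> borel_measurable borel"
  unfolding vel_def by measurable

lemma abs_vel_le:
  assumes "norm \<sigma> = 1"
  shows "\<bar>vel \<beta> \<sigma> v\<bar> \<le> jb v powr (1 + \<beta>)"
proof -
  have "\<bar>v \<bullet> \<sigma>\<bar> \<le> jb v" using Cauchy_Schwarz_ineq2[of v \<sigma>] assms norm_le_jb[of v] by simp
  then have "\<bar>vel \<beta> \<sigma> v\<bar> \<le> jb v * jb v powr \<beta>"
    unfolding vel_def abs_mult by (intro mult_mono) auto
  then show ?thesis using jb_pos[of v] by (simp add: powr_add)
qed

lemma jb_powr_le_ball:
  assumes "norm v < r"
  shows "jb v powr t \<le> (1 + r) powr \<bar>t\<bar>"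
proof -
  have "jb v powr t \<le> jb v powr \<bar>t\<bar>" using jb_ge_1 by (intro powr_mono) auto
  also have "\<dots> \<le> (1 + r) powr \<bar>t\<bar>" using jb_le[of v] assms jb_pos[of v] by (intro powr_mono2) auto
  finally show ?thesis .
qed

text \<open>Of the equilibrium only what its two cases share is kept: positivity, radial symmetry
  and normalisation. Tails and large velocities enter later, as explicit assumptions of single
  lemmas.\<close>

locale collision =
  fixes \<beta> lam :: real and M :: "real^'n \<Rightarrow> real" and D Dt L
  assumes lam_pos: "lam > 0"
    and M_meas [measurable]: "M \<in> borel_measurable borel"
    and M_pos: "0 < M v"
    and M_radial: "norm u = norm v \<Longrightarrow> M u = M v"
    and M_int: "(LINT v|lborel. wgt \<beta> M v) = 1"
    and coercivity: "weighted_coercivity \<beta> lam M D Dt L"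
    and well_posed: "modes_well_posed \<beta> M Dt L"
begin

abbreviation "N \<equiv> vmeas M"
abbreviation "e \<equiv> e0 \<beta> :: real^'n \<Rightarrow> complex"
abbreviation "T \<equiv> Lt \<beta> L"

lemma measurable_N [simp]: "borel_measurable N = borel_measurable borel"
  unfolding vmeas_def by (simp add: measurable_def)

lemma AE_N: "(AE v in N. P v) \<longleftrightarrow> (AE v in lborel. P v)"
  unfolding vmeas_def using M_pos by (subst AE_density) auto

lemma integrable_N:
  fixes f :: "real^'n \<Rightarrow> 'b::{banach, second_countable_topology}"
  shows "f \<in> borel_measurable borel \<Longrightarrow> integrable N f \<longleftrightarrow> integrable lborel (\<lambda>v. M v *\<^sub>R f v)"
  unfolding vmeas_def by (rule integrable_density) (auto intro: less_imp_le M_pos)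

lemma integral_N:
  fixes f :: "real^'n \<Rightarrow> 'b::{banach, second_countable_topology}"
  shows "f \<in> borel_measurable borel \<Longrightarrow> (LINT v|N. f v) = (LINT v|lborel. M v *\<^sub>R f v)"
  unfolding vmeas_def by (rule integral_density) (auto intro: less_imp_le M_pos)

text \<open>The Bochner integral of a non-integrable function is 0, so the normalisation to 1
  already carries integrability.\<close>

lemma wgt_integrable: "integrable lborel (wgt \<beta> M)"
  using M_int not_integrable_integral_eq[of lborel "wgt \<beta> M"] by auto

lemma e_measurable [measurable]: "e \<in> borel_measurable borel"
  unfolding e0_def by measurable

lemma e_nz: "e v \<noteq> 0"
  using jb_pos[of v] by (simp add: e0_def)

lemma cmod_e_sq: "(cmod (e0 \<beta> v))\<^sup>2 = jb v powr - \<beta>"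
  using jb_pos[of v] by (simp add: e0_def powr_powr flip: powr_numeral)

lemma nrm_e: "nrm N e = 1"
  using M_int unfolding nrm_def cmod_e_sq by (subst integral_N) (auto simp: wgt_def mult.commute)

lemma e_L2: "e \<in> L2 N"
  using wgt_integrable unfolding L2_def mem_Collect_eq cmod_e_sq
  by (subst integrable_N) (auto simp: wgt_def[abs_def] mult.commute)

lemma T_operator: "L2_operator N Dt T" and T_real: "real_operator N Dt T"
  and T_rot: "commutes_with_rotations N Dt T"
  and e_Dt: "e \<in> Dt" and T_e: "AE v in N. T e v = 0"
  and T_adj_e: "is_adjoint N Dt T e (\<lambda>_. 0)"
  and T_coercive: "g \<in> Dt \<Longrightarrow> ip N g e = 0 \<Longrightarrow> lam * (nrm N g)\<^sup>2 \<le> - Re (ip N (T g) g)"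
  using coercivity unfolding weighted_coercivity_def Let_def by blast+

lemma Dt_L2: "g \<in> Dt \<Longrightarrow> g \<in> L2 N"
  using T_operator unfolding L2_operator_def by blast

lemma T_L2: "g \<in> Dt \<Longrightarrow> T g \<in> L2 N"
  using T_operator unfolding L2_operator_def by blast

lemma Dt_lin: "f \<in> Dt \<Longrightarrow> g \<in> Dt \<Longrightarrow> (\<lambda>v. a * f v + b * g v) \<in> Dt"
  using T_operator unfolding L2_operator_def by blast

lemma T_lin:
  "f \<in> Dt \<Longrightarrow> g \<in> Dt \<Longrightarrow> AE v in N. T (\<lambda>u. a * f u + b * g u) v = a * T f v + b * T g v"
  using T_operator unfolding L2_operator_def by blast

lemma ip_T_e: "g \<in> Dt \<Longrightarrow> ip N (T g) e = 0"
  using T_adj_e unfolding is_adjoint_def by simp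

text \<open>Coercivity is assumed orthogonally to \<open>e\<close>. Because \<open>T\<close>
  annihilates \<open>e\<close> and the range of \<open>T\<close> is orthogonal to \<open>e\<close>,
  the component along \<open>e\<close> can be removed from both slots of the form without changing
  it.\<close>

lemma T_gap:
  assumes g: "g \<in> Dt"
  shows "Re (ip N (T g) g) \<le> - lam * (nrm N (\<lambda>v. g v - ip N g e * e v))\<^sup>2"
proof -
  define c where "c = ip N g e"
  define w where "w = (\<lambda>v. 1 * g v + (- c) * e v)"
  have w: "w \<in> Dt" unfolding w_def by (rule Dt_lin[OF g e_Dt])
  have w_eq: "w = (\<lambda>v. g v - c * e v)" by (auto simp: w_def)
  have "ip N w e = c - c * ip N e e"
    unfolding w_eq using Dt_L2[OF g] e_L2 by (simp add: ip_simps L2_intros c_def)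
  then have "ip N w e = 0" by (simp add: ip_self nrm_e)
  then have "lam * (nrm N w)\<^sup>2 \<le> - Re (ip N (T w) w)" by (rule T_coercive[OF w])
  also have "ip N (T w) w = ip N (T g) w"
  proof (rule ip_cong_AE)
    show "AE v in N. T w v = T g v"
      using T_lin[OF g e_Dt, of 1 "- c"] T_e unfolding w_def by eventually_elim simp
  qed (use T_L2 Dt_L2 g w in auto)
  also have "\<dots> = ip N (T g) g"
    unfolding w_eq using T_L2[OF g] Dt_L2[OF g] e_L2 by (simp add: ip_simps L2_intros ip_T_e[OF g])
  finally show ?thesis unfolding w_eq c_def by simp
qed

lemma dom_advD:
  assumes "g \<in> dom_adv \<beta> M Dt \<sigma>"
  shows "g \<in> Dt" "(\<lambda>v. of_real (vel \<beta> \<sigma> v) * g v) \<in> L2 N"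
  using assms by (auto simp: dom_adv_def)

lemma L_adv_eq: "L_adv \<beta> L \<eta> \<sigma> g = (\<lambda>v. T g v - (\<i> * of_real \<eta>) * (of_real (vel \<beta> \<sigma> v) * g v))"
  by (auto simp: L_adv_def mult.assoc)

lemma nrm_L_adv_le:
  assumes "g \<in> dom_adv \<beta> M Dt \<sigma>" "\<eta> \<ge> 0"
  shows "nrm N (L_adv \<beta> L \<eta> \<sigma> g) \<le> nrm N (T g) + \<eta> * nrm N (\<lambda>v. of_real (vel \<beta> \<sigma> v) * g v)"
proof -
  have "nrm N (L_adv \<beta> L \<eta> \<sigma> g) \<le> nrm N (T g) + nrm N (\<lambda>v. (\<i> * of_real \<eta>) * (of_real (vel \<beta> \<sigma> v) * g v))"
    unfolding L_adv_eq using dom_advD[OF assms(1)] by (intro nrm_triangle_diff L2_intros T_L2)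
  then show ?thesis using assms(2) unfolding nrm_scale by (simp add: norm_mult)
qed

lemma ip_L_adv_e:
  assumes "g \<in> dom_adv \<beta> M Dt \<sigma>"
  shows "ip N (L_adv \<beta> L \<eta> \<sigma> g) e = - (\<i> * of_real \<eta>) * ip N (\<lambda>v. of_real (vel \<beta> \<sigma> v) * g v) e"
  unfolding L_adv_eq using dom_advD[OF assms] T_L2 e_L2
  by (simp add: ip_diff_left L2_scale ip_scale_left ip_T_e)

text \<open>Advection is multiplication by an imaginary function and drops out of the real part of
  the quadratic form, so the gap of \<open>T\<close> survives for every \<open>\<eta>\<close> with
  the same constant. Well-posedness of the modes supplies dissipativity of the adjoint.\<close>

lemma gap_operator:
  assumes "\<eta> > 0" "norm \<sigma> = 1"
  shows "gap_operator N e (dom_adv \<beta> M Dt \<sigma>) (L_adv \<beta> L \<eta> \<sigma>) lam"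
proof
  note mw = well_posed[unfolded modes_well_posed_def, rule_format, OF assms]
  have dense: "densely_defined N (dom_adv \<beta> M Dt \<sigma>)" using mw by blast
  show "Re (ip N \<zeta> \<psi>) \<le> 0" if "is_adjoint N (dom_adv \<beta> M Dt \<sigma>) (L_adv \<beta> L \<eta> \<sigma>) \<psi> \<zeta>" for \<psi> \<zeta>
    using mw that by blast
  show "subspace_L2 N (dom_adv \<beta> M Dt \<sigma>)"
    unfolding subspace_L2_def
  proof (intro conjI ballI allI)
    show "dom_adv \<beta> M Dt \<sigma> \<subseteq> L2 N" using Dt_L2 by (auto simp: dom_adv_def)
    \<comment> \<open>Approximating the zero function by density produces an element.\<close>
    show "dom_adv \<beta> M Dt \<sigma> \<noteq> {}"
      using dense[unfolded densely_defined_def, rule_format, OF L2_zero zero_less_one] by blast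
    fix f g a b assume f: "f \<in> dom_adv \<beta> M Dt \<sigma>" and g: "g \<in> dom_adv \<beta> M Dt \<sigma>"
    have "(\<lambda>v. a * (of_real (vel \<beta> \<sigma> v) * f v) + b * (of_real (vel \<beta> \<sigma> v) * g v)) \<in> L2 N"
      by (intro L2_intros dom_advD[OF f] dom_advD[OF g])
    then have "(\<lambda>v. of_real (vel \<beta> \<sigma> v) * (a * f v + b * g v)) \<in> L2 N" by (simp add: algebra_simps)
    then show "(\<lambda>v. a * f v + b * g v) \<in> dom_adv \<beta> M Dt \<sigma>"
      using Dt_lin[OF dom_advD(1)[OF f] dom_advD(1)[OF g]] by (simp add: dom_adv_def)
  qed
  fix g assume g: "g \<in> dom_adv \<beta> M Dt \<sigma>"
  show "L_adv \<beta> L \<eta> \<sigma> g \<in> L2 N"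
    unfolding L_adv_eq by (intro L2_intros T_L2 dom_advD[OF g])
  have "ip N (L_adv \<beta> L \<eta> \<sigma> g) g = ip N (T g) g - (\<i> * of_real \<eta>) * ip N (\<lambda>v. of_real (vel \<beta> \<sigma> v) * g v) g"
    unfolding L_adv_eq using dom_advD[OF g] T_L2 Dt_L2 by (simp add: ip_diff_left L2_scale ip_scale_left)
  then have "Re (ip N (L_adv \<beta> L \<eta> \<sigma> g) g) = Re (ip N (T g) g)"
    using Im_ip_real_mult_self[of N "vel \<beta> \<sigma>" g] by simp
  then show "Re (ip N (L_adv \<beta> L \<eta> \<sigma> g) g) \<le> - lam * (nrm N (\<lambda>v. g v - ip N g e * e v))\<^sup>2"
    using T_gap[OF dom_advD(1)[OF g]] by simp
next
  fix f g a b assume fg: "f \<in> dom_adv \<beta> M Dt \<sigma>" "g \<in> dom_adv \<beta> M Dt \<sigma>"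
  show "AE v in N. L_adv \<beta> L \<eta> \<sigma> (\<lambda>u. a * f u + b * g u) v = a * L_adv \<beta> L \<eta> \<sigma> f v + b * L_adv \<beta> L \<eta> \<sigma> g v"
    using T_lin[OF dom_advD(1)[OF fg(1)] dom_advD(1)[OF fg(2)], of a b]
    by eventually_elim (simp add: L_adv_def algebra_simps)
qed (use e_L2 e_nz nrm_e lam_pos in auto)

text \<open>The squared modulus of \<open>e\<close> is the weight that turns \<open>M\<close> into
  \<open>wgt \<beta> M\<close>. Multiplication by \<open>e\<close> is therefore an isometry between
  the two spaces, and it carries the normalising integral to the pairing with
  \<open>e\<close>.\<close>

lemma fluid_mode_iff:
  "fluid_mode \<beta> M Dt L \<eta> \<sigma> \<phi> \<mu> \<longleftrightarrow> \<phi> \<in> borel_measurable borel \<and>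
    is_adjoint N (dom_adv \<beta> M Dt \<sigma>) (L_adv \<beta> L \<eta> \<sigma>) (\<lambda>v. e v * \<phi> v) (\<lambda>v. - \<mu> * (e v * \<phi> v)) \<and>
    ip N (\<lambda>v. e v * \<phi> v) e = 1"
proof -
  have wm: "wgt \<beta> M \<in> borel_measurable borel" unfolding wgt_def by measurable
  have wp: "0 \<le> wgt \<beta> M v" for v using M_pos[of v] by (simp add: wgt_def)
  have meas: "borel_measurable (vmeas (wgt \<beta> M)) = borel_measurable borel"
    unfolding vmeas_def by (simp add: measurable_def)
  have 1: "(LINT v|vmeas (wgt \<beta> M). \<phi> v) = ip N (\<lambda>v. e v * \<phi> v) e" if [measurable]: "\<phi> \<in> borel_measurable borel"
  proof -
    have "(LINT v|vmeas (wgt \<beta> M). \<phi> v) = (LINT v|lborel. wgt \<beta> M v *\<^sub>R \<phi> v)"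
      unfolding vmeas_def using wm wp by (intro integral_density) auto
    also have "\<dots> = (LINT v|lborel. M v *\<^sub>R (e v * \<phi> v * cnj (e v)))"
    proof (rule Bochner_Integration.integral_cong[OF refl])
      fix v
      have "e v * cnj (e v) = of_real (jb v powr - \<beta>)"
        by (metis cmod_e_sq complex_norm_square)
      then have "e v * \<phi> v * cnj (e v) = of_real (jb v powr - \<beta>) * \<phi> v"
        by (metis mult.assoc mult.commute)
      then show "wgt \<beta> M v *\<^sub>R \<phi> v = M v *\<^sub>R (e v * \<phi> v * cnj (e v))"
        by (simp only: wgt_def scaleR_conv_of_real of_real_mult mult_ac)
    qed
    also have "\<dots> = ip N (\<lambda>v. e v * \<phi> v) e" unfolding ip_def by (rule integral_N[symmetric]) measurable
    finally show ?thesis .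
  qed
  have 2: "\<phi> \<in> L2 (vmeas (wgt \<beta> M)) \<longleftrightarrow> (\<lambda>v. e v * \<phi> v) \<in> L2 N" if [measurable]: "\<phi> \<in> borel_measurable borel"
  proof -
    have "integrable (vmeas (wgt \<beta> M)) (\<lambda>v. (cmod (\<phi> v))\<^sup>2) \<longleftrightarrow> integrable lborel (\<lambda>v. wgt \<beta> M v *\<^sub>R (cmod (\<phi> v))\<^sup>2)"
      unfolding vmeas_def using wm wp by (intro integrable_density) auto
    moreover have "integrable N (\<lambda>v. (cmod (e v * \<phi> v))\<^sup>2) \<longleftrightarrow> integrable lborel (\<lambda>v. wgt \<beta> M v *\<^sub>R (cmod (\<phi> v))\<^sup>2)"
      by (subst integrable_N) (auto simp: norm_mult power_mult_distrib cmod_e_sq wgt_def mult_ac)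
    ultimately show ?thesis by (simp add: L2_def meas)
  qed
  show ?thesis
  proof (cases "\<phi> \<in> borel_measurable borel")
    case True
    have "(\<lambda>v. e v * \<phi> v) \<in> L2 N"
      if "is_adjoint N (dom_adv \<beta> M Dt \<sigma>) (L_adv \<beta> L \<eta> \<sigma>) (\<lambda>v. e v * \<phi> v) (\<lambda>v. - \<mu> * (e v * \<phi> v))"
      using that unfolding is_adjoint_def by blast
    then show ?thesis unfolding fluid_mode_def 1[OF True] 2[OF True] using True by blast
  next
    case False
    then show ?thesis unfolding fluid_mode_def L2_def meas by blast
  qed
qed

lemma fluid_mode_of_eigenvector:
  assumes "is_adjoint N (dom_adv \<beta> M Dt \<sigma>) (L_adv \<beta> L \<eta> \<sigma>) \<psi> (\<lambda>v. - \<mu> * \<psi> v)" "ip N \<psi> e = 1"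
  shows "fluid_mode \<beta> M Dt L \<eta> \<sigma> (\<lambda>v. \<psi> v / e v) \<mu>"
proof -
  have [measurable]: "\<psi> \<in> borel_measurable borel" using assms by (simp add: is_adjoint_def L2_def)
  show ?thesis using assms by (simp add: fluid_mode_iff e_nz)
qed

lemma wnorm_minus_one:
  assumes [measurable]: "\<phi> \<in> borel_measurable borel"
  shows "wnorm M (-\<beta>) (\<lambda>v. \<phi> v - 1) = nrm N (\<lambda>v. e v * \<phi> v - e v)"
proof -
  have "(cmod (e v * \<phi> v - e v))\<^sup>2 = (cmod (\<phi> v - 1))\<^sup>2 * jb v powr - \<beta>" for v
  proof -
    have "e v * \<phi> v - e v = e v * (\<phi> v - 1)" by (simp add: algebra_simps)
    then show ?thesis by (simp add: norm_mult power_mult_distrib cmod_e_sq)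
  qed
  then show ?thesis unfolding wnorm_def nrm_def by simp
qed

section \<open>Symmetries of the eigenvalue problem: conjugation and rotation\<close>

lemma T_cnj:
  assumes h: "h \<in> Dt"
  shows "AE v in N. T (\<lambda>u. cnj (h u)) v = cnj (T h v)"
proof -
  have c: "(\<lambda>v. cnj (h v)) \<in> Dt" using T_real h unfolding real_operator_def by blast
  \<comment> \<open>\<open>real_operator\<close> speaks of real functions only; the real and
    imaginary parts of \<open>h\<close> are in \<open>Dt\<close> because it is stable under
    conjugation.\<close>
  define a where "a = (\<lambda>v. (1/2) * h v + (1/2) * cnj (h v))"
  define b where "b = (\<lambda>v. (- \<i> / 2) * h v + (\<i> / 2) * cnj (h v))"
  have ab: "a \<in> Dt" "b \<in> Dt" unfolding a_def b_def by (intro Dt_lin h c)+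
  have "a v = of_real (Re (h v))" "b v = of_real (Im (h v))" for v
    by (auto simp: a_def b_def complex_eq_iff)
  then have "AE v in N. a v \<in> \<real>" "AE v in N. b v \<in> \<real>" by auto
  then have real: "AE v in N. T a v \<in> \<real>" "AE v in N. T b v \<in> \<real>"
    using T_real ab unfolding real_operator_def by blast+
  have "h = (\<lambda>v. 1 * a v + \<i> * b v)" "(\<lambda>v. cnj (h v)) = (\<lambda>v. 1 * a v + (- \<i>) * b v)"
    by (auto simp: a_def b_def algebra_simps)
  then have "AE v in N. T h v = 1 * T a v + \<i> * T b v"
    "AE v in N. T (\<lambda>u. cnj (h u)) v = 1 * T a v + (- \<i>) * T b v"
    using T_lin[OF ab, of 1 \<i>] T_lin[OF ab, of 1 "- \<i>"] by simp_all
  then show ?thesis using real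
    by eventually_elim (simp add: Reals_cnj_iff)
qed

lemma ip_cnj_cnj: "ip N (\<lambda>v. cnj (f v)) (\<lambda>v. cnj (g v)) = cnj (ip N f g)"
  unfolding ip_def by (subst Bochner_Integration.integral_cnj[symmetric]) simp

lemma cnj_e [simp]: "cnj (e0 \<beta> v) = e0 \<beta> v"
  by (simp add: e0_def)

text \<open>Conjugation commutes with \<open>T\<close> but changes the sign of the imaginary
  advection term; as \<open>vel\<close> is odd in \<open>\<sigma>\<close>, reversing the direction
  restores it.\<close>

lemma fluid_mode_cnj:
  assumes "fluid_mode \<beta> M Dt L \<eta> \<sigma> \<phi> \<mu>"
  shows "fluid_mode \<beta> M Dt L \<eta> (- \<sigma>) (\<lambda>v. cnj (\<phi> v)) (cnj \<mu>)"
proof -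
  define \<psi> where "\<psi> = (\<lambda>v. e v * \<phi> v)"
  have phi[measurable]: "\<phi> \<in> borel_measurable borel"
    and adj: "is_adjoint N (dom_adv \<beta> M Dt \<sigma>) (L_adv \<beta> L \<eta> \<sigma>) \<psi> (\<lambda>v. - \<mu> * \<psi> v)" and one: "ip N \<psi> e = 1"
    using assms unfolding fluid_mode_iff \<psi>_def by auto
  have psi: "\<psi> \<in> L2 N" using adj by (simp add: is_adjoint_def)
  have c_psi: "e v * cnj (\<phi> v) = cnj (\<psi> v)" for v by (simp add: \<psi>_def)
  have "is_adjoint N (dom_adv \<beta> M Dt (- \<sigma>)) (L_adv \<beta> L \<eta> (- \<sigma>)) (\<lambda>v. cnj (\<psi> v)) (\<lambda>v. - cnj \<mu> * cnj (\<psi> v))"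
    unfolding is_adjoint_def
  proof (intro conjI ballI L2_cnj L2_scale psi)
    fix h assume h: "h \<in> dom_adv \<beta> M Dt (- \<sigma>)"
    have "(\<lambda>v. cnj (h v)) \<in> Dt" using T_real dom_advD(1)[OF h] unfolding real_operator_def by blast
    moreover have "(\<lambda>v. - cnj (of_real (vel \<beta> (- \<sigma>) v) * h v)) \<in> L2 N"
      by (intro L2_uminus L2_cnj dom_advD[OF h])
    then have "(\<lambda>v. of_real (vel \<beta> \<sigma> v) * cnj (h v)) \<in> L2 N" by (simp add: vel_def)
    ultimately have ch: "(\<lambda>v. cnj (h v)) \<in> dom_adv \<beta> M Dt \<sigma>" by (simp add: dom_adv_def)
    have L2s: "L_adv \<beta> L \<eta> (- \<sigma>) h \<in> L2 N" "L_adv \<beta> L \<eta> \<sigma> (\<lambda>v. cnj (h v)) \<in> L2 N"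
      unfolding L_adv_eq by (intro L2_intros T_L2 dom_advD[OF h] dom_advD[OF ch])+
    have "AE v in N. cnj (L_adv \<beta> L \<eta> (- \<sigma>) h v) = L_adv \<beta> L \<eta> \<sigma> (\<lambda>v. cnj (h v)) v"
      using T_cnj[OF dom_advD(1)[OF h]] by eventually_elim (simp add: L_adv_def vel_def)
    then have "ip N (\<lambda>v. cnj (L_adv \<beta> L \<eta> (- \<sigma>) h v)) \<psi> = ip N (L_adv \<beta> L \<eta> \<sigma> (\<lambda>v. cnj (h v))) \<psi>"
      by (intro ip_cong_AE L2_cnj L2s psi) auto
    also have "\<dots> = ip N (\<lambda>v. cnj (h v)) (\<lambda>v. - \<mu> * \<psi> v)" using adj ch by (simp add: is_adjoint_def)
    finally have "cnj (ip N (\<lambda>v. cnj (L_adv \<beta> L \<eta> (- \<sigma>) h v)) \<psi>) = cnj (ip N (\<lambda>v. cnj (h v)) (\<lambda>v. - \<mu> * \<psi> v))"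
      by simp
    then show "ip N (L_adv \<beta> L \<eta> (- \<sigma>) h) (\<lambda>v. cnj (\<psi> v)) = ip N h (\<lambda>v. - cnj \<mu> * cnj (\<psi> v))"
      unfolding ip_cnj_cnj[symmetric] by simp
  qed
  moreover have "ip N (\<lambda>v. cnj (\<psi> v)) e = 1"
    using one ip_cnj_cnj[of \<psi> e] by simp
  ultimately show ?thesis by (simp add: fluid_mode_iff c_psi)
qed

text \<open>Lebesgue measure is invariant and \<open>M\<close> is radial, so \<open>M dv\<close> is
  invariant as well.\<close>

lemma L2_rotate:
  assumes Q: "orthogonal_transformation Q"
  shows "f \<in> L2 N \<Longrightarrow> f \<circ> Q \<in> L2 N"
    and "f \<in> L2 N \<Longrightarrow> g \<in> L2 N \<Longrightarrow> ip N (f \<circ> Q) (g \<circ> Q) = ip N f g"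
    and "(AE v in N. P v) \<Longrightarrow> (AE v in N. P (Q v))"
proof -
  have Qm[measurable]: "Q \<in> borel_measurable borel"
    using orthogonal_transformation_linear[OF Q]
    by (intro borel_measurable_continuous_onI linear_continuous_on linear_conv_bounded_linear[THEN iffD1])
  have MQ: "M (Q v) = M v" for v
    by (rule M_radial) (rule orthogonal_transformation_norm[OF Q])
  show "f \<circ> Q \<in> L2 N" if f: "f \<in> L2 N"
  proof -
    have [measurable]: "f \<in> borel_measurable borel" using f by (simp add: L2_def)
    have "integrable lborel (\<lambda>v. M v *\<^sub>R (cmod (f v))\<^sup>2)"
      using f unfolding L2_def by (subst integrable_N[symmetric]) auto
    then have "integrable (distr lborel borel Q) (\<lambda>v. M v *\<^sub>R (cmod (f v))\<^sup>2)"
      by (simp add: lborel_distr_orthogonal[OF Q])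
    then have "integrable lborel (\<lambda>v. M (Q v) *\<^sub>R (cmod (f (Q v)))\<^sup>2)"
      by (subst (asm) integrable_distr_eq) auto
    then show ?thesis unfolding L2_def by (simp add: integrable_N MQ)
  qed
  show "ip N (f \<circ> Q) (g \<circ> Q) = ip N f g" if "f \<in> L2 N" "g \<in> L2 N"
  proof -
    have [measurable]: "f \<in> borel_measurable borel" "g \<in> borel_measurable borel" using that by (simp_all add: L2_def)
    have "ip N f g = (LINT v|distr lborel borel Q. M v *\<^sub>R (f v * cnj (g v)))"
      unfolding ip_def lborel_distr_orthogonal[OF Q] by (rule integral_N) measurable
    also have "\<dots> = (LINT v|lborel. M (Q v) *\<^sub>R (f (Q v) * cnj (g (Q v))))"
      by (rule integral_distr) measurable
    also have "\<dots> = ip N (f \<circ> Q) (g \<circ> Q)"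
      unfolding ip_def MQ o_def by (rule integral_N[symmetric]) measurable
    finally show ?thesis by simp
  qed
  show "AE v in N. P (Q v)" if "AE v in N. P v"
  proof -
    have "AE v in distr lborel borel Q. P v" using that unfolding AE_N lborel_distr_orthogonal[OF Q] .
    then have "AE v in lborel. P (Q v)" by (rule AE_distrD[rotated]) simp
    then show ?thesis by (simp add: AE_N)
  qed
qed

text \<open>Test functions are carried from the domain for \<open>\<sigma>'\<close> to that for
  \<open>\<sigma>\<close> by the inverse rotation \<open>P\<close>, under which the velocity in
  direction \<open>\<sigma>'\<close> becomes that in direction \<open>\<sigma>\<close>; the pairings
  do not change.\<close>

lemma fluid_mode_rotate:
  assumes "fluid_mode \<beta> M Dt L \<eta> \<sigma> \<phi> \<mu>" "rotation Q" "Q \<sigma>' = \<sigma>"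
  shows "fluid_mode \<beta> M Dt L \<eta> \<sigma>' (\<phi> \<circ> Q) \<mu>"
proof -
  have Q: "orthogonal_transformation Q" using assms by (simp add: rotation_def)
  have Qm[measurable]: "Q \<in> borel_measurable borel"
    using orthogonal_transformation_linear[OF Q]
    by (intro borel_measurable_continuous_onI linear_continuous_on linear_conv_bounded_linear[THEN iffD1])
  define P where "P = inv Q"
  have P: "orthogonal_transformation P" unfolding P_def by (rule orthogonal_transformation_inv[OF Q])
  have QP: "Q (P v) = v" and PQ: "P (Q v) = v" for v
    unfolding P_def using orthogonal_transformation_surj[OF Q] orthogonal_transformation_inj[OF Q]
    by (simp_all add: surj_f_inv_f inv_f_f)
  \<comment> \<open>Commutation is assumed for rotations only, so the inverse must be shown to be
    one; its determinant follows from multiplicativity.\<close>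
  have rotP: "rotation P"
  proof -
    have "matrix Q ** matrix P = mat 1"
      using matrix_compose[OF orthogonal_transformation_linear[OF P] orthogonal_transformation_linear[OF Q]] QP
      by (simp add: o_def matrix_id_mat_1[unfolded id_def])
    then have "det (matrix Q) * det (matrix P) = 1" by (metis det_mul det_I)
    then show ?thesis using assms(2) P unfolding rotation_def by auto
  qed
  define \<psi> where "\<psi> = (\<lambda>v. e v * \<phi> v)"
  have phi[measurable]: "\<phi> \<in> borel_measurable borel"
    and adj: "is_adjoint N (dom_adv \<beta> M Dt \<sigma>) (L_adv \<beta> L \<eta> \<sigma>) \<psi> (\<lambda>v. - \<mu> * \<psi> v)" and one: "ip N \<psi> e = 1"
    using assms(1) unfolding fluid_mode_iff \<psi>_def by auto
  have psi: "\<psi> \<in> L2 N" using adj by (simp add: is_adjoint_def)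
  have jbQ: "jb (Q v) = jb v" "jb (P v) = jb v" for v
    by (simp_all add: jb_def orthogonal_transformation_norm[OF Q] orthogonal_transformation_norm[OF P])
  have eQ: "e (Q v) = e v" for v by (simp add: e0_def jbQ)
  have velP: "vel \<beta> \<sigma>' (P v) = vel \<beta> \<sigma> v" for v
  proof -
    have "P v \<bullet> \<sigma>' = Q (P v) \<bullet> Q \<sigma>'" using Q by (simp add: orthogonal_transformation_def)
    then show ?thesis by (simp add: vel_def jbQ QP assms(3))
  qed
  have psi_Q: "e v * \<phi> (Q v) = \<psi> (Q v)" for v by (simp add: \<psi>_def eQ)
  have "is_adjoint N (dom_adv \<beta> M Dt \<sigma>') (L_adv \<beta> L \<eta> \<sigma>') (\<psi> \<circ> Q) (\<lambda>v. - \<mu> * (\<psi> \<circ> Q) v)"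
    unfolding is_adjoint_def
  proof (intro conjI ballI L2_scale L2_rotate(1)[OF Q] psi)
    fix h assume h: "h \<in> dom_adv \<beta> M Dt \<sigma>'"
    have hP: "h \<circ> P \<in> Dt" "AE v in N. T (h \<circ> P) v = T h (P v)"
      using T_rot rotP dom_advD(1)[OF h] unfolding commutes_with_rotations_def by blast+
    have "(\<lambda>v. of_real (vel \<beta> \<sigma>' v) * h v) \<circ> P \<in> L2 N" by (intro L2_rotate(1)[OF P] dom_advD[OF h])
    then have "(\<lambda>v. of_real (vel \<beta> \<sigma> v) * (h \<circ> P) v) \<in> L2 N" by (simp add: o_def velP)
    with hP have dP: "h \<circ> P \<in> dom_adv \<beta> M Dt \<sigma>" by (simp add: dom_adv_def)
    have L2s: "L_adv \<beta> L \<eta> \<sigma>' h \<in> L2 N" "L_adv \<beta> L \<eta> \<sigma> (h \<circ> P) \<in> L2 N"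
      unfolding L_adv_eq by (intro L2_intros T_L2 dom_advD[OF h] dom_advD[OF dP])+
    have "ip N (L_adv \<beta> L \<eta> \<sigma>' h) (\<psi> \<circ> Q) = ip N (L_adv \<beta> L \<eta> \<sigma>' h \<circ> P) ((\<psi> \<circ> Q) \<circ> P)"
      by (rule L2_rotate(2)[OF P, symmetric]) (intro L2s L2_rotate(1)[OF Q] psi)+
    also have "(\<psi> \<circ> Q) \<circ> P = \<psi>" by (auto simp: QP)
    also have "ip N (L_adv \<beta> L \<eta> \<sigma>' h \<circ> P) \<psi> = ip N (L_adv \<beta> L \<eta> \<sigma> (h \<circ> P)) \<psi>"
    proof (rule ip_cong_AE)
      show "AE v in N. (L_adv \<beta> L \<eta> \<sigma>' h \<circ> P) v = L_adv \<beta> L \<eta> \<sigma> (h \<circ> P) v"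
        using hP(2) by eventually_elim (simp add: L_adv_def velP)
    qed (use L2s psi L2_rotate(1)[OF P] in auto)
    also have "\<dots> = ip N (h \<circ> P) (\<lambda>v. - \<mu> * \<psi> v)" using adj dP by (simp add: is_adjoint_def)
    also have "\<dots> = ip N ((h \<circ> P) \<circ> Q) ((\<lambda>v. - \<mu> * \<psi> v) \<circ> Q)"
      by (rule L2_rotate(2)[OF Q, symmetric]) (intro L2_scale psi Dt_L2 hP)+
    also have "(h \<circ> P) \<circ> Q = h" by (auto simp: PQ)
    also have "(\<lambda>v. - \<mu> * \<psi> v) \<circ> Q = (\<lambda>v. - \<mu> * (\<psi> \<circ> Q) v)" by auto
    finally show "ip N (L_adv \<beta> L \<eta> \<sigma>' h) (\<psi> \<circ> Q) = ip N h (\<lambda>v. - \<mu> * (\<psi> \<circ> Q) v)" .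
  qed
  moreover have "ip N (\<psi> \<circ> Q) e = 1"
  proof -
    have "e \<circ> Q = e" by (auto simp: eQ)
    then show ?thesis using one L2_rotate(2)[OF Q psi e_L2] by simp
  qed
  moreover have "\<phi> \<circ> Q \<in> borel_measurable borel" by measurable
  ultimately show ?thesis by (simp add: fluid_mode_iff psi_Q o_def)
qed

end

lemma integral_tail:
  fixes f :: "real^'n \<Rightarrow> real"
  assumes f: "integrable lborel f" and "\<delta> > 0"
  shows "\<exists>R0\<ge>1. \<forall>R\<ge>R0. (LINT v|lborel. f v * indicator (- ball 0 R) v) \<le> \<delta>"
proof -
  have [measurable]: "f \<in> borel_measurable borel" using f by (simp add: borel_measurable_integrable)
  have "((\<lambda>R. LINT v|lborel. f v * indicator (- ball 0 R) v) \<longlongrightarrow> (LINT v|(lborel :: (real^'n) measure). 0)) at_top"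
  proof (rule integral_dominated_convergence_at_top[where w = "\<lambda>v. \<bar>f v\<bar>"])
    show "AE v in lborel. ((\<lambda>R. f v * indicator (- ball 0 R) v) \<longlongrightarrow> 0) at_top"
    proof (rule AE_I2)
      fix v :: "real^'n"
      have "\<forall>\<^sub>F R in at_top. f v * indicator (- ball 0 R) v = 0"
        using eventually_gt_at_top[of "norm v"] by eventually_elim simp
      then show "((\<lambda>R. f v * indicator (- ball 0 R) v) \<longlongrightarrow> 0) at_top" by (rule tendsto_eventually)
    qed
  qed (use f in \<open>auto simp: indicator_def\<close>)
  then have "\<forall>\<^sub>F R in at_top. (LINT v|lborel. f v * indicator (- ball 0 R) v) < \<delta>"
    using \<open>\<delta> > 0\<close> by (simp add: order_tendstoD(2))
  then obtain R1 where "\<And>R. R \<ge> R1 \<Longrightarrow> (LINT v|lborel. f v * indicator (- ball 0 R) v) < \<delta>"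
    unfolding eventually_at_top_linorder by blast
  then show ?thesis by (intro exI[of _ "max 1 R1"]) (auto intro: less_imp_le)
qed

lemma cutoff_measurable:
  assumes "cutoff \<kappa>"
  shows "\<kappa> \<in> borel_measurable borel"
proof -
  have "Ck 0 \<kappa>" using assms unfolding cutoff_def smooth_def by blast
  then show ?thesis by (intro borel_measurable_continuous_onI) simp
qed

lemma cutoff_scaled:
  assumes "cutoff \<kappa>" "R > 0"
  shows "0 \<le> \<kappa> (v /\<^sub>R R)" "\<kappa> (v /\<^sub>R R) \<le> 1" "norm v < R \<Longrightarrow> \<kappa> (v /\<^sub>R R) = 1"
    "2 * R \<le> norm v \<Longrightarrow> \<kappa> (v /\<^sub>R R) = 0"
proof -
  have n: "norm (v /\<^sub>R R) = norm v / R" using assms(2) by (simp add: divide_inverse mult.commute)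
  show "0 \<le> \<kappa> (v /\<^sub>R R)" "\<kappa> (v /\<^sub>R R) \<le> 1" using assms(1) unfolding cutoff_def by blast+
  show "\<kappa> (v /\<^sub>R R) = 1" if "norm v < R"
  proof -
    have "v /\<^sub>R R \<in> ball 0 1" unfolding mem_ball_0 n using that assms(2) by simp
    then show ?thesis using assms(1) unfolding cutoff_def by blast
  qed
  show "\<kappa> (v /\<^sub>R R) = 0" if "2 * R \<le> norm v"
  proof -
    have "v /\<^sub>R R \<notin> ball 0 2" unfolding mem_ball_0 n using that assms(2) by (simp add: field_simps)
    then show ?thesis using assms(1) unfolding cutoff_def by blast
  qed
qed

section \<open>Cutoff test functions and bounds on fluid modes\<close>

context collision
begin

lemma T_e_mult: "T (\<lambda>v. e v * h v) = (\<lambda>v. of_real (jb v powr (\<beta>/2)) * L h v)"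
proof -
  have *: "of_real (jb v powr (\<beta>/2)) * (e0 \<beta> v * h v) = h v" for v
  proof -
    have "complex_of_real (jb v powr (\<beta>/2)) * e0 \<beta> v = of_real (jb v powr (\<beta>/2) * jb v powr (- \<beta>/2))"
      by (simp add: e0_def)
    also have "\<dots> = 1" using jb_pos[of v] by (simp flip: powr_add)
    finally show ?thesis by (simp flip: mult.assoc)
  qed
  show ?thesis by (simp only: Lt_def *)
qed

text \<open>The inner weight of \<open>Lt\<close> cancels against \<open>e\<close> and the outer one
  produces the weight \<open>\<beta>\<close>. This converts the large-velocity estimates on
  \<open>L\<close> into norms of \<open>T\<close> on the test functions.\<close>

lemma nrm_T_e_mult: "nrm N (T (\<lambda>v. e v * h v)) = wnorm M \<beta> (L h)"
proof -
  have "(cmod (of_real (jb v powr (\<beta>/2)) * L h v))\<^sup>2 = (cmod (L h v))\<^sup>2 * jb v powr \<beta>" for v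
  proof -
    have "(jb v powr (\<beta>/2))\<^sup>2 = jb v powr \<beta>" using jb_pos[of v] by (simp add: powr_powr flip: powr_numeral)
    then show ?thesis by (simp add: norm_mult power_mult_distrib)
  qed
  then show ?thesis unfolding T_e_mult nrm_def wnorm_def by simp
qed

text \<open>Since the moment is bounded as a nonnegative integral, square integrability is a
  conclusion here and comes together with the norm.\<close>

lemma moment_bound:
  assumes [measurable]: "f \<in> borel_measurable borel" "X \<in> sets borel"
    and le: "\<And>v. M v * (cmod (f v))\<^sup>2 \<le> c * (jb v powr t * indicator X v)"
    and J: "jint t X \<le> ennreal B" and "c \<ge> 0" "B \<ge> 0"
  shows "f \<in> L2 N" "(nrm N f)\<^sup>2 \<le> c * B"
proof -
  have nn: "(\<integral>\<^sup>+v. ennreal (M v * (cmod (f v))\<^sup>2) \<partial>lborel) \<le> ennreal (c * B)"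
  proof -
    have "(\<integral>\<^sup>+v. ennreal (M v * (cmod (f v))\<^sup>2) \<partial>lborel) \<le> (\<integral>\<^sup>+v. ennreal c * (ennreal (jb v powr t) * indicator X v) \<partial>lborel)"
    proof (rule nn_integral_mono)
      fix v
      have "ennreal (M v * (cmod (f v))\<^sup>2) \<le> ennreal (c * (jb v powr t * indicator X v))"
        by (rule ennreal_leI[OF le])
      also have "\<dots> = ennreal c * (ennreal (jb v powr t) * indicator X v)"
        using \<open>c \<ge> 0\<close> by (auto simp: ennreal_mult indicator_def)
      finally show "ennreal (M v * (cmod (f v))\<^sup>2) \<le> ennreal c * (ennreal (jb v powr t) * indicator X v)" .
    qed
    also have "\<dots> = ennreal c * jint t X" unfolding jint_def by (rule nn_integral_cmult) measurable
    also have "\<dots> \<le> ennreal c * ennreal B" by (intro mult_left_mono J) simp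
    finally show ?thesis using assms(5,6) by (simp add: ennreal_mult)
  qed
  have pos: "0 \<le> M v * (cmod (f v))\<^sup>2" for v using M_pos[of v] by simp
  have int: "integrable lborel (\<lambda>v. M v * (cmod (f v))\<^sup>2)"
    by (rule integrableI_bounded) (use pos le_less_trans[OF nn ennreal_less_top] in auto)
  then show "f \<in> L2 N" unfolding L2_def by (simp add: integrable_N)
  have "ennreal (LINT v|lborel. M v * (cmod (f v))\<^sup>2) \<le> ennreal (c * B)"
    using nn nn_integral_eq_integral[OF int] pos by simp
  then have "(LINT v|lborel. M v * (cmod (f v))\<^sup>2) \<le> c * B"
    using assms(5,6) by (subst (asm) ennreal_le_iff) auto
  moreover have "(nrm N f)\<^sup>2 = (LINT v|lborel. M v * (cmod (f v))\<^sup>2)"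
    unfolding nrm_sq by (subst integral_N) auto
  ultimately show "(nrm N f)\<^sup>2 \<le> c * B" by simp
qed

lemma mode_exists_unique:
  assumes "\<eta> > 0" "norm \<sigma> = 1"
    and g: "g \<in> dom_adv \<beta> M Dt \<sigma>" "nrm N (\<lambda>v. g v - e v) \<le> lam / (8 + 16 * lam)"
      "nrm N (L_adv \<beta> L \<eta> \<sigma> g) \<le> lam / (8 + 16 * lam)"
  shows "\<exists>\<phi> \<mu>. \<mu> \<in> ball 0 (lam / 2) \<and> fluid_mode \<beta> M Dt L \<eta> \<sigma> \<phi> \<mu> \<and>
    (\<forall>\<phi>' \<mu>'. \<mu>' \<in> ball 0 (lam / 2) \<and> fluid_mode \<beta> M Dt L \<eta> \<sigma> \<phi>' \<mu>' \<longrightarrow>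
      \<mu>' = \<mu> \<and> (AE v in lborel. \<phi>' v = \<phi> v))"
proof -
  interpret gap_operator N e "dom_adv \<beta> M Dt \<sigma>" "L_adv \<beta> L \<eta> \<sigma>" lam
    by (rule gap_operator) (use assms in auto)
  obtain \<psi> \<mu> where *: "\<mu> \<in> ball 0 (lam / 2)"
    "is_adjoint N (dom_adv \<beta> M Dt \<sigma>) (L_adv \<beta> L \<eta> \<sigma>) \<psi> (\<lambda>v. - \<mu> * \<psi> v)" "ip N \<psi> e = 1"
    and uniq: "\<forall>\<psi>' \<mu>'. \<mu>' \<in> ball 0 (lam / 2) \<and>
      is_adjoint N (dom_adv \<beta> M Dt \<sigma>) (L_adv \<beta> L \<eta> \<sigma>) \<psi>' (\<lambda>v. - \<mu>' * \<psi>' v) \<and> ip N \<psi>' e = 1 \<longrightarrow>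
      \<mu>' = \<mu> \<and> (AE v in N. \<psi>' v = \<psi> v)"
    using eigenvalue_exists_unique[OF g] by (elim exE conjE)
  show ?thesis
  proof (rule exI[of _ "\<lambda>v. \<psi> v / e v"], rule exI[of _ \<mu>], intro conjI allI impI)
    show "\<mu> \<in> ball 0 (lam / 2)" by (rule *)
    show "fluid_mode \<beta> M Dt L \<eta> \<sigma> (\<lambda>v. \<psi> v / e v) \<mu>"
      by (rule fluid_mode_of_eigenvector[OF *(2,3)])
    fix \<phi>' \<mu>' assume "\<mu>' \<in> ball 0 (lam / 2) \<and> fluid_mode \<beta> M Dt L \<eta> \<sigma> \<phi>' \<mu>'"
    then have "\<mu>' \<in> ball 0 (lam / 2) \<and> is_adjoint N (dom_adv \<beta> M Dt \<sigma>) (L_adv \<beta> L \<eta> \<sigma>) (\<lambda>v. e v * \<phi>' v) (\<lambda>v. - \<mu>' * (e v * \<phi>' v)) \<and>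
        ip N (\<lambda>v. e v * \<phi>' v) e = 1"
      unfolding fluid_mode_iff by blast+
    from uniq[rule_format, OF this] have u: "\<mu>' = \<mu>" "AE v in N. e v * \<phi>' v = \<psi> v" by auto
    show "\<mu>' = \<mu>" by (rule u)
    show "AE v in lborel. \<phi>' v = \<psi> v / e v"
      using u(2) unfolding AE_N by eventually_elim (use e_nz in \<open>auto simp: field_simps\<close>)
  qed
qed

lemma mode_bounds:
  assumes "\<eta> > 0" "norm \<sigma> = 1" "fluid_mode \<beta> M Dt L \<eta> \<sigma> \<phi> \<mu>" "cmod \<mu> < lam / 2"
  shows "0 \<le> Re \<mu>" "wnorm M (-\<beta>) (\<lambda>v. \<phi> v - 1) \<le> sqrt (2 / lam) * sqrt (Re \<mu>)"
proof -
  interpret gap_operator N e "dom_adv \<beta> M Dt \<sigma>" "L_adv \<beta> L \<eta> \<sigma>" lam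
    by (rule gap_operator) (use assms in auto)
  have f: "\<phi> \<in> borel_measurable borel"
    "is_adjoint N (dom_adv \<beta> M Dt \<sigma>) (L_adv \<beta> L \<eta> \<sigma>) (\<lambda>v. e v * \<phi> v) (\<lambda>v. - \<mu> * (e v * \<phi> v))"
    "ip N (\<lambda>v. e v * \<phi> v) e = 1"
    using assms(3) unfolding fluid_mode_iff by auto
  show "0 \<le> Re \<mu>" by (rule eigenvector_bounds(1)[OF f(2,3) assms(4)])
  show "wnorm M (-\<beta>) (\<lambda>v. \<phi> v - 1) \<le> sqrt (2 / lam) * sqrt (Re \<mu>)"
    unfolding wnorm_minus_one[OF f(1)] real_sqrt_mult[symmetric]
    by (rule real_le_rsqrt) (rule eigenvector_bounds(2)[OF f(2,3) assms(4)])
qed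

text \<open>Paired with \<open>e\<close>, only advection survives, because the range of
  \<open>T\<close> is orthogonal to \<open>e\<close>. The left side is the flux of \<open>g\<close>
  in direction \<open>\<sigma>\<close>, to be made large by taking \<open>g\<close> close to
  \<open>e\<close> times the velocity.\<close>

lemma mode_lower_bound:
  assumes "\<eta> > 0" "norm \<sigma> = 1" "fluid_mode \<beta> M Dt L \<eta> \<sigma> \<phi> \<mu>" "cmod \<mu> < lam / 2" "Im \<mu> = 0"
    and g: "g \<in> dom_adv \<beta> M Dt \<sigma>"
  shows "\<eta> * cmod (ip N (\<lambda>v. of_real (vel \<beta> \<sigma> v) * g v) e) \<le>
    sqrt (Re \<mu>) * (sqrt (2 / lam) * (nrm N (T g) + \<eta> * nrm N (\<lambda>v. of_real (vel \<beta> \<sigma> v) * g v)) + 2 * sqrt lam * nrm N g)"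
proof -
  interpret gap_operator N e "dom_adv \<beta> M Dt \<sigma>" "L_adv \<beta> L \<eta> \<sigma>" lam
    by (rule gap_operator) (use assms in auto)
  have f: "is_adjoint N (dom_adv \<beta> M Dt \<sigma>) (L_adv \<beta> L \<eta> \<sigma>) (\<lambda>v. e v * \<phi> v) (\<lambda>v. - \<mu> * (e v * \<phi> v))"
    "ip N (\<lambda>v. e v * \<phi> v) e = 1"
    using assms(3) unfolding fluid_mode_iff by auto
  have "\<eta> * cmod (ip N (\<lambda>v. of_real (vel \<beta> \<sigma> v) * g v) e) = cmod (ip N (L_adv \<beta> L \<eta> \<sigma> g) e)"
    unfolding ip_L_adv_e[OF g] using assms(1) by (simp add: norm_mult)
  also have "\<dots> \<le> sqrt (Re \<mu>) * (sqrt (2 / lam) * nrm N (L_adv \<beta> L \<eta> \<sigma> g) + 2 * sqrt lam * nrm N g)"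
    by (rule eigenvalue_lower_bound[OF f assms(4,5) g])
  also have "\<dots> \<le> sqrt (Re \<mu>) * (sqrt (2 / lam) * (nrm N (T g) + \<eta> * nrm N (\<lambda>v. of_real (vel \<beta> \<sigma> v) * g v)) + 2 * sqrt lam * nrm N g)"
    using mode_bounds(1)[OF assms(1-4)] nrm_L_adv_le[OF g, of \<eta>] assms(1) lam_pos
    by (intro mult_left_mono add_right_mono) auto
  finally show ?thesis .
qed

text \<open>The error against \<open>e\<close> lives outside the ball of radius \<open>R\<close>,
  where the cutoff may differ from 1. The bound on the advected function is crude, but in the
  existence proof \<open>R\<close> is fixed before \<open>\<eta>\<close>. The pairing with
  \<open>e\<close> has no real part, being an imaginary multiple of the integral of a real
  function.\<close>

lemma cut_test_function:
  assumes \<kappa>: "cutoff \<kappa>" and R: "R \<ge> 1" and \<sigma>: "norm \<sigma> = 1"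
    and g: "(\<lambda>v. e v * cut \<kappa> R v) \<in> Dt"
  shows "(\<lambda>v. of_real (vel \<beta> \<sigma> v) * (e v * cut \<kappa> R v)) \<in> L2 N"
    "(\<lambda>v. e v * cut \<kappa> R v) \<in> dom_adv \<beta> M Dt \<sigma>"
    "nrm N (\<lambda>v. of_real (vel \<beta> \<sigma> v) * (e v * cut \<kappa> R v)) \<le> (1 + 2 * R) powr \<bar>1 + \<beta>\<bar>"
    "(nrm N (\<lambda>v. e v * cut \<kappa> R v - e v))\<^sup>2 \<le> (LINT v|lborel. wgt \<beta> M v * indicator (- ball 0 R) v)"
    "Re (ip N (L_adv \<beta> L \<eta> \<sigma> (\<lambda>v. e v * cut \<kappa> R v)) e) = 0"
proof -
  note [measurable] = cutoff_measurable[OF \<kappa>]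
  have R0: "R > 0" using R by simp
  note c = cutoff_scaled[OF \<kappa> R0]
  define m where "m v = vel \<beta> \<sigma> v * \<kappa> (v /\<^sub>R R)" for v
  have m[measurable]: "m \<in> borel_measurable borel" unfolding m_def by measurable
  have m_le: "\<bar>m v\<bar> \<le> (1 + 2 * R) powr \<bar>1 + \<beta>\<bar>" for v
  proof (cases "norm v < 2 * R")
    case True
    have "\<bar>m v\<bar> = \<bar>vel \<beta> \<sigma> v\<bar> * \<kappa> (v /\<^sub>R R)" using c(1)[of v] by (simp add: m_def abs_mult)
    also have "\<dots> \<le> \<bar>vel \<beta> \<sigma> v\<bar> * 1" by (intro mult_left_mono c) simp
    also have "\<dots> \<le> jb v powr (1 + \<beta>)" using abs_vel_le[OF \<sigma>] by simp
    also have "\<dots> \<le> (1 + 2 * R) powr \<bar>1 + \<beta>\<bar>" by (rule jb_powr_le_ball[OF True])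
    finally show ?thesis .
  next
    case False
    then show ?thesis using c(4)[of v] by (simp add: m_def)
  qed
  have m_eq: "(\<lambda>v. of_real (vel \<beta> \<sigma> v) * (e v * cut \<kappa> R v)) = (\<lambda>v. of_real (m v) * e v)"
    by (auto simp: m_def cut_def)
  have mL: "m \<in> borel_measurable N" by simp
  show L2: "(\<lambda>v. of_real (vel \<beta> \<sigma> v) * (e v * cut \<kappa> R v)) \<in> L2 N"
    unfolding m_eq by (rule L2_mult_bounded(1)[OF e_L2 mL m_le])
  then show dom: "(\<lambda>v. e v * cut \<kappa> R v) \<in> dom_adv \<beta> M Dt \<sigma>" using g by (simp add: dom_adv_def)
  show "nrm N (\<lambda>v. of_real (vel \<beta> \<sigma> v) * (e v * cut \<kappa> R v)) \<le> (1 + 2 * R) powr \<bar>1 + \<beta>\<bar>"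
    unfolding m_eq using L2_mult_bounded(2)[OF e_L2 mL m_le] by (simp add: nrm_e)
  show "Re (ip N (L_adv \<beta> L \<eta> \<sigma> (\<lambda>v. e v * cut \<kappa> R v)) e) = 0"
    unfolding ip_L_adv_e[OF dom] m_eq using Im_ip_real_mult_self[of N m e] by simp
  have d: "(\<lambda>v. e v * cut \<kappa> R v - e v) \<in> L2 N" by (intro L2_intros Dt_L2 g e_L2)
  have "(nrm N (\<lambda>v. e v * cut \<kappa> R v - e v))\<^sup>2 = (LINT v|lborel. M v *\<^sub>R (cmod (e v * cut \<kappa> R v - e v))\<^sup>2)"
    unfolding nrm_sq cut_def by (rule integral_N) measurable
  also have "\<dots> \<le> (LINT v|lborel. wgt \<beta> M v * indicator (- ball 0 R) v)"
  proof (rule integral_mono)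
    show "integrable lborel (\<lambda>v. M v *\<^sub>R (cmod (e v * cut \<kappa> R v - e v))\<^sup>2)"
      using d unfolding L2_def by (subst integrable_N[symmetric]) (auto simp: cut_def)
    show "integrable lborel (\<lambda>v. wgt \<beta> M v * indicator (- ball 0 R) v)"
      using integrable_mult_indicator[OF _ wgt_integrable, of "- ball 0 R"] by (simp add: mult.commute)
    fix v
    have "e v * cut \<kappa> R v - e v = e v * of_real (\<kappa> (v /\<^sub>R R) - 1)" by (simp add: cut_def algebra_simps)
    then have "M v *\<^sub>R (cmod (e v * cut \<kappa> R v - e v))\<^sup>2 = wgt \<beta> M v * (\<kappa> (v /\<^sub>R R) - 1)\<^sup>2"
      by (simp add: norm_mult power_mult_distrib cmod_e_sq wgt_def del: of_real_diff)
    also have "\<dots> \<le> wgt \<beta> M v * indicator (- ball 0 R) v"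
    proof (rule mult_left_mono)
      have "(\<kappa> (v /\<^sub>R R) - 1)\<^sup>2 \<le> 1" using c(1,2)[of v] by (simp add: abs_square_le_1)
      then show "(\<kappa> (v /\<^sub>R R) - 1)\<^sup>2 \<le> indicator (- ball 0 R) v"
        using c(3)[of v] by (auto simp: indicator_def)
      show "0 \<le> wgt \<beta> M v" using M_pos[of v] by (simp add: wgt_def)
    qed
    finally show "M v *\<^sub>R (cmod (e v * cut \<kappa> R v - e v))\<^sup>2 \<le> wgt \<beta> M v * indicator (- ball 0 R) v" .
  qed
  finally show "(nrm N (\<lambda>v. e v * cut \<kappa> R v - e v))\<^sup>2 \<le> (LINT v|lborel. wgt \<beta> M v * indicator (- ball 0 R) v)" .
qed

text \<open>\<open>X\<close> and \<open>Y\<close> remain free so that each regime can insert its own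
  bounds on the two terms of the operator. The tail is required to be at most 1/16 because the
  distance to \<open>e\<close>, its square root, has to be at most 1/4.\<close>

lemma mode_upper_bound:
  assumes "\<eta> > 0" "norm \<sigma> = 1" "fluid_mode \<beta> M Dt L \<eta> \<sigma> \<phi> \<mu>" "cmod \<mu> < lam / 2" "Im \<mu> = 0"
    and \<kappa>: "cutoff \<kappa>" and R: "R \<ge> 1" and g: "(\<lambda>v. e v * cut \<kappa> R v) \<in> Dt"
    and tail: "(LINT v|lborel. wgt \<beta> M v * indicator (- ball 0 R) v) \<le> 1 / 16"
    and X: "wnorm M \<beta> (L (cut \<kappa> R)) \<le> X"
    and Y: "nrm N (\<lambda>v. of_real (vel \<beta> \<sigma> v) * (e v * cut \<kappa> R v)) \<le> Y"
  shows "Re \<mu> \<le> 8 / lam * (X + \<eta> * Y)\<^sup>2"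
proof -
  interpret gap_operator N e "dom_adv \<beta> M Dt \<sigma>" "L_adv \<beta> L \<eta> \<sigma>" lam
    by (rule gap_operator) (use assms in auto)
  have f: "is_adjoint N (dom_adv \<beta> M Dt \<sigma>) (L_adv \<beta> L \<eta> \<sigma>) (\<lambda>v. e v * \<phi> v) (\<lambda>v. - \<mu> * (e v * \<phi> v))"
    "ip N (\<lambda>v. e v * \<phi> v) e = 1"
    using assms(3) unfolding fluid_mode_iff by auto
  note t = cut_test_function[OF \<kappa> R assms(2) g]
  have "(nrm N (\<lambda>v. e v * cut \<kappa> R v - e v))\<^sup>2 \<le> (1/4)\<^sup>2" using t(4) tail by (simp add: power2_eq_square)
  then have "nrm N (\<lambda>v. e v * cut \<kappa> R v - e v) \<le> 1/4" by (rule power2_le_imp_le) simp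
  from eigenvalue_upper_bound[OF f assms(4,5) t(2) this t(5)]
  have "Re \<mu> \<le> 8 / lam * (nrm N (L_adv \<beta> L \<eta> \<sigma> (\<lambda>v. e v * cut \<kappa> R v)))\<^sup>2" .
  also have "\<dots> \<le> 8 / lam * (X + \<eta> * Y)\<^sup>2"
  proof (intro mult_left_mono power_mono)
    have "nrm N (L_adv \<beta> L \<eta> \<sigma> (\<lambda>v. e v * cut \<kappa> R v)) \<le> wnorm M \<beta> (L (cut \<kappa> R)) + \<eta> * nrm N (\<lambda>v. of_real (vel \<beta> \<sigma> v) * (e v * cut \<kappa> R v))"
      using nrm_L_adv_le[OF t(2), of \<eta>] assms(1) by (simp add: nrm_T_e_mult)
    also have "\<dots> \<le> X + \<eta> * Y" using X Y assms(1) by (intro add_mono mult_left_mono) auto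
    finally show "nrm N (L_adv \<beta> L \<eta> \<sigma> (\<lambda>v. e v * cut \<kappa> R v)) \<le> X + \<eta> * Y" .
  qed (use lam_pos in auto)
  finally show ?thesis .
qed

text \<open>\<open>vel\<close> vanishes only on the hyperplane orthogonal to
  \<open>\<sigma>\<close>, a null set; this is read off from the positive second moment over an
  annulus.\<close>

lemma vel_e_nonzero:
  assumes "norm \<sigma> = 1" "(\<lambda>v. of_real (vel \<beta> \<sigma> v) * e v) \<in> L2 N"
  shows "nrm N (\<lambda>v. of_real (vel \<beta> \<sigma> v) * e v) > 0"
proof (rule ccontr)
  assume "\<not> ?thesis"
  then have "nrm N (\<lambda>v. of_real (vel \<beta> \<sigma> v) * e v) = 0"
    using nrm_nonneg[of N "\<lambda>v. of_real (vel \<beta> \<sigma> v) * e v"] by linarith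
  then have "AE v in N. of_real (vel \<beta> \<sigma> v) * e v = 0" by (rule nrm_eq_0_imp_AE[OF assms(2)])
  then have z: "AE v in lborel. v \<bullet> \<sigma> = 0"
    unfolding AE_N using e_nz jb_pos by (auto simp: vel_def less_imp_neq[OF jb_pos, symmetric])
  obtain c where c: "c > 0" "\<And>(\<sigma>::real^'n) r. r \<ge> 1 \<Longrightarrow> norm \<sigma> = 1 \<Longrightarrow>
    ennreal (c * r powr 0) \<le> (\<integral>\<^sup>+v. ennreal ((v \<bullet> \<sigma>)\<^sup>2 * jb v powr (0 - 2 - real CARD('n))) * indicator (ball 0 r - ball 0 (r / 2)) v \<partial>lborel)"
    using second_moment_annulus_ge[of 0, where 'n = 'n] by blast
  have "(\<integral>\<^sup>+v. ennreal ((v \<bullet> \<sigma>)\<^sup>2 * jb v powr (0 - 2 - real CARD('n))) * indicator (ball 0 1 - ball 0 (1 / 2)) v \<partial>lborel) = (\<integral>\<^sup>+v. 0 \<partial>(lborel :: (real^'n) measure))"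
    by (rule nn_integral_cong_AE) (use z in \<open>eventually_elim, simp\<close>)
  then show False using c(2)[of 1 \<sigma>] assms(1) c(1) by simp
qed

text \<open>
  The domain is dense, so it contains an approximation of \<open>vel \<sigma> * e\<close> for one direction; rotation
  invariance transports the resulting bound to all directions.
\<close>

lemma mode_lower_bound_square:
  assumes vel_L2: "\<And>\<sigma>. norm \<sigma> = 1 \<Longrightarrow> (\<lambda>v. of_real (vel \<beta> \<sigma> v) * e v) \<in> L2 N"
  shows "\<exists>s>0. \<forall>\<eta> \<sigma> \<phi> \<mu>. 0 < \<eta> \<and> \<eta> < 1 \<and> norm \<sigma> = 1 \<and> fluid_mode \<beta> M Dt L \<eta> \<sigma> \<phi> \<mu> \<and>
    cmod \<mu> < lam / 2 \<and> Im \<mu> = 0 \<longrightarrow> s * \<eta>\<^sup>2 \<le> Re \<mu>"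
proof -
  obtain \<sigma>0 :: "real^'n" where s0: "norm \<sigma>0 = 1" using vector_choose_size[of 1] by auto
  let ?u = "\<lambda>v. of_real (vel \<beta> \<sigma>0 v) * e v"
  have u: "?u \<in> L2 N" by (rule vel_L2[OF s0])
  define q where "q = nrm N ?u"
  have q: "q > 0" unfolding q_def by (rule vel_e_nonzero[OF s0 u])
  have dd: "densely_defined N (dom_adv \<beta> M Dt \<sigma>0)"
    using well_posed s0 unfolding modes_well_posed_def by (meson zero_less_one)
  have "q / 2 > 0" using q by simp
  from dd[unfolded densely_defined_def, rule_format, OF u this]
  obtain g where g: "g \<in> dom_adv \<beta> M Dt \<sigma>0" "nrm N (\<lambda>v. ?u v - g v) < q / 2" by blast
  have gL: "g \<in> L2 N" by (rule Dt_L2[OF dom_advD(1)[OF g(1)]])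
  \<comment> \<open>The real multiplier moves to the other slot, so the flux of \<open>g\<close> is
    a pairing with \<open>?u\<close> and is close to its squared norm.\<close>
  have "ip N (\<lambda>v. of_real (vel \<beta> \<sigma>0 v) * g v) e = ip N g ?u" by (rule ip_real_mult)
  also have "ip N g ?u = of_real (q\<^sup>2) - ip N (\<lambda>v. ?u v - g v) ?u"
    using gL u by (simp add: ip_simps L2_intros ip_self q_def)
  finally have eq: "ip N (\<lambda>v. of_real (vel \<beta> \<sigma>0 v) * g v) e = of_real (q\<^sup>2) - ip N (\<lambda>v. ?u v - g v) ?u" .
  have "cmod (ip N (\<lambda>v. ?u v - g v) ?u) \<le> nrm N (\<lambda>v. ?u v - g v) * q"
    unfolding q_def by (intro cauchy_schwarz L2_intros gL u)
  also have "\<dots> \<le> q / 2 * q" using g(2) q by (intro mult_right_mono) auto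
  finally have "cmod (ip N (\<lambda>v. ?u v - g v) ?u) \<le> q\<^sup>2 / 2" by (simp add: power2_eq_square)
  moreover have "q\<^sup>2 = cmod (of_real (q\<^sup>2))" unfolding norm_of_real by simp
  ultimately have low: "q\<^sup>2 / 2 \<le> cmod (ip N (\<lambda>v. of_real (vel \<beta> \<sigma>0 v) * g v) e)"
    unfolding eq using norm_triangle_ineq2[of "of_real (q\<^sup>2)" "ip N (\<lambda>v. ?u v - g v) ?u"] by linarith
  define C where "C = sqrt (2 / lam) * (nrm N (T g) + nrm N (\<lambda>v. of_real (vel \<beta> \<sigma>0 v) * g v)) + 2 * sqrt lam * nrm N g + 1"
  have C: "C > 0" unfolding C_def using lam_pos by (intro add_nonneg_pos add_nonneg_nonneg mult_nonneg_nonneg) auto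
  have "(q\<^sup>2 / (2 * C))\<^sup>2 * \<eta>\<^sup>2 \<le> Re \<mu>"
    if *: "0 < \<eta>" "\<eta> < 1" "norm \<sigma> = 1" "fluid_mode \<beta> M Dt L \<eta> \<sigma> \<phi> \<mu>" "cmod \<mu> < lam / 2" "Im \<mu> = 0" for \<eta> \<sigma> \<phi> \<mu>
  proof -
    obtain Q where Q: "rotation Q" "Q \<sigma>0 = \<sigma>" using rotation_exists_unit[OF s0 *(3)] by blast
    have fm: "fluid_mode \<beta> M Dt L \<eta> \<sigma>0 (\<phi> \<circ> Q) \<mu>" by (rule fluid_mode_rotate[OF *(4) Q])
    have re: "0 \<le> Re \<mu>" by (rule mode_bounds(1)[OF *(1) s0 fm *(5)])
    have "\<eta> * (q\<^sup>2 / 2) \<le> \<eta> * cmod (ip N (\<lambda>v. of_real (vel \<beta> \<sigma>0 v) * g v) e)"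
      using low *(1) by (intro mult_left_mono) auto
    also have "\<dots> \<le> sqrt (Re \<mu>) * (sqrt (2 / lam) * (nrm N (T g) + \<eta> * nrm N (\<lambda>v. of_real (vel \<beta> \<sigma>0 v) * g v)) + 2 * sqrt lam * nrm N g)"
      by (rule mode_lower_bound[OF *(1) s0 fm *(5,6) g(1)])
    also have "\<dots> \<le> sqrt (Re \<mu>) * C"
    proof (rule mult_left_mono)
      have "\<eta> * nrm N (\<lambda>v. of_real (vel \<beta> \<sigma>0 v) * g v) \<le> nrm N (\<lambda>v. of_real (vel \<beta> \<sigma>0 v) * g v)"
        using *(1,2) by (intro mult_left_le_one_le) auto
      then have "sqrt (2 / lam) * (nrm N (T g) + \<eta> * nrm N (\<lambda>v. of_real (vel \<beta> \<sigma>0 v) * g v)) \<le>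
          sqrt (2 / lam) * (nrm N (T g) + nrm N (\<lambda>v. of_real (vel \<beta> \<sigma>0 v) * g v))"
        using lam_pos by (intro mult_left_mono) auto
      then show "sqrt (2 / lam) * (nrm N (T g) + \<eta> * nrm N (\<lambda>v. of_real (vel \<beta> \<sigma>0 v) * g v)) + 2 * sqrt lam * nrm N g \<le> C"
        unfolding C_def by linarith
    qed (use re in simp)
    finally have "q\<^sup>2 / (2 * C) * \<eta> \<le> sqrt (Re \<mu>)" using C by (simp add: field_simps)
    then have "(q\<^sup>2 / (2 * C) * \<eta>)\<^sup>2 \<le> (sqrt (Re \<mu>))\<^sup>2" using *(1) C by (intro power_mono) auto
    then show ?thesis by (simp only: power_mult_distrib[of "q\<^sup>2 / (2 * C)"] real_sqrt_pow2[OF re])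
  qed
  moreover have "(q\<^sup>2 / (2 * C))\<^sup>2 > 0" using q C by simp
  ultimately show ?thesis by blast
qed

text \<open>When \<open>vel\<close> times \<open>e\<close> is square integrable, the advection term
  is at most \<open>\<eta> * V\<close> whatever the cutoff. Hence \<open>R\<close> may depend on
  \<open>\<eta>\<close> and be taken so large that the collision term is below \<open>\<eta>\<close>
  as well.\<close>

lemma mode_upper_bound_square:
  assumes V: "\<And>\<sigma>. norm \<sigma> = 1 \<Longrightarrow> (\<lambda>v. of_real (vel \<beta> \<sigma> v) * e v) \<in> L2 N \<and> nrm N (\<lambda>v. of_real (vel \<beta> \<sigma> v) * e v) \<le> V"
    and \<kappa>: "cutoff \<kappa>" and Dt: "\<And>R. R \<ge> 1 \<Longrightarrow> (\<lambda>v. e v * cut \<kappa> R v) \<in> Dt"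
    and p: "p > 0" and Lc: "\<And>R. R \<ge> 1 \<Longrightarrow> wnorm M \<beta> (L (cut \<kappa> R)) \<le> A' * R powr - p"
    and m: "0 < \<eta>" "norm \<sigma> = 1" "fluid_mode \<beta> M Dt L \<eta> \<sigma> \<phi> \<mu>" "cmod \<mu> < lam / 2" "Im \<mu> = 0"
  shows "Re \<mu> \<le> 8 / lam * (1 + V)\<^sup>2 * \<eta>\<^sup>2"
proof -
  obtain R0 where R0: "R0 \<ge> 1" "\<And>R. R \<ge> R0 \<Longrightarrow> (LINT v|lborel. wgt \<beta> M v * indicator (- ball 0 R) v) \<le> 1 / 16"
    using integral_tail[OF wgt_integrable, of "1/16"] by auto
  have "((\<lambda>R. A' * R powr - p) \<longlongrightarrow> A' * 0) at_top"
    by (intro tendsto_mult tendsto_const tendsto_neg_powr filterlim_ident) (use p in simp)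
  then have "\<forall>\<^sub>F R in at_top. A' * R powr - p < \<eta>" using m(1) by (simp add: order_tendstoD(2))
  then have "\<forall>\<^sub>F R in at_top. A' * R powr - p < \<eta> \<and> R \<ge> R0" using eventually_ge_at_top by (rule eventually_conj)
  then obtain R where R: "A' * R powr - p < \<eta>" "R \<ge> R0" unfolding eventually_at_top_linorder by blast
  have R1: "R \<ge> 1" using R R0 by linarith
  note [measurable] = cutoff_measurable[OF \<kappa>]
  have c: "0 \<le> \<kappa> (v /\<^sub>R R)" "\<kappa> (v /\<^sub>R R) \<le> 1" for v using cutoff_scaled[OF \<kappa>, of R v] R1 by auto
  have "nrm N (\<lambda>v. of_real (\<kappa> (v /\<^sub>R R)) * (of_real (vel \<beta> \<sigma> v) * e v)) \<le> 1 * nrm N (\<lambda>v. of_real (vel \<beta> \<sigma> v) * e v)"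
    by (rule L2_mult_bounded(2)) (use V m c in auto)
  then have Y: "nrm N (\<lambda>v. of_real (vel \<beta> \<sigma> v) * (e v * cut \<kappa> R v)) \<le> V"
    using V[OF m(2)] by (simp add: cut_def mult_ac)
  have "Re \<mu> \<le> 8 / lam * (\<eta> + \<eta> * V)\<^sup>2"
    by (rule mode_upper_bound[OF m \<kappa> R1 Dt[OF R1] R0(2)[OF R(2)] _ Y]) (use Lc[OF R1] R(1) in linarith)
  also have "\<dots> = 8 / lam * (1 + V)\<^sup>2 * \<eta>\<^sup>2" by (simp add: power2_eq_square algebra_simps)
  finally show ?thesis .
qed

end

lemma powr_mult_eq: "s + t = u \<Longrightarrow> x powr s * x powr t = (x::real) powr u"
  by (simp flip: powr_add)

section \<open>Heavy-tailed equilibria\<close>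

context collision
begin

text \<open>\<open>E R\<close> is the growth of the second moment truncated at \<open>R\<close>, a
  power or a logarithm. With \<open>\<eta> * R powr (1 + \<beta>)\<close> held constant, the lower
  bound reads: \<open>\<eta> * E R\<close> is at most a multiple of
  \<open>sqrt (Re \<mu>) * sqrt (E R)\<close>. So \<open>Re \<mu>\<close> is at least of order
  \<open>\<eta>\<^sup>2 * E R\<close>, the order that the upper bound also produces;
  \<open>th\<close> is this quantity in closed form.\<close>

lemma mode_bounds_heavy_tail:
  fixes a \<rho> c0 A' B' C1 C2 C3 C4 C5 C6 :: real and E th :: "real \<Rightarrow> real"
  assumes b: "1 + \<beta> > 0" and \<rho>: "\<rho> \<ge> 2"
    and M_form: "\<And>v. M v = c0 * jb v powr (- (real CARD('n) + a))" and c0: "c0 > 0"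
    and \<kappa>: "cutoff \<kappa>"
    and Dt1: "\<And>R. R \<ge> 1 \<Longrightarrow> (\<lambda>v. e v * cut \<kappa> R v) \<in> Dt"
    and Dt2: "\<And>\<sigma> R. norm \<sigma> = 1 \<Longrightarrow> R \<ge> 2 \<Longrightarrow> (\<lambda>v. e v * cut_vel \<beta> \<kappa> \<sigma> R v) \<in> Dt"
    and Lc: "\<And>R. R \<ge> 1 \<Longrightarrow> wnorm M \<beta> (L (cut \<kappa> R)) \<le> A' * R powr (- ((a + \<beta>) / 2))"
    and Lv: "\<And>\<sigma> R. norm \<sigma> = 1 \<Longrightarrow> R \<ge> 2 \<Longrightarrow> wnorm M \<beta> (L (cut_vel \<beta> \<kappa> \<sigma> R)) \<le> B' * sqrt (E R)"
    and E: "\<And>R. R \<ge> 2 \<Longrightarrow> E R > 0"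
    and J1: "\<And>R. R \<ge> 2 \<Longrightarrow> jint (2 + \<beta> - a - real CARD('n)) (ball (0::real^'n) (2 * R)) \<le> ennreal (C1 * E R)"
    and J2: "\<And>R. R \<ge> 2 \<Longrightarrow> jint (4 + 3 * \<beta> - a - real CARD('n)) (ball (0::real^'n) (2 * R)) \<le> ennreal (C2 * ((R powr (1 + \<beta>))\<^sup>2 * E R))"
    and J3: "\<And>(\<sigma>::real^'n) R. norm \<sigma> = 1 \<Longrightarrow> R \<ge> 2 \<Longrightarrow>
      ennreal (C3 * E R) \<le> (\<integral>\<^sup>+v. ennreal ((v \<bullet> \<sigma>)\<^sup>2 * jb v powr (\<beta> - a - real CARD('n))) * indicator (ball 0 R) v \<partial>lborel)"
    and C: "C1 \<ge> 0" "C2 \<ge> 0" "C3 > 0" "C4 \<ge> 0" "C5 \<ge> 0" "C6 > 0" "A' \<ge> 0" "B' \<ge> 0"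
    and tail: "\<And>R. R \<ge> \<rho> \<Longrightarrow> (LINT v|lborel. wgt \<beta> M v * indicator (- ball 0 R) v) \<le> 1 / 16"
    and th: "\<And>\<eta>. 0 < \<eta> \<Longrightarrow> \<eta> \<le> 1 / 2 \<Longrightarrow>
      (\<rho> * \<eta> powr (- (1 / (1 + \<beta>)))) powr (- (a + \<beta>)) \<le> C4 * th \<eta> \<and>
      \<eta>\<^sup>2 * E (\<rho> * \<eta> powr (- (1 / (1 + \<beta>)))) \<le> C5 * th \<eta> \<and>
      C6 * th \<eta> \<le> \<eta>\<^sup>2 * E (\<rho> * \<eta> powr (- (1 / (1 + \<beta>)))) \<and> 0 \<le> th \<eta>"
  shows "\<exists>s0>0. \<exists>s1>0. \<forall>\<eta> \<sigma> \<phi> \<mu>. 0 < \<eta> \<and> \<eta> \<le> 1 / 2 \<and> norm \<sigma> = 1 \<and> fluid_mode \<beta> M Dt L \<eta> \<sigma> \<phi> \<mu> \<and>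
    cmod \<mu> < lam / 2 \<and> Im \<mu> = 0 \<longrightarrow> s0 * th \<eta> \<le> Re \<mu> \<and> Re \<mu> \<le> s1 * th \<eta>"
proof -
  let ?d = "real CARD('n)"
  \<comment> \<open>The coefficient multiplying \<open>sqrt (Re \<mu>) * sqrt (E R)\<close> in the
    lower bound, enlarged by 1 to be positive.\<close>
  define C7 where "C7 = sqrt (2 / lam) * (B' + \<rho> powr (1 + \<beta>) * sqrt (c0 * C2)) + 2 * sqrt lam * sqrt (c0 * C1) + 1"
  have C7: "C7 > 0"
    unfolding C7_def using lam_pos c0 C by (intro add_nonneg_pos add_nonneg_nonneg mult_nonneg_nonneg) auto
  define s0 where "s0 = (c0 * C3 / C7)\<^sup>2 * C6"
  define s1 where "s1 = 16 / lam * (A'\<^sup>2 * C4 + c0 * C1 * C5) + 1"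
  have s0: "s0 > 0" unfolding s0_def using c0 C C7 by simp
  have s1: "s1 > 0" unfolding s1_def using lam_pos c0 C by (intro add_nonneg_pos mult_nonneg_nonneg add_nonneg_nonneg) auto
  note [measurable] = cutoff_measurable[OF \<kappa>]
  have bounds: "s0 * th \<eta> \<le> Re \<mu> \<and> Re \<mu> \<le> s1 * th \<eta>"
    if eta: "0 < \<eta>" "\<eta> \<le> 1 / 2" and s: "norm \<sigma> = 1" and fm: "fluid_mode \<beta> M Dt L \<eta> \<sigma> \<phi> \<mu>"
      and mu: "cmod \<mu> < lam / 2" "Im \<mu> = 0" for \<eta> \<sigma> \<phi> \<mu>
  proof -
    define R where "R = \<rho> * \<eta> powr (- (1 / (1 + \<beta>)))"
    have "1 \<le> \<eta> powr (- (1 / (1 + \<beta>)))"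
      using powr_mono'[of "- (1 / (1 + \<beta>))" 0 \<eta>] eta b by simp
    then have "\<rho> * 1 \<le> R" unfolding R_def using \<rho> by (intro mult_left_mono) auto
    then have R: "R \<ge> \<rho>" "R \<ge> 2" "R \<ge> 1" using \<rho> by linarith+
    \<comment> \<open>The relation that fixes the scale of \<open>R\<close>: at the cutoff radius,
      advection is comparable to the collision term.\<close>
    have eta_R: "\<eta> * R powr (1 + \<beta>) = \<rho> powr (1 + \<beta>)"
    proof -
      have "R powr (1 + \<beta>) = \<rho> powr (1 + \<beta>) * \<eta> powr (- 1)"
        unfolding R_def using \<rho> b by (simp add: powr_mult powr_powr)
      then show ?thesis using eta by (simp add: powr_minus)
    qed
    note t = th[OF eta, folded R_def]
    define y where "y = sqrt (E R)"
    have ER: "E R > 0" by (rule E[OF R(2)])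
    have y: "y > 0" "y\<^sup>2 = E R" unfolding y_def using ER by auto
    have c: "0 \<le> \<kappa> (v /\<^sub>R R)" "\<kappa> (v /\<^sub>R R) \<le> 1" "norm v < R \<Longrightarrow> \<kappa> (v /\<^sub>R R) = 1"
      "2 * R \<le> norm v \<Longrightarrow> \<kappa> (v /\<^sub>R R) = 0" for v
      using cutoff_scaled[OF \<kappa>, of R v] R by auto
    have cut_sq: "(\<kappa> (v /\<^sub>R R))\<^sup>2 \<le> indicator (ball 0 (2 * R)) v" for v
      using c(1,2,4)[of v] by (auto simp: indicator_def power_le_one)
    have vel_sq: "(vel \<beta> \<sigma> v)\<^sup>2 \<le> jb v powr (2 + 2 * \<beta>)" for v
    proof -
      have "(vel \<beta> \<sigma> v)\<^sup>2 = \<bar>vel \<beta> \<sigma> v\<bar>\<^sup>2" by simp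
      also have "\<dots> \<le> (jb v powr (1 + \<beta>))\<^sup>2" by (intro power_mono abs_vel_le s) simp
      also have "\<dots> = jb v powr (2 + 2 * \<beta>)" using jb_pos[of v] by (simp add: powr_powr algebra_simps flip: powr_numeral)
      finally show ?thesis .
    qed
    have Me: "M v * (cmod (e v))\<^sup>2 = c0 * jb v powr (- \<beta> - a - ?d)" for v
    proof -
      have "- \<beta> - a - ?d = - (?d + a) + - \<beta>" by simp
      then show ?thesis unfolding M_form cmod_e_sq by (simp only: powr_add mult.assoc)
    qed
    \<comment> \<open>\<open>?g1\<close> has two roles: it is the advection term of the test
      function for the upper bound, and it is itself the test function for the lower bound, where
      \<open>?g2\<close> is its advection term.\<close>
    let ?g1 = "\<lambda>v. of_real (vel \<beta> \<sigma> v) * (e v * cut \<kappa> R v)"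
    let ?g2 = "\<lambda>v. of_real (vel \<beta> \<sigma> v) * (e v * cut_vel \<beta> \<kappa> \<sigma> R v)"
    have g2_eq: "(\<lambda>v. e v * cut_vel \<beta> \<kappa> \<sigma> R v) = ?g1" by (auto simp: cut_vel_def)
    have le1: "M v * (cmod (?g1 v))\<^sup>2 \<le> c0 * (jb v powr (2 + \<beta> - a - ?d) * indicator (ball 0 (2 * R)) v)" for v
    proof -
      have "M v * (cmod (?g1 v))\<^sup>2 = (M v * (cmod (e v))\<^sup>2) * ((vel \<beta> \<sigma> v)\<^sup>2 * (\<kappa> (v /\<^sub>R R))\<^sup>2)"
        by (simp add: cut_def norm_mult power_mult_distrib mult_ac)
      also have "\<dots> \<le> (M v * (cmod (e v))\<^sup>2) * (jb v powr (2 + 2 * \<beta>) * indicator (ball 0 (2 * R)) v)"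
        using M_pos[of v] by (intro mult_left_mono mult_mono vel_sq cut_sq) auto
      also have "\<dots> = c0 * (jb v powr (2 + \<beta> - a - ?d) * indicator (ball 0 (2 * R)) v)"
      proof -
        have "2 + \<beta> - a - ?d = (- \<beta> - a - ?d) + (2 + 2 * \<beta>)" by simp
        then show ?thesis unfolding Me by (simp only: powr_add mult.assoc)
      qed
      finally show ?thesis .
    qed
    have le2: "M v * (cmod (?g2 v))\<^sup>2 \<le> c0 * (jb v powr (4 + 3 * \<beta> - a - ?d) * indicator (ball 0 (2 * R)) v)" for v
    proof -
      have "M v * (cmod (?g2 v))\<^sup>2 = (vel \<beta> \<sigma> v)\<^sup>2 * (M v * (cmod (?g1 v))\<^sup>2)"
        by (simp add: cut_vel_def norm_mult power_mult_distrib mult_ac)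
      also have "\<dots> \<le> jb v powr (2 + 2 * \<beta>) * (c0 * (jb v powr (2 + \<beta> - a - ?d) * indicator (ball 0 (2 * R)) v))"
        using M_pos[of v] by (intro mult_mono vel_sq le1) auto
      also have "\<dots> = c0 * (jb v powr (4 + 3 * \<beta> - a - ?d) * indicator (ball 0 (2 * R)) v)"
      proof -
        have "4 + 3 * \<beta> - a - ?d = (2 + 2 * \<beta>) + (2 + \<beta> - a - ?d)" by simp
        then show ?thesis by (simp only: powr_add mult_ac)
      qed
      finally show ?thesis .
    qed
    have meas: "?g1 \<in> borel_measurable borel" "?g2 \<in> borel_measurable borel"
      unfolding cut_vel_def cut_def by measurable
    have ballm: "ball (0::real^'n) (2 * R) \<in> sets borel" by simp
    have "0 \<le> C1 * E R" "0 \<le> C2 * ((R powr (1 + \<beta>))\<^sup>2 * E R)" using C ER by auto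
    note g1 = moment_bound[OF meas(1) ballm le1 J1[OF R(2)] less_imp_le[OF c0] this(1)]
      and g2 = moment_bound[OF meas(2) ballm le2 J2[OF R(2)] less_imp_le[OF c0] this(2)]
    have n1: "nrm N ?g1 \<le> sqrt (c0 * C1) * y"
      unfolding y_def real_sqrt_mult[symmetric] by (rule real_le_rsqrt) (use g1(2) in \<open>simp add: mult.assoc\<close>)
    have n2: "nrm N ?g2 \<le> R powr (1 + \<beta>) * sqrt (c0 * C2) * y"
    proof (rule power2_le_imp_le)
      have "(R powr (1 + \<beta>) * sqrt (c0 * C2) * y)\<^sup>2 = c0 * (C2 * ((R powr (1 + \<beta>))\<^sup>2 * E R))"
        unfolding power_mult_distrib y using c0 C by simp
      then show "(nrm N ?g2)\<^sup>2 \<le> (R powr (1 + \<beta>) * sqrt (c0 * C2) * y)\<^sup>2" using g2(2) by simp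
    qed (use c0 C y in auto)
    have re: "0 \<le> Re \<mu>" by (rule mode_bounds(1)[OF eta(1) s fm mu(1)])
    have upper: "Re \<mu> \<le> s1 * th \<eta>"
    proof -
      let ?X = "A' * R powr (- ((a + \<beta>) / 2))" and ?Y = "sqrt (c0 * C1) * y"
      have "Re \<mu> \<le> 8 / lam * (?X + \<eta> * ?Y)\<^sup>2"
        by (rule mode_upper_bound[OF eta(1) s fm mu \<kappa> R(3) Dt1[OF R(3)] tail[OF R(1)] Lc[OF R(3)] n1])
      also have "\<dots> \<le> 8 / lam * (2 * ?X\<^sup>2 + 2 * (\<eta> * ?Y)\<^sup>2)"
        using lam_pos sum_squares_bound[of ?X "\<eta> * ?Y"] by (intro mult_left_mono) (auto simp: power2_sum)
      also have "?X\<^sup>2 = A'\<^sup>2 * R powr (- (a + \<beta>))"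
      proof -
        have "(R powr (- ((a + \<beta>) / 2)))\<^sup>2 = R powr (- ((a + \<beta>) / 2)) * R powr (- ((a + \<beta>) / 2))"
          by (rule power2_eq_square)
        also have "\<dots> = R powr (- ((a + \<beta>) / 2) + - ((a + \<beta>) / 2))" by (rule powr_add[symmetric])
        also have "- ((a + \<beta>) / 2) + - ((a + \<beta>) / 2) = - (a + \<beta>)" by (simp add: field_simps)
        finally show ?thesis by (simp add: power_mult_distrib)
      qed
      also have "(\<eta> * ?Y)\<^sup>2 = c0 * C1 * (\<eta>\<^sup>2 * E R)"
        unfolding power_mult_distrib y using c0 C by simp
      also have "8 / lam * (2 * (A'\<^sup>2 * R powr (- (a + \<beta>))) + 2 * (c0 * C1 * (\<eta>\<^sup>2 * E R))) \<le>
          8 / lam * (2 * (A'\<^sup>2 * (C4 * th \<eta>)) + 2 * (c0 * C1 * (C5 * th \<eta>)))"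
        using t lam_pos c0 C by (intro mult_left_mono add_mono) auto
      also have "\<dots> = (s1 - 1) * th \<eta>" unfolding s1_def by (simp add: algebra_simps)
      also have "\<dots> \<le> s1 * th \<eta>" using t by (intro mult_right_mono) auto
      finally show ?thesis .
    qed
    have dom: "(\<lambda>v. e v * cut_vel \<beta> \<kappa> \<sigma> R v) \<in> dom_adv \<beta> M Dt \<sigma>"
      using Dt2[OF s R(2)] g2(1) by (simp add: dom_adv_def)
    have low: "c0 * (C3 * E R) \<le> cmod (ip N ?g2 e)"
    proof -
      \<comment> \<open>The integrand of the flux. It is nonnegative and contains the cutoff to the
        first power, so restriction to the ball of radius \<open>R\<close>, where the cutoff is 1,
        bounds its integral from below by \<open>J3\<close>.\<close>
      define f where "f v = M v * ((vel \<beta> \<sigma> v)\<^sup>2 * \<kappa> (v /\<^sub>R R) * (cmod (e v))\<^sup>2)" for v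
      have f0: "0 \<le> f v" for v unfolding f_def using M_pos[of v] c(1)[of v] by simp
      have I0: "0 \<le> (LINT v|lborel. f v)" by (rule Bochner_Integration.integral_nonneg) (rule f0)
      have f_meas[measurable]: "f \<in> borel_measurable borel" unfolding f_def by measurable
      have pt: "M v *\<^sub>R (?g2 v * cnj (e v)) = of_real (f v)" for v
      proof -
        have "?g2 v * cnj (e v) = of_real ((vel \<beta> \<sigma> v)\<^sup>2 * \<kappa> (v /\<^sub>R R)) * (e v * cnj (e v))"
          by (simp only: cut_vel_def cut_def of_real_mult power2_eq_square mult_ac)
        also have "e v * cnj (e v) = of_real ((cmod (e v))\<^sup>2)" by (simp only: complex_norm_square)
        finally show ?thesis by (simp only: f_def scaleR_conv_of_real of_real_mult mult.assoc)
      qed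
      have g2e: "(\<lambda>v. ?g2 v * cnj (e v)) \<in> borel_measurable borel" using meas(2) by measurable
      have "integrable N (\<lambda>v. ?g2 v * cnj (e v))" by (rule ip_integrable[OF g2(1) e_L2])
      then have "integrable lborel (\<lambda>v. complex_of_real (f v))" unfolding integrable_N[OF g2e] pt .
      then have f_int: "integrable lborel f" unfolding complex_of_real_integrable_eq .
      have "ip N ?g2 e = of_real (LINT v|lborel. f v)"
        unfolding ip_def integral_N[OF g2e] pt by simp
      then have cm: "cmod (ip N ?g2 e) = (LINT v|lborel. f v)"
        using I0 by simp
      have "ennreal (c0 * (C3 * E R)) = ennreal c0 * ennreal (C3 * E R)" using c0 C ER by (simp add: ennreal_mult)
      also have "\<dots> \<le> ennreal c0 * (\<integral>\<^sup>+v. ennreal ((v \<bullet> \<sigma>)\<^sup>2 * jb v powr (\<beta> - a - ?d)) * indicator (ball 0 R) v \<partial>lborel)"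
        by (intro mult_left_mono J3 s R) simp
      also have "\<dots> = (\<integral>\<^sup>+v. ennreal c0 * (ennreal ((v \<bullet> \<sigma>)\<^sup>2 * jb v powr (\<beta> - a - ?d)) * indicator (ball 0 R) v) \<partial>lborel)"
        by (rule nn_integral_cmult[symmetric]) measurable
      also have "\<dots> \<le> (\<integral>\<^sup>+v. ennreal (f v) \<partial>lborel)"
      proof (rule nn_integral_mono)
        fix v :: "real^'n"
        show "ennreal c0 * (ennreal ((v \<bullet> \<sigma>)\<^sup>2 * jb v powr (\<beta> - a - ?d)) * indicator (ball 0 R) v) \<le> ennreal (f v)"
        proof (cases "norm v < R")
          case True
          have "f v = (M v * (cmod (e v))\<^sup>2) * (vel \<beta> \<sigma> v)\<^sup>2" unfolding f_def c(3)[OF True] by simp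
          also have "\<dots> = c0 * ((v \<bullet> \<sigma>)\<^sup>2 * (jb v powr (- \<beta> - a - ?d) * (jb v powr \<beta> * jb v powr \<beta>)))"
            unfolding Me vel_def power_mult_distrib by (simp only: power2_eq_square mult_ac)
          also have "jb v powr (- \<beta> - a - ?d) * (jb v powr \<beta> * jb v powr \<beta>) = jb v powr ((- \<beta> - a - ?d) + (\<beta> + \<beta>))"
            by (simp only: powr_add)
          also have "(- \<beta> - a - ?d) + (\<beta> + \<beta>) = \<beta> - a - ?d" by simp
          finally have "f v = c0 * ((v \<bullet> \<sigma>)\<^sup>2 * jb v powr (\<beta> - a - ?d))" .
          then show ?thesis using True c0 by (simp add: ennreal_mult)
        qed simp
      qed
      also have "\<dots> = ennreal (LINT v|lborel. f v)"
        using f0 by (intro nn_integral_eq_integral f_int) auto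
      finally have "c0 * (C3 * E R) \<le> (LINT v|lborel. f v)"
        using I0 by (subst (asm) ennreal_le_iff) auto
      then show ?thesis using cm by simp
    qed
    have lower: "s0 * th \<eta> \<le> Re \<mu>"
    proof -
      have "\<eta> * (c0 * (C3 * E R)) \<le> \<eta> * cmod (ip N ?g2 e)" using low eta by (intro mult_left_mono) auto
      also have "\<dots> \<le> sqrt (Re \<mu>) * (sqrt (2 / lam) * (nrm N (T (\<lambda>v. e v * cut_vel \<beta> \<kappa> \<sigma> R v)) + \<eta> * nrm N ?g2) +
          2 * sqrt lam * nrm N (\<lambda>v. e v * cut_vel \<beta> \<kappa> \<sigma> R v))"
        by (rule mode_lower_bound[OF eta(1) s fm mu dom])
      also have "\<dots> \<le> sqrt (Re \<mu>) * (sqrt (2 / lam) * (B' * y + \<eta> * (R powr (1 + \<beta>) * sqrt (c0 * C2) * y)) +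
          2 * sqrt lam * (sqrt (c0 * C1) * y))"
      proof (intro mult_left_mono add_mono)
        show "nrm N (T (\<lambda>v. e v * cut_vel \<beta> \<kappa> \<sigma> R v)) \<le> B' * y"
          unfolding nrm_T_e_mult y_def by (rule Lv[OF s R(2)])
        show "nrm N (\<lambda>v. e v * cut_vel \<beta> \<kappa> \<sigma> R v) \<le> sqrt (c0 * C1) * y" unfolding g2_eq by (rule n1)
      qed (use n2 eta lam_pos re in auto)
      also have "\<dots> = sqrt (Re \<mu>) * ((sqrt (2 / lam) * (B' + (\<eta> * R powr (1 + \<beta>)) * sqrt (c0 * C2)) + 2 * sqrt lam * sqrt (c0 * C1)) * y)"
        by (simp add: algebra_simps)
      also have "\<dots> = sqrt (Re \<mu>) * ((C7 - 1) * y)" unfolding eta_R C7_def by simp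
      also have "\<dots> \<le> sqrt (Re \<mu>) * (C7 * y)" using y re by (intro mult_left_mono mult_right_mono) auto
      \<comment> \<open>One factor \<open>y\<close>, the root of \<open>E R\<close>, cancels;
        squaring what remains gives the order \<open>\<eta>\<^sup>2 * E R\<close>.\<close>
      finally have "(\<eta> * (c0 * C3) * y) * y \<le> (sqrt (Re \<mu>) * C7) * y"
        unfolding y(2)[symmetric] by (simp add: power2_eq_square mult_ac)
      then have "\<eta> * (c0 * C3) * y \<le> sqrt (Re \<mu>) * C7" using y(1) by (rule mult_right_le_imp_le)
      then have "(c0 * C3 / C7) * (\<eta> * y) \<le> sqrt (Re \<mu>)" using C7 by (simp add: field_simps)
      then have "((c0 * C3 / C7) * (\<eta> * y))\<^sup>2 \<le> (sqrt (Re \<mu>))\<^sup>2"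
        using c0 C C7 eta y by (intro power_mono) auto
      then have "(c0 * C3 / C7)\<^sup>2 * (\<eta>\<^sup>2 * E R) \<le> Re \<mu>"
        unfolding power_mult_distrib[of "c0 * C3 / C7"] power_mult_distrib[of \<eta>] y(2) real_sqrt_pow2[OF re] .
      moreover have "s0 * th \<eta> \<le> (c0 * C3 / C7)\<^sup>2 * (\<eta>\<^sup>2 * E R)"
        unfolding s0_def mult.assoc using t by (intro mult_left_mono) auto
      ultimately show ?thesis by linarith
    qed
    show ?thesis using lower upper ..
  qed
  show ?thesis using s0 s1 bounds by blast
qed

end

section \<open>Equilibria\<close>

text \<open>Positivity of the constant is not automatic, since a divergent or vanishing integral has
  value 0 and its inverse is 0 too. The normalisation of \<open>wgt\<close> excludes this.\<close>

lemma equilibrium_power_law: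
  fixes M :: "real^'n \<Rightarrow> real"
  assumes "equilibrium (ereal a) \<beta> K M"
  shows "\<exists>c>0. c = inverse (LINT u|lborel. jb (u::real^'n) powr (- real CARD('n) - a - \<beta>)) \<and>
    (\<forall>v. M v = c * jb v powr (- (real CARD('n) + a)))"
proof -
  define c where "c = inverse (LINT u|lborel. jb (u::real^'n) powr (- real CARD('n) - a - \<beta>))"
  have M: "M v = c * jb v powr (- (real CARD('n) + a))" for v
    using assms unfolding equilibrium_def c_def by auto
  have "c \<noteq> 0"
  proof
    assume "c = 0"
    then have "(LINT v|lborel. wgt \<beta> M v) = 0" by (simp add: wgt_def M)
    then show False using assms unfolding equilibrium_def by simp
  qed
  moreover have "c \<ge> 0" unfolding c_def by (simp add: integral_nonneg_AE)
  ultimately have "c > 0" by simp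
  then show ?thesis using M c_def by blast
qed

lemma equilibrium_cases:
  assumes "equilibrium \<alpha> \<beta> K M"
  obtains a where "\<alpha> = ereal a" | "\<alpha> = \<infinity>"
  using assms unfolding equilibrium_def by blast

lemma equilibrium_infinity:
  assumes "equilibrium \<infinity> \<beta> K M"
  shows "smooth M" "0 < M v" "norm u = norm v \<Longrightarrow> M u = M v" "M v \<le> \<bar>K p\<bar> * jb v powr - p"
proof -
  have not_real: "\<infinity> \<noteq> ereal a" for a by simp
  have *: "smooth M" "\<forall>v. 0 < M v" "\<forall>u v. norm u = norm v \<longrightarrow> M u = M v" "\<forall>p v. M v \<le> K p * jb v powr - p"
    using assms not_real unfolding equilibrium_def by blast+
  show "smooth M" "0 < M v" "norm u = norm v \<Longrightarrow> M u = M v" using * by blast+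
  have "M v \<le> K p * jb v powr - p" using * by blast
  also have "\<dots> \<le> \<bar>K p\<bar> * jb v powr - p" by (intro mult_right_mono) auto
  finally show "M v \<le> \<bar>K p\<bar> * jb v powr - p" .
qed

lemma equilibrium_imp_collision:
  assumes "equilibrium \<alpha> \<beta> K M" "weighted_coercivity \<beta> lam M D Dt L" "modes_well_posed \<beta> M Dt L" "lam > 0"
  shows "collision \<beta> lam M D Dt L"
proof
  have "M \<in> borel_measurable borel \<and> (\<forall>v. 0 < M v) \<and> (\<forall>u v. norm u = norm v \<longrightarrow> M u = M v)"
    using equilibrium_cases[OF assms(1)]
  proof cases
    case (1 a)
    obtain c where c: "c > 0" "\<And>v. M v = c * jb v powr (- (real CARD('a) + a))"
      using equilibrium_power_law assms(1) 1 by blast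
    have "M = (\<lambda>v. c * jb v powr (- (real CARD('a) + a)))" using c by auto
    moreover have "(\<lambda>v::real^'a. c * jb v powr (- (real CARD('a) + a))) \<in> borel_measurable borel" by measurable
    moreover have "0 < M v" for v using c jb_pos[of v] by simp
    moreover have "M u = M v" if "norm u = norm v" for u v using c that by (simp add: jb_def)
    ultimately show ?thesis by simp
  next
    case 2
    note inf = equilibrium_infinity[OF assms(1)[unfolded 2]]
    have "Ck 0 M" using inf(1) unfolding smooth_def by blast
    then have "M \<in> borel_measurable borel" by (intro borel_measurable_continuous_onI) simp
    then show ?thesis using inf(2,3) by blast
  qed
  then show "M \<in> borel_measurable borel" "0 < M v" "norm u = norm v \<Longrightarrow> M u = M v" for u v by blast+
  show "(LINT v|lborel. wgt \<beta> M v) = 1" using assms(1) unfolding equilibrium_def by blast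
qed (use assms in auto)

text \<open>\<open>W\<close> is found before \<open>M\<close>. A cutoff radius chosen from the tail
  of \<open>W\<close> is then uniform over all admissible equilibria.\<close>

lemma equilibrium_dominated:
  assumes "\<alpha> + ereal \<beta> > 0"
  shows "\<exists>W. integrable lborel W \<and> (\<forall>M::real^'n \<Rightarrow> real. equilibrium \<alpha> \<beta> K M \<longrightarrow> (\<forall>v. wgt \<beta> M v \<le> W v))"
proof (cases "\<alpha> = \<infinity>")
  case True
  let ?d = "real CARD('n)"
  let ?W = "\<lambda>v::real^'n. \<bar>K (?d + 1 - \<beta>)\<bar> * jb v powr (- 1 - ?d)"
  have "integrable lborel ?W" using integrable_jb_powr[of "- 1", where 'n = 'n] by simp
  moreover have "wgt \<beta> M v \<le> ?W v" if "equilibrium \<alpha> \<beta> K M" for M and v :: "real^'n"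
  proof -
    have "wgt \<beta> M v \<le> jb v powr - \<beta> * (\<bar>K (?d + 1 - \<beta>)\<bar> * jb v powr - (?d + 1 - \<beta>))"
      unfolding wgt_def by (intro mult_left_mono equilibrium_infinity(4)[OF that[unfolded True]]) simp
    also have "\<dots> = \<bar>K (?d + 1 - \<beta>)\<bar> * (jb v powr - \<beta> * jb v powr - (?d + 1 - \<beta>))" by (simp add: mult_ac)
    also have "jb v powr - \<beta> * jb v powr - (?d + 1 - \<beta>) = jb v powr (- 1 - ?d)" by (rule powr_mult_eq) simp
    finally show ?thesis .
  qed
  ultimately show ?thesis by blast
next
  case False
  then obtain a where a: "\<alpha> = ereal a" using assms by (cases \<alpha>) auto
  let ?d = "real CARD('n)"
  define c where "c = inverse (LINT u|lborel. jb (u::real^'n) powr (- ?d - a - \<beta>))"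
  let ?W = "\<lambda>v::real^'n. c * jb v powr (- (a + \<beta>) - ?d)"
  have "integrable lborel ?W" using integrable_jb_powr[of "- (a + \<beta>)", where 'n = 'n] assms a by simp
  moreover have "wgt \<beta> M v \<le> ?W v" if eq: "equilibrium \<alpha> \<beta> K M" for M and v :: "real^'n"
  proof -
    have "M v = c * jb v powr (- (?d + a))"
      using equilibrium_power_law[OF eq[unfolded a]] unfolding c_def by blast
    then have "wgt \<beta> M v = c * (jb v powr - \<beta> * jb v powr (- (?d + a)))" by (simp add: wgt_def mult_ac)
    also have "jb v powr - \<beta> * jb v powr (- (?d + a)) = jb v powr (- (a + \<beta>) - ?d)" by (rule powr_mult_eq) simp
    finally show ?thesis by simp
  qed
  ultimately show ?thesis by blast
qed

text \<open>The left side bounds \<open>M\<close> times the squared modulus of \<open>vel\<close>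
  times \<open>e\<close>; a negative \<open>s\<close> makes the right side integrable, so the
  velocity times \<open>e\<close> is square integrable in this regime.\<close>

lemma equilibrium_second_moment:
  fixes M :: "real^'n \<Rightarrow> real"
  assumes "equilibrium \<alpha> \<beta> K M" "\<alpha> > ereal (2 + \<beta>)"
  shows "\<exists>C\<ge>0. \<exists>s<0. \<forall>v. M v * jb v powr (2 + \<beta>) \<le> C * jb v powr (s - real CARD('n))"
  using equilibrium_cases[OF assms(1)]
proof cases
  case (1 a)
  obtain c where c: "c > 0" "\<And>v. M v = c * jb v powr (- (real CARD('n) + a))"
    using equilibrium_power_law assms(1) 1 by blast
  have "M v * jb v powr (2 + \<beta>) = c * jb v powr ((2 + \<beta> - a) - real CARD('n))" for v
  proof -
    have "jb v powr (- (real CARD('n) + a)) * jb v powr (2 + \<beta>) = jb v powr ((2 + \<beta> - a) - real CARD('n))"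
      by (rule powr_mult_eq) simp
    then show ?thesis by (simp add: c(2) mult.assoc)
  qed
  moreover have "2 + \<beta> - a < 0" using assms(2) 1 by simp
  ultimately show ?thesis using c(1) by (intro exI[of _ c] exI[of _ "2 + \<beta> - a"] conjI) auto
next
  case 2
  \<comment> \<open>After multiplication by the weight of exponent \<open>2 + \<beta>\<close> this
    leaves one power of decay beyond the dimension.\<close>
  let ?p = "real CARD('n) + 3 + \<beta>"
  have "M v * jb v powr (2 + \<beta>) \<le> \<bar>K ?p\<bar> * jb v powr (- 1 - real CARD('n))" for v
  proof -
    have "M v * jb v powr (2 + \<beta>) \<le> \<bar>K ?p\<bar> * jb v powr - ?p * jb v powr (2 + \<beta>)"
      by (intro mult_right_mono equilibrium_infinity(4)[OF assms(1)[unfolded 2]]) simp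
    also have "\<dots> = \<bar>K ?p\<bar> * (jb v powr - ?p * jb v powr (2 + \<beta>))" by (rule mult.assoc)
    also have "jb v powr - ?p * jb v powr (2 + \<beta>) = jb v powr (- 1 - real CARD('n))" by (rule powr_mult_eq) simp
    finally show ?thesis .
  qed
  then show ?thesis by (intro exI[of _ "\<bar>K ?p\<bar>"] exI[of _ "- 1"] conjI) auto
qed

text \<open>One exponent and one constant for both types of equilibrium, found before
  \<open>M\<close>, \<open>\<kappa>\<close> and \<open>L\<close>: half of
  \<open>\<alpha> + \<beta>\<close> if \<alpha> is finite, and any positive exponent, here 1,
  otherwise.\<close>

lemma large_velocity_cut_decay:
  assumes "\<alpha> + ereal \<beta> > 0"
  shows "\<exists>p>0. \<exists>A'\<ge>0. \<forall>(M::real^'n \<Rightarrow> real) \<kappa> Dt L. large_velocity \<alpha> \<beta> A B \<kappa> M Dt L \<longrightarrow>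
    (\<forall>R\<ge>1. wnorm M \<beta> (L (cut \<kappa> R)) \<le> A' * R powr - p)"
proof -
  obtain p where p: "p > 0" "\<And>(M::real^'n \<Rightarrow> real) \<kappa> Dt L R. large_velocity \<alpha> \<beta> A B \<kappa> M Dt L \<Longrightarrow> R \<ge> 1 \<Longrightarrow>
      wnorm M \<beta> (L (cut \<kappa> R)) \<le> A p * R powr - p"
  proof (cases "\<alpha> = \<infinity>")
    case True
    show ?thesis
    proof (rule that[of 1])
      fix M :: "real^'n \<Rightarrow> real" and \<kappa> Dt L and R :: real
      assume "large_velocity \<alpha> \<beta> A B \<kappa> M Dt L" "R \<ge> 1"
      then show "wnorm M \<beta> (L (cut \<kappa> R)) \<le> A 1 * R powr - 1"
        using True unfolding large_velocity_def by blast
    qed simp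
  next
    case False
    then obtain a where a: "\<alpha> = ereal a" using assms by (cases \<alpha>) auto
    show ?thesis by (rule that[of "(a + \<beta>) / 2"]) (use a assms in \<open>auto simp: large_velocity_def\<close>)
  qed
  have "wnorm M \<beta> (L (cut \<kappa> R)) \<le> \<bar>A p\<bar> * R powr - p"
    if "large_velocity \<alpha> \<beta> A B \<kappa> M Dt L" "R \<ge> 1" for M :: "real^'n \<Rightarrow> real" and \<kappa> Dt L R
    by (rule order_trans[OF p(2)[OF that]]) (intro mult_right_mono, auto)
  with p(1) show ?thesis by (intro exI[of _ p] conjI exI[of _ "\<bar>A p\<bar>"]) auto
qed

section \<open>The rate \<open>theta\<close> and the two-sided eigenvalue estimate\<close>

lemma theta_pos:
  assumes "0 < \<eta>" "\<eta> \<le> 1 / 2"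
  shows "0 < theta \<alpha> \<beta> \<eta>"
proof -
  have "\<bar>ln \<eta>\<bar> > 0" using assms by simp
  then have "\<eta>\<^sup>2 * \<bar>ln \<eta>\<bar> > 0" using assms by (intro mult_pos_pos) auto
  then show ?thesis using assms by (simp add: theta_def)
qed

text \<open>Adding 0 < \<alpha> + \<beta> and \<alpha> \<le> 2 + \<beta> gives 2 + 2 \<beta> > 0,
  which the exponent of the cutoff radius requires.\<close>

lemma exponent_range:
  assumes "\<alpha> + ereal \<beta> > 0" "\<not> \<alpha> > ereal (2 + \<beta>)"
  obtains a where "\<alpha> = ereal a" "a + \<beta> > 0" "a \<le> 2 + \<beta>" "1 + \<beta> > 0"
proof (cases \<alpha>)
  case (real a)
  then have "a + \<beta> > 0" "a \<le> 2 + \<beta>" using assms by auto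
  then show ?thesis using that real by simp
qed (use assms in auto)

lemma theta_tendsto_0:
  assumes "\<alpha> + ereal \<beta> > 0"
  shows "(theta \<alpha> \<beta> \<longlongrightarrow> 0) (at_right 0)"
proof (cases "\<alpha> > ereal (2 + \<beta>)")
  case True
  then have "theta \<alpha> \<beta> = (\<lambda>\<eta>. \<eta>\<^sup>2)" by (auto simp: theta_def)
  moreover have "((\<lambda>\<eta>::real. \<eta>\<^sup>2) \<longlongrightarrow> 0) (at_right 0)" by (auto intro!: tendsto_eq_intros)
  ultimately show ?thesis by simp
next
  case False
  then obtain a where a: "\<alpha> = ereal a" "a + \<beta> > 0" "a \<le> 2 + \<beta>" "1 + \<beta> > 0"
    using exponent_range assms by blast
  have id: "((\<lambda>\<eta>::real. \<eta>) \<longlongrightarrow> 0) (at_right 0)" by (rule tendsto_ident_at)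
  show ?thesis
  proof (cases "a = 2 + \<beta>")
    case True
    have ev: "\<forall>\<^sub>F \<eta> in at_right (0::real). 0 < \<eta> \<and> \<eta> < 1"
      by (rule eventually_at_right_less[THEN eventually_conj, OF eventually_at_right_real[of 0 1, THEN eventually_mono]]) auto
    have th: "theta \<alpha> \<beta> = (\<lambda>\<eta>. \<eta>\<^sup>2 * \<bar>ln \<eta>\<bar>)" using a True by (auto simp: theta_def)
    show ?thesis unfolding th
    proof (rule tendsto_sandwich[OF _ _ tendsto_const id])
      show "\<forall>\<^sub>F \<eta> in at_right (0::real). 0 \<le> \<eta>\<^sup>2 * \<bar>ln \<eta>\<bar>" by simp
      show "\<forall>\<^sub>F \<eta> in at_right (0::real). \<eta>\<^sup>2 * \<bar>ln \<eta>\<bar> \<le> \<eta>"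
        using ev
      proof eventually_elim
        case (elim \<eta>)
        \<comment> \<open>The logarithm of 1/\<eta> is at most 1/\<eta>, which costs one of the two
          powers of \<eta>.\<close>
        have "\<bar>ln \<eta>\<bar> = ln (1 / \<eta>)" using elim by (simp add: ln_div)
        also have "\<dots> \<le> 1 / \<eta>" using ln_le_minus_one[of "1 / \<eta>"] elim by simp
        finally have "\<eta>\<^sup>2 * \<bar>ln \<eta>\<bar> \<le> \<eta>\<^sup>2 * (1 / \<eta>)" by (intro mult_left_mono) auto
        also have "\<dots> = \<eta>" using elim by (simp add: power2_eq_square)
        finally show ?case .
      qed
    qed
  next
    case False
    have th: "theta \<alpha> \<beta> = (\<lambda>\<eta>. \<eta> powr ((a + \<beta>) / (1 + \<beta>)))" using a False by (auto simp: theta_def)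
    show ?thesis unfolding th
      by (rule tendsto_zero_powrI[OF id tendsto_const])
        (use a in \<open>auto intro!: eventually_at_right_less[THEN eventually_mono] less_imp_le\<close>)
  qed
qed

lemma eigenvalue_asymptotics:
  fixes M :: "real^'n \<Rightarrow> real"
  assumes ab: "\<alpha> + ereal \<beta> > 0" and eq: "equilibrium \<alpha> \<beta> K M"
    and coll: "collision \<beta> lam M D Dt L"
    and \<kappa>: "cutoff \<kappa>" and lv: "large_velocity \<alpha> \<beta> A B \<kappa> M Dt L"
  shows "\<exists>s0>0. \<exists>s1>0. \<forall>\<eta> \<sigma> \<phi> \<mu>. 0 < \<eta> \<and> \<eta> \<le> 1 / 2 \<and> norm \<sigma> = 1 \<and> fluid_mode \<beta> M Dt L \<eta> \<sigma> \<phi> \<mu> \<and>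
    cmod \<mu> < lam / 2 \<and> Im \<mu> = 0 \<longrightarrow> s0 * theta \<alpha> \<beta> \<eta> \<le> Re \<mu> \<and> Re \<mu> \<le> s1 * theta \<alpha> \<beta> \<eta>"
proof -
  interpret collision \<beta> lam M D Dt L by (rule coll)
  have Dt1: "\<And>R. R \<ge> 1 \<Longrightarrow> (\<lambda>v. e0 \<beta> v * cut \<kappa> R v) \<in> Dt"
    using lv unfolding large_velocity_def by blast
  show ?thesis
  proof (cases "\<alpha> > ereal (2 + \<beta>)")
    case True
    then have th: "theta \<alpha> \<beta> \<eta> = \<eta>\<^sup>2" for \<eta> by (simp add: theta_def)
    obtain C s where C: "C \<ge> 0" "s < 0" "\<And>v. M v * jb v powr (2 + \<beta>) \<le> C * jb v powr (s - real CARD('n))"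
      using equilibrium_second_moment[OF eq True] by blast
    define I where "I = (LINT v|lborel. jb (v::real^'n) powr (s - real CARD('n)))"
    have I: "I \<ge> 0" unfolding I_def by (rule Bochner_Integration.integral_nonneg) simp
    have J: "jint (s - real CARD('n)) (UNIV :: (real^'n) set) \<le> ennreal I"
      unfolding jint_def I_def using nn_integral_eq_integral[OF integrable_jb_powr[OF C(2), where 'n = 'n]] by simp
    have V: "(\<lambda>v. of_real (vel \<beta> \<sigma> v) * e v) \<in> L2 N \<and> nrm N (\<lambda>v. of_real (vel \<beta> \<sigma> v) * e v) \<le> sqrt (C * I)"
      if s: "norm \<sigma> = 1" for \<sigma>
    proof -
      have le: "M v * (cmod (of_real (vel \<beta> \<sigma> v) * e v))\<^sup>2 \<le> C * (jb v powr (s - real CARD('n)) * indicator UNIV v)" for v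
      proof -
        have "(vel \<beta> \<sigma> v)\<^sup>2 = \<bar>vel \<beta> \<sigma> v\<bar> * \<bar>vel \<beta> \<sigma> v\<bar>" by (simp add: power2_eq_square)
        also have "\<dots> \<le> jb v powr (1 + \<beta>) * jb v powr (1 + \<beta>)" by (intro mult_mono abs_vel_le s) auto
        also have "\<dots> = jb v powr (2 + 2 * \<beta>)" by (rule powr_mult_eq) simp
        finally have "(vel \<beta> \<sigma> v)\<^sup>2 * jb v powr - \<beta> \<le> jb v powr (2 + 2 * \<beta>) * jb v powr - \<beta>"
          by (rule mult_right_mono) simp
        also have "\<dots> = jb v powr (2 + \<beta>)" by (rule powr_mult_eq) simp
        finally have "M v * ((vel \<beta> \<sigma> v)\<^sup>2 * jb v powr - \<beta>) \<le> M v * jb v powr (2 + \<beta>)"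
          using M_pos[of v] by (intro mult_left_mono) auto
        then show ?thesis using C(3)[of v] by (simp add: norm_mult power_mult_distrib cmod_e_sq)
      qed
      have m: "(\<lambda>v. of_real (vel \<beta> \<sigma> v) * e v) \<in> borel_measurable borel" by measurable
      note mb = moment_bound[OF m _ le J C(1) I]
      show ?thesis using mb by (auto intro: real_le_rsqrt)
    qed
    obtain p A' where pA: "p > 0" "\<And>R. R \<ge> 1 \<Longrightarrow> wnorm M \<beta> (L (cut \<kappa> R)) \<le> A' * R powr - p"
      using large_velocity_cut_decay[OF ab, where A = A and B = B and 'n = 'n] lv by blast
    have up: "Re \<mu> \<le> 8 / lam * (1 + sqrt (C * I))\<^sup>2 * \<eta>\<^sup>2"
      if "0 < \<eta>" "norm \<sigma> = 1" "fluid_mode \<beta> M Dt L \<eta> \<sigma> \<phi> \<mu>" "cmod \<mu> < lam / 2" "Im \<mu> = 0" for \<eta> \<sigma> \<phi> \<mu>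
      by (rule mode_upper_bound_square[OF V \<kappa> Dt1 pA that])
    obtain s0 where s0: "s0 > 0" "\<And>\<eta> \<sigma> \<phi> \<mu>. 0 < \<eta> \<and> \<eta> < 1 \<and> norm \<sigma> = 1 \<and> fluid_mode \<beta> M Dt L \<eta> \<sigma> \<phi> \<mu> \<and>
      cmod \<mu> < lam / 2 \<and> Im \<mu> = 0 \<Longrightarrow> s0 * \<eta>\<^sup>2 \<le> Re \<mu>"
      using mode_lower_bound_square V by blast
    have "1 + sqrt (C * I) > 0" using C I by (intro add_pos_nonneg) auto
    then have s1: "8 / lam * (1 + sqrt (C * I))\<^sup>2 > 0"
      using lam_pos by (intro mult_pos_pos divide_pos_pos zero_less_power) auto
    show ?thesis unfolding th
    proof (rule exI[of _ s0], rule conjI[OF s0(1)], rule exI, rule conjI[OF s1], intro allI impI)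
      fix \<eta> \<sigma> \<phi> \<mu>
      assume *: "0 < \<eta> \<and> \<eta> \<le> 1 / 2 \<and> norm \<sigma> = 1 \<and> fluid_mode \<beta> M Dt L \<eta> \<sigma> \<phi> \<mu> \<and> cmod \<mu> < lam / 2 \<and> Im \<mu> = 0"
      then have "\<eta> < 1" by linarith
      then show "s0 * \<eta>\<^sup>2 \<le> Re \<mu> \<and> Re \<mu> \<le> 8 / lam * (1 + sqrt (C * I))\<^sup>2 * \<eta>\<^sup>2"
        using * s0(2)[of \<eta> \<sigma> \<phi> \<mu>] up[of \<eta> \<sigma> \<phi> \<mu>] by blast
    qed
  next
    case False
    then obtain a where a: "\<alpha> = ereal a" "a + \<beta> > 0" "a \<le> 2 + \<beta>" "1 + \<beta> > 0"
      using exponent_range ab by blast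
    obtain c0 where c0: "c0 > 0" and M_form: "\<And>v. M v = c0 * jb v powr (- (real CARD('n) + a))"
      using equilibrium_power_law eq a(1) by blast
    obtain R0 where R0: "\<And>R. R \<ge> R0 \<Longrightarrow> (LINT v|lborel. wgt \<beta> M v * indicator (- ball 0 R) v) \<le> 1 / 16"
      using integral_tail[OF wgt_integrable, of "1/16"] by auto
    define \<rho> where "\<rho> = max 2 R0"
    have \<rho>: "\<rho> \<ge> 2" and tail: "\<And>R. R \<ge> \<rho> \<Longrightarrow> (LINT v|lborel. wgt \<beta> M v * indicator (- ball 0 R) v) \<le> 1 / 16"
      using R0 unfolding \<rho>_def by auto
    have Lc: "wnorm M \<beta> (L (cut \<kappa> R)) \<le> \<bar>A ((a + \<beta>) / 2)\<bar> * R powr (- ((a + \<beta>) / 2))" if "R \<ge> 1" for R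
    proof -
      have "wnorm M \<beta> (L (cut \<kappa> R)) \<le> A ((a + \<beta>) / 2) * R powr (- ((a + \<beta>) / 2))"
        using lv a(1) that unfolding large_velocity_def by blast
      also have "\<dots> \<le> \<bar>A ((a + \<beta>) / 2)\<bar> * R powr (- ((a + \<beta>) / 2))" by (intro mult_right_mono) auto
      finally show ?thesis .
    qed
    obtain C2 where C2: "C2 > 0" "\<And>R. R \<ge> 1 \<Longrightarrow>
        jint ((4 + 3 * \<beta> - a) - real CARD('n)) (ball (0::real^'n) R) \<le> ennreal (C2 * R powr (4 + 3 * \<beta> - a))"
      using jint_ball_le_powr[of "4 + 3 * \<beta> - a", where 'n = 'n] a by auto
    have R_powr: "(\<rho> * \<eta> powr (- (1 / (1 + \<beta>)))) powr x = \<rho> powr x * \<eta> powr (- (x / (1 + \<beta>)))" if "0 < \<eta>" for \<eta> x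
      using \<rho> that by (simp add: powr_mult powr_powr)
    show ?thesis
    proof (cases "a = 2 + \<beta>")
      case False
      \<comment> \<open>The excess of the divergent second moment: it grows like
        \<open>R powr s\<close>.\<close>
      define s where "s = 2 + \<beta> - a"
      have s: "s > 0" using a(3) False by (simp add: s_def)
      have th: "theta \<alpha> \<beta> \<eta> = \<eta> powr ((a + \<beta>) / (1 + \<beta>))" for \<eta> using a False by (simp add: theta_def)
      obtain C1 where C1: "C1 > 0" "\<And>R. R \<ge> 1 \<Longrightarrow> jint (s - real CARD('n)) (ball (0::real^'n) R) \<le> ennreal (C1 * R powr s)"
        using jint_ball_le_powr[OF s, where 'n = 'n] by blast
      obtain C3 where C3: "C3 > 0" "\<And>(\<sigma>::real^'n) r. r \<ge> 1 \<Longrightarrow> norm \<sigma> = 1 \<Longrightarrow>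
        ennreal (C3 * r powr s) \<le> (\<integral>\<^sup>+v. ennreal ((v \<bullet> \<sigma>)\<^sup>2 * jb v powr (s - 2 - real CARD('n))) * indicator (ball 0 r - ball 0 (r / 2)) v \<partial>lborel)"
        using second_moment_annulus_ge[of s, where 'n = 'n] by blast
      have lv2: "(\<lambda>v. e0 \<beta> v * cut_vel \<beta> \<kappa> \<sigma> R v) \<in> Dt \<and> wnorm M \<beta> (L (cut_vel \<beta> \<kappa> \<sigma> R)) \<le> \<bar>B\<bar> * sqrt (R powr s)"
        if "norm \<sigma> = 1" "R \<ge> 2" for \<sigma> R
      proof -
        have "- \<beta> < a \<and> a < 2 + \<beta>" "R \<ge> 1" using a False that by auto
        then have *: "(\<lambda>v. e0 \<beta> v * cut_vel \<beta> \<kappa> \<sigma> R v) \<in> Dt"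
          "wnorm M \<beta> (L (cut_vel \<beta> \<kappa> \<sigma> R)) \<le> B * R powr (1 + \<beta> - (a + \<beta>) / 2)"
          using lv a(1) that(1) unfolding large_velocity_def by blast+
        have ex: "1 + \<beta> - (a + \<beta>) / 2 = s / 2" unfolding s_def by (simp add: field_simps)
        have "R powr (1 + \<beta> - (a + \<beta>) / 2) = sqrt (R powr s)"
          unfolding ex using that(2) by (simp add: powr_half_sqrt[symmetric] powr_powr)
        moreover have "B * sqrt (R powr s) \<le> \<bar>B\<bar> * sqrt (R powr s)" by (intro mult_right_mono) auto
        ultimately show ?thesis using * by auto
      qed
      show ?thesis unfolding th
      proof (rule mode_bounds_heavy_tail[where E = "\<lambda>R. R powr s" and a = a and \<rho> = \<rho> and ?c0.0 = c0
            and A' = "\<bar>A ((a + \<beta>) / 2)\<bar>" and B' = "\<bar>B\<bar>" and ?C1.0 = "C1 * 2 powr s" and ?C2.0 = "C2 * 2 powr (4 + 3 * \<beta> - a)"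
            and ?C3.0 = C3 and ?C4.0 = "\<rho> powr (- (a + \<beta>))" and ?C5.0 = "\<rho> powr s" and ?C6.0 = "\<rho> powr s" and \<kappa> = \<kappa>])
        show "(\<lambda>v. e0 \<beta> v * cut_vel \<beta> \<kappa> \<sigma> R v) \<in> Dt" "wnorm M \<beta> (L (cut_vel \<beta> \<kappa> \<sigma> R)) \<le> \<bar>B\<bar> * sqrt (R powr s)"
          if "norm \<sigma> = 1" "R \<ge> 2" for \<sigma> R
          using lv2[OF that] by auto
        fix R :: real assume R: "R \<ge> 2"
        show "0 < R powr s" using R by simp
        show "jint (2 + \<beta> - a - real CARD('n)) (ball (0::real^'n) (2 * R)) \<le> ennreal (C1 * 2 powr s * R powr s)"
          using C1(2)[of "2 * R"] R by (simp add: s_def powr_mult mult.assoc)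
        show "jint (4 + 3 * \<beta> - a - real CARD('n)) (ball (0::real^'n) (2 * R)) \<le>
            ennreal (C2 * 2 powr (4 + 3 * \<beta> - a) * ((R powr (1 + \<beta>))\<^sup>2 * R powr s))"
        proof -
          have "(R powr (1 + \<beta>))\<^sup>2 = R powr (2 + 2 * \<beta>)"
            unfolding power2_eq_square by (rule powr_mult_eq) simp
          moreover have "R powr (2 + 2 * \<beta>) * R powr s = R powr (4 + 3 * \<beta> - a)"
            by (rule powr_mult_eq) (simp add: s_def)
          ultimately show ?thesis using C2(2)[of "2 * R"] R by (simp add: powr_mult mult.assoc)
        qed
        fix \<sigma> :: "real^'n" assume \<sigma>: "norm \<sigma> = 1"
        have "ennreal (C3 * R powr s) \<le> (\<integral>\<^sup>+v. ennreal ((v \<bullet> \<sigma>)\<^sup>2 * jb v powr (s - 2 - real CARD('n))) * indicator (ball 0 R - ball 0 (R / 2)) v \<partial>lborel)"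
          using R \<sigma> by (intro C3(2)) auto
        also have "\<dots> \<le> (\<integral>\<^sup>+v. ennreal ((v \<bullet> \<sigma>)\<^sup>2 * jb v powr (s - 2 - real CARD('n))) * indicator (ball 0 R) v \<partial>lborel)"
          by (intro nn_integral_mono mult_left_mono) (auto simp: indicator_def)
        also have "s - 2 - real CARD('n) = \<beta> - a - real CARD('n)" by (simp add: s_def)
        finally show "ennreal (C3 * R powr s) \<le> (\<integral>\<^sup>+v. ennreal ((v \<bullet> \<sigma>)\<^sup>2 * jb v powr (\<beta> - a - real CARD('n))) * indicator (ball 0 R) v \<partial>lborel)" .
      next
        fix \<eta> :: real assume eta: "0 < \<eta>" "\<eta> \<le> 1 / 2"
        \<comment> \<open>Inserting the cutoff radius into \<open>\<eta>\<^sup>2 * R powr s\<close>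
          reproduces the exponent of \<open>theta\<close>.\<close>
        have "2 + - (s / (1 + \<beta>)) = (a + \<beta>) / (1 + \<beta>)" using a(4) by (simp add: s_def field_simps)
        then have "\<eta> powr 2 * \<eta> powr (- (s / (1 + \<beta>))) = \<eta> powr ((a + \<beta>) / (1 + \<beta>))" by (rule powr_mult_eq)
        then have "\<eta>\<^sup>2 * (\<rho> * \<eta> powr (- (1 / (1 + \<beta>)))) powr s = \<rho> powr s * \<eta> powr ((a + \<beta>) / (1 + \<beta>))"
          unfolding R_powr[OF eta(1)] using eta by (simp add: powr_numeral mult_ac)
        moreover have "(\<rho> * \<eta> powr (- (1 / (1 + \<beta>)))) powr (- (a + \<beta>)) = \<rho> powr (- (a + \<beta>)) * \<eta> powr ((a + \<beta>) / (1 + \<beta>))"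
        proof -
          have "- (- (a + \<beta>) / (1 + \<beta>)) = (a + \<beta>) / (1 + \<beta>)" by (simp only: minus_divide_left[symmetric] minus_minus)
          then show ?thesis unfolding R_powr[OF eta(1)] by (simp only:)
        qed
        ultimately show "(\<rho> * \<eta> powr (- (1 / (1 + \<beta>)))) powr (- (a + \<beta>)) \<le> \<rho> powr (- (a + \<beta>)) * \<eta> powr ((a + \<beta>) / (1 + \<beta>)) \<and>
          \<eta>\<^sup>2 * (\<rho> * \<eta> powr (- (1 / (1 + \<beta>)))) powr s \<le> \<rho> powr s * \<eta> powr ((a + \<beta>) / (1 + \<beta>)) \<and>
          \<rho> powr s * \<eta> powr ((a + \<beta>) / (1 + \<beta>)) \<le> \<eta>\<^sup>2 * (\<rho> * \<eta> powr (- (1 / (1 + \<beta>)))) powr s \<and>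
          0 \<le> \<eta> powr ((a + \<beta>) / (1 + \<beta>))"
          by simp
      qed (use a \<rho> M_form c0 \<kappa> Dt1 Lc tail C1 C2 C3 in auto)
    next
      case True
      have th: "theta \<alpha> \<beta> \<eta> = \<eta>\<^sup>2 * \<bar>ln \<eta>\<bar>" for \<eta> using a True by (simp add: theta_def)
      obtain C1 where C1: "C1 > 0" "\<And>R. R \<ge> 2 \<Longrightarrow> jint (- real CARD('n)) (ball (0::real^'n) R) \<le> ennreal (C1 * ln R)"
        using jint_ball_le_ln[where 'n = 'n] by blast
      obtain C3 where C3: "C3 > 0" "\<And>(\<sigma>::real^'n) R. R \<ge> 2 \<Longrightarrow> norm \<sigma> = 1 \<Longrightarrow>
        ennreal (C3 * ln R) \<le> (\<integral>\<^sup>+v. ennreal ((v \<bullet> \<sigma>)\<^sup>2 * jb v powr (- 2 - real CARD('n))) * indicator (ball 0 R) v \<partial>lborel)"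
        using second_moment_ge_ln[where 'n = 'n] by blast
      have lv2: "(\<lambda>v. e0 \<beta> v * cut_vel \<beta> \<kappa> \<sigma> R v) \<in> Dt \<and> wnorm M \<beta> (L (cut_vel \<beta> \<kappa> \<sigma> R)) \<le> \<bar>B\<bar> * sqrt (ln R)"
        if "norm \<sigma> = 1" "R \<ge> 2" for \<sigma> R
      proof -
        have *: "(\<lambda>v. e0 \<beta> v * cut_vel \<beta> \<kappa> \<sigma> R v) \<in> Dt" "wnorm M \<beta> (L (cut_vel \<beta> \<kappa> \<sigma> R)) \<le> B * sqrt (ln R)"
          using lv a(1) True that unfolding large_velocity_def by blast+
        moreover have "B * sqrt (ln R) \<le> \<bar>B\<bar> * sqrt (ln R)" using that(2) by (intro mult_right_mono) auto
        ultimately show ?thesis by auto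
      qed
      have ln2: "ln R \<ge> ln 2" if "R \<ge> 2" for R :: real using that by simp
      have ln2p: "ln (2::real) > 0" by simp
      show ?thesis unfolding th
      proof (rule mode_bounds_heavy_tail[where E = ln and a = a and \<rho> = \<rho> and ?c0.0 = c0
            and A' = "\<bar>A ((a + \<beta>) / 2)\<bar>" and B' = "\<bar>B\<bar>" and ?C1.0 = "C1 * 2" and ?C2.0 = "C2 * 2 powr (4 + 3 * \<beta> - a) / ln 2"
            and ?C3.0 = C3 and ?C4.0 = "\<rho> powr (- (a + \<beta>)) / ln 2" and ?C5.0 = "ln \<rho> / ln 2 + 1 / (1 + \<beta>)"
            and ?C6.0 = "1 / (1 + \<beta>)" and \<kappa> = \<kappa>])
        show "(\<lambda>v. e0 \<beta> v * cut_vel \<beta> \<kappa> \<sigma> R v) \<in> Dt" "wnorm M \<beta> (L (cut_vel \<beta> \<kappa> \<sigma> R)) \<le> \<bar>B\<bar> * sqrt (ln R)"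
          if "norm \<sigma> = 1" "R \<ge> 2" for \<sigma> R
          using lv2[OF that] by auto
        fix R :: real assume R: "R \<ge> 2"
        show "0 < ln R" using R by simp
        show "jint (2 + \<beta> - a - real CARD('n)) (ball (0::real^'n) (2 * R)) \<le> ennreal (C1 * 2 * ln R)"
        proof -
          \<comment> \<open>The support of the cutoff reaches \<open>2 * R\<close>; for
            \<open>R \<ge> 2\<close> the doubling is absorbed by a factor 2.\<close>
          have "ln (2 * R) \<le> 2 * ln R" using ln2[OF R] R by (simp add: ln_mult)
          then have "C1 * ln (2 * R) \<le> C1 * 2 * ln R" using C1(1) by simp
          then show ?thesis using C1(2)[of "2 * R"] R True by (simp add: order_trans[OF _ ennreal_leI])
        qed
        show "jint (4 + 3 * \<beta> - a - real CARD('n)) (ball (0::real^'n) (2 * R)) \<le>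
            ennreal (C2 * 2 powr (4 + 3 * \<beta> - a) / ln 2 * ((R powr (1 + \<beta>))\<^sup>2 * ln R))"
        proof -
          \<comment> \<open>At the critical exponent the fourth moment grows like a pure power; the
            factor \<open>ln R\<close> is inserted at the price of dividing by
            \<open>ln 2\<close>.\<close>
          have sq: "(R powr (1 + \<beta>))\<^sup>2 = R powr (4 + 3 * \<beta> - a)"
            unfolding power2_eq_square by (rule powr_mult_eq) (simp add: True)
          have "C2 * (2 * R) powr (4 + 3 * \<beta> - a) = C2 * 2 powr (4 + 3 * \<beta> - a) / ln 2 * ((R powr (1 + \<beta>))\<^sup>2 * ln 2)"
            unfolding sq using R ln2p by (simp add: powr_mult)
          also have "\<dots> \<le> C2 * 2 powr (4 + 3 * \<beta> - a) / ln 2 * ((R powr (1 + \<beta>))\<^sup>2 * ln R)"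
            using C2(1) ln2[OF R] ln2p by (intro mult_left_mono) auto
          finally have "ennreal (C2 * (2 * R) powr (4 + 3 * \<beta> - a)) \<le>
              ennreal (C2 * 2 powr (4 + 3 * \<beta> - a) / ln 2 * ((R powr (1 + \<beta>))\<^sup>2 * ln R))" by (rule ennreal_leI)
          moreover have "1 \<le> 2 * R" using R by simp
          ultimately show ?thesis using C2(2)[of "2 * R"] order_trans by blast
        qed
        fix \<sigma> :: "real^'n" assume \<sigma>: "norm \<sigma> = 1"
        have "- 2 - real CARD('n) = \<beta> - a - real CARD('n)" using True by simp
        then show "ennreal (C3 * ln R) \<le> (\<integral>\<^sup>+v. ennreal ((v \<bullet> \<sigma>)\<^sup>2 * jb v powr (\<beta> - a - real CARD('n))) * indicator (ball 0 R) v \<partial>lborel)"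
          using C3(2)[OF R \<sigma>] by simp
      next
        fix \<eta> :: real assume eta: "0 < \<eta>" "\<eta> \<le> 1 / 2"
        have neg: "ln \<eta> \<le> - ln 2"
        proof -
          have "ln \<eta> \<le> ln (1 / 2)" using eta by (subst ln_le_cancel_iff) auto
          then show ?thesis by (simp add: ln_div)
        qed
        then have l: "ln 2 \<le> \<bar>ln \<eta>\<bar>" "\<bar>ln \<eta>\<bar> = - ln \<eta>" using ln2p by linarith+
        have lnR: "ln (\<rho> * \<eta> powr (- (1 / (1 + \<beta>)))) = ln \<rho> + 1 / (1 + \<beta>) * \<bar>ln \<eta>\<bar>"
          using \<rho> eta l(2) by (simp add: ln_mult ln_powr)
        have "ln \<rho> * ln 2 \<le> ln \<rho> * \<bar>ln \<eta>\<bar>" using \<rho> l by (intro mult_left_mono) auto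
        then have "ln \<rho> \<le> ln \<rho> / ln 2 * \<bar>ln \<eta>\<bar>" using ln2p by (simp add: field_simps)
        then have u: "\<eta>\<^sup>2 * ln (\<rho> * \<eta> powr (- (1 / (1 + \<beta>)))) \<le> (ln \<rho> / ln 2 + 1 / (1 + \<beta>)) * (\<eta>\<^sup>2 * \<bar>ln \<eta>\<bar>)"
          unfolding lnR mult.left_commute[of _ "\<eta>\<^sup>2"] by (intro mult_left_mono) (auto simp: distrib_right)
        have lo: "1 / (1 + \<beta>) * (\<eta>\<^sup>2 * \<bar>ln \<eta>\<bar>) \<le> \<eta>\<^sup>2 * ln (\<rho> * \<eta> powr (- (1 / (1 + \<beta>))))"
          unfolding lnR mult.left_commute[of _ "\<eta>\<^sup>2"] using \<rho> by (intro mult_left_mono) auto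
        \<comment> \<open>The collision term contributes only the order of
          \<open>\<eta>\<^sup>2\<close>, dominated by \<open>theta\<close> because
          \<open>\<bar>ln \<eta>\<bar>\<close> is at least \<open>ln 2\<close>.\<close>
        have "(\<rho> * \<eta> powr (- (1 / (1 + \<beta>)))) powr (- (a + \<beta>)) = \<rho> powr (- (a + \<beta>)) * \<eta> powr 2"
        proof -
          have "- (- (a + \<beta>) / (1 + \<beta>)) = 2" using a(4) by (simp add: True field_simps)
          then show ?thesis unfolding R_powr[OF eta(1)] by simp
        qed
        also have "\<dots> = \<rho> powr (- (a + \<beta>)) / ln 2 * (\<eta>\<^sup>2 * ln 2)" using eta ln2p by (simp add: powr_numeral)
        also have "\<dots> \<le> \<rho> powr (- (a + \<beta>)) / ln 2 * (\<eta>\<^sup>2 * \<bar>ln \<eta>\<bar>)"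
          using l ln2p by (intro mult_left_mono) auto
        finally show "(\<rho> * \<eta> powr (- (1 / (1 + \<beta>)))) powr (- (a + \<beta>)) \<le> \<rho> powr (- (a + \<beta>)) / ln 2 * (\<eta>\<^sup>2 * \<bar>ln \<eta>\<bar>) \<and>
          \<eta>\<^sup>2 * ln (\<rho> * \<eta> powr (- (1 / (1 + \<beta>)))) \<le> (ln \<rho> / ln 2 + 1 / (1 + \<beta>)) * (\<eta>\<^sup>2 * \<bar>ln \<eta>\<bar>) \<and>
          1 / (1 + \<beta>) * (\<eta>\<^sup>2 * \<bar>ln \<eta>\<bar>) \<le> \<eta>\<^sup>2 * ln (\<rho> * \<eta> powr (- (1 / (1 + \<beta>)))) \<and>
          0 \<le> \<eta>\<^sup>2 * \<bar>ln \<eta>\<bar>"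
          using u lo by simp
      qed (use a \<rho> M_form c0 \<kappa> Dt1 Lc tail C1 C2 C3 ln2p in auto)
    qed
  qed
qed

text \<open>That the thresholds are explicit in the constants is rendered by the order of
  quantifiers: \<open>\<eta>0\<close> and \<open>r0\<close> are fixed before \<open>M\<close>,
  \<open>\<kappa>\<close>, the domains and \<open>L\<close>. The branch is a pair of functions of
  \<open>\<eta>\<close> and \<open>\<sigma>\<close>, so its limits at 0 can be stated for each
  direction.\<close>

theorem lemma1p1:
  fixes \<alpha> :: ereal and \<beta> lam B :: real and K A :: "real \<Rightarrow> real"
  assumes "\<alpha> + ereal \<beta> > 0" and "lam > 0"
  shows "\<exists>\<eta>0>0. \<exists>r0. 0 < r0 \<and> r0 < lam \<and>
    (\<forall>(M :: real^'n \<Rightarrow> real) \<kappa> D Dt L.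
       equilibrium \<alpha> \<beta> K M \<and> weighted_coercivity \<beta> lam M D Dt L \<and>
       cutoff \<kappa> \<and> large_velocity \<alpha> \<beta> A B \<kappa> M Dt L \<and> modes_well_posed \<beta> M Dt L \<longrightarrow>
       (\<exists>(\<phi> :: real \<Rightarrow> real^'n \<Rightarrow> real^'n \<Rightarrow> complex) (\<mu> :: real \<Rightarrow> real^'n \<Rightarrow> complex).
          (\<forall>\<eta>\<in>{0<..<\<eta>0}. \<forall>\<sigma>. norm \<sigma> = 1 \<longrightarrow>
             \<mu> \<eta> \<sigma> \<in> ball 0 r0 \<and> fluid_mode \<beta> M Dt L \<eta> \<sigma> (\<phi> \<eta> \<sigma>) (\<mu> \<eta> \<sigma>) \<and>
             (\<forall>\<phi>' \<mu>'. \<mu>' \<in> ball 0 r0 \<and> fluid_mode \<beta> M Dt L \<eta> \<sigma> \<phi>' \<mu>' \<longrightarrow>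
                \<mu>' = \<mu> \<eta> \<sigma> \<and> (AE v in lborel. \<phi>' v = \<phi> \<eta> \<sigma> v)) \<and>
             Im (\<mu> \<eta> \<sigma>) = 0 \<and> Re (\<mu> \<eta> \<sigma>) > 0) \<and>
          (\<forall>\<sigma>. norm \<sigma> = 1 \<longrightarrow>
             ((\<lambda>\<eta>. \<mu> \<eta> \<sigma>) \<longlongrightarrow> 0) (at_right 0) \<and>
             ((\<lambda>\<eta>. wnorm M (-\<beta>) (\<lambda>v. \<phi> \<eta> \<sigma> v - 1)) \<longlongrightarrow> 0) (at_right 0)) \<and>
          (\<exists>c>0. \<exists>s0>0. \<exists>s1>s0. \<forall>\<eta>\<in>{0<..<\<eta>0}. \<forall>\<sigma>. norm \<sigma> = 1 \<longrightarrow>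
             wnorm M (-\<beta>) (\<lambda>v. \<phi> \<eta> \<sigma> v - 1) \<le> c * sqrt (Re (\<mu> \<eta> \<sigma>)) \<and>
             s0 * theta \<alpha> \<beta> \<eta> < Re (\<mu> \<eta> \<sigma>) \<and> Re (\<mu> \<eta> \<sigma>) < s1 * theta \<alpha> \<beta> \<eta>)))"
proof -
  obtain W where W: "integrable lborel W"
    "\<forall>M::real^'n \<Rightarrow> real. equilibrium \<alpha> \<beta> K M \<longrightarrow> (\<forall>v. wgt \<beta> M v \<le> W v)"
    using equilibrium_dominated[OF assms(1), where K = K and 'n = 'n] by (elim exE conjE)
  obtain p A' where pA: "p > 0" "\<forall>(M::real^'n \<Rightarrow> real) \<kappa> Dt L. large_velocity \<alpha> \<beta> A B \<kappa> M Dt L \<longrightarrow>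
      (\<forall>R\<ge>1. wnorm M \<beta> (L (cut \<kappa> R)) \<le> A' * R powr - p)"
    using large_velocity_cut_decay[OF assms(1), where A = A and B = B and 'n = 'n] by (elim exE conjE)
  define \<epsilon> where "\<epsilon> = lam / (8 + 16 * lam)"
  have \<epsilon>: "\<epsilon> > 0" unfolding \<epsilon>_def using assms(2) by simp
  obtain R0 where R0: "R0 \<ge> 1" "\<And>R. R \<ge> R0 \<Longrightarrow> (LINT v|lborel. W v * indicator (- ball 0 R) v) \<le> \<epsilon>\<^sup>2"
    using integral_tail[OF W(1), of "\<epsilon>\<^sup>2"] \<epsilon> by auto
  have "((\<lambda>R. A' * R powr - p) \<longlongrightarrow> A' * 0) at_top"
    by (intro tendsto_mult tendsto_const tendsto_neg_powr filterlim_ident) (use pA(1) in simp)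
  then have "\<forall>\<^sub>F R in at_top. A' * R powr - p < \<epsilon> / 2" by (rule order_tendstoD(2)) (use \<epsilon> in simp)
  then have "\<forall>\<^sub>F R in at_top. A' * R powr - p < \<epsilon> / 2 \<and> R \<ge> R0" using eventually_ge_at_top by (rule eventually_conj)
  then obtain R where R: "A' * R powr - p < \<epsilon> / 2" "R \<ge> R0" unfolding eventually_at_top_linorder by blast
  have R1: "R \<ge> 1" using R R0 by linarith
  define Q where "Q = (1 + 2 * R) powr \<bar>1 + \<beta>\<bar>"
  have Q: "Q > 0" unfolding Q_def using R1 by simp
  \<comment> \<open>Half of \<open>\<epsilon>\<close> is spent on the collision term, through
    \<open>R\<close>, and half on advection, through \<open>Q\<close>. The bound 1/2 keeps
    \<open>ln \<eta>\<close> away from 0, as \<open>theta\<close> requires in the critical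
    case.\<close>
  define \<eta>0 where "\<eta>0 = min (1 / 2) (\<epsilon> / (2 * Q))"
  have \<eta>0: "\<eta>0 > 0" "\<eta>0 \<le> 1 / 2" unfolding \<eta>0_def using \<epsilon> Q by auto
  have \<eta>Q: "\<eta> * Q \<le> \<epsilon> / 2" if "\<eta> < \<eta>0" for \<eta>
  proof -
    have "\<eta> * Q \<le> \<epsilon> / (2 * Q) * Q" using that Q unfolding \<eta>0_def by (intro mult_right_mono) auto
    then show ?thesis using Q by simp
  qed
  show ?thesis
  proof (rule exI[of _ \<eta>0], rule conjI[OF \<eta>0(1)], rule exI[of _ "lam / 2"], intro conjI allI impI)
    show "0 < lam / 2" "lam / 2 < lam" using assms(2) by auto
  next
    fix M :: "real^'n \<Rightarrow> real" and \<kappa> D Dt L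
    assume hyp: "equilibrium \<alpha> \<beta> K M \<and> weighted_coercivity \<beta> lam M D Dt L \<and>
       cutoff \<kappa> \<and> large_velocity \<alpha> \<beta> A B \<kappa> M Dt L \<and> modes_well_posed \<beta> M Dt L"
    then have eq: "equilibrium \<alpha> \<beta> K M" and \<kappa>: "cutoff \<kappa>" and lv: "large_velocity \<alpha> \<beta> A B \<kappa> M Dt L"
      and coll: "collision \<beta> lam M D Dt L"
      using equilibrium_imp_collision assms(2) by blast+
    interpret collision \<beta> lam M D Dt L by (rule coll)
    let ?sol = "\<lambda>\<eta> \<sigma> \<phi> \<mu>. \<mu> \<in> ball 0 (lam / 2) \<and> fluid_mode \<beta> M Dt L \<eta> \<sigma> \<phi> \<mu> \<and>
        (\<forall>\<phi>' \<mu>'. \<mu>' \<in> ball 0 (lam / 2) \<and> fluid_mode \<beta> M Dt L \<eta> \<sigma> \<phi>' \<mu>' \<longrightarrow>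
          \<mu>' = \<mu> \<and> (AE v in lborel. \<phi>' v = \<phi> v))"
    have ex: "\<exists>\<phi> \<mu>. ?sol \<eta> \<sigma> \<phi> \<mu>" if eta: "0 < \<eta>" "\<eta> < \<eta>0" and s: "norm \<sigma> = 1" for \<eta> \<sigma>
    proof -
      let ?g = "\<lambda>v. e v * cut \<kappa> R v"
      have g: "?g \<in> Dt" using lv R1 unfolding large_velocity_def by blast
      note t = cut_test_function[OF \<kappa> R1 s g]
      have "(LINT v|lborel. wgt \<beta> M v * indicator (- ball 0 R) v) \<le> (LINT v|lborel. W v * indicator (- ball 0 R) v)"
      proof (rule integral_mono)
        show "integrable lborel (\<lambda>v. wgt \<beta> M v * indicator (- ball 0 R) v)"
          using integrable_mult_indicator[OF _ wgt_integrable, of "- ball 0 R"] by (simp add: mult.commute)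
        show "integrable lborel (\<lambda>v. W v * indicator (- ball 0 R) v)"
          using integrable_mult_indicator[OF _ W(1), of "- ball 0 R"] by (simp add: mult.commute)
      qed (intro mult_right_mono W(2)[rule_format, OF eq], simp)
      also have "\<dots> \<le> \<epsilon>\<^sup>2" by (rule R0(2)[OF R(2)])
      finally have "(nrm N (\<lambda>v. ?g v - e v))\<^sup>2 \<le> \<epsilon>\<^sup>2" using t(4) by linarith
      then have g1: "nrm N (\<lambda>v. ?g v - e v) \<le> \<epsilon>" by (rule power2_le_imp_le) (use \<epsilon> in simp)
      have "nrm N (L_adv \<beta> L \<eta> \<sigma> ?g) \<le> nrm N (T ?g) + \<eta> * nrm N (\<lambda>v. of_real (vel \<beta> \<sigma> v) * ?g v)"
        using nrm_L_adv_le[OF t(2)] eta by simp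
      also have "\<dots> \<le> \<epsilon> / 2 + \<eta> * Q"
      proof (intro add_mono mult_left_mono)
        show "nrm N (T ?g) \<le> \<epsilon> / 2"
          unfolding nrm_T_e_mult using pA(2)[rule_format, OF lv R1] R(1) by linarith
        show "nrm N (\<lambda>v. of_real (vel \<beta> \<sigma> v) * ?g v) \<le> Q" unfolding Q_def by (rule t(3))
      qed (use eta in simp)
      finally have g2: "nrm N (L_adv \<beta> L \<eta> \<sigma> ?g) \<le> \<epsilon>" using \<eta>Q[OF eta(2)] by linarith
      show ?thesis by (rule mode_exists_unique[OF eta(1) s t(2) g1[unfolded \<epsilon>_def] g2[unfolded \<epsilon>_def]])
    qed
    \<comment> \<open>The pair is chosen as a whole, so that mode and eigenvalue belong
      together.\<close>
    define F where "F \<eta> \<sigma> = (SOME q. ?sol \<eta> \<sigma> (fst q) (snd q))" for \<eta> \<sigma>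
    define \<phi> where "\<phi> \<eta> \<sigma> = fst (F \<eta> \<sigma>)" for \<eta> \<sigma>
    define \<mu> where "\<mu> \<eta> \<sigma> = snd (F \<eta> \<sigma>)" for \<eta> \<sigma>
    have sol: "?sol \<eta> \<sigma> (\<phi> \<eta> \<sigma>) (\<mu> \<eta> \<sigma>)" if h: "0 < \<eta>" "\<eta> < \<eta>0" "norm \<sigma> = 1" for \<eta> \<sigma>
    proof -
      obtain \<phi>1 \<mu>1 where "?sol \<eta> \<sigma> \<phi>1 \<mu>1" using ex[OF h] by (elim exE)
      then have "?sol \<eta> \<sigma> (fst (\<phi>1, \<mu>1)) (snd (\<phi>1, \<mu>1))" unfolding fst_conv snd_conv .
      then show ?thesis unfolding \<phi>_def \<mu>_def F_def by (rule someI)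
    qed
    have mu_ball: "cmod (\<mu> \<eta> \<sigma>) < lam / 2" and fm: "fluid_mode \<beta> M Dt L \<eta> \<sigma> (\<phi> \<eta> \<sigma>) (\<mu> \<eta> \<sigma>)"
      and uniq: "\<And>\<phi>' \<mu>'. cmod \<mu>' < lam / 2 \<Longrightarrow> fluid_mode \<beta> M Dt L \<eta> \<sigma> \<phi>' \<mu>' \<Longrightarrow> \<mu>' = \<mu> \<eta> \<sigma>"
      if "0 < \<eta>" "\<eta> < \<eta>0" "norm \<sigma> = 1" for \<eta> \<sigma>
      using sol[OF that] by simp_all
    have real: "Im (\<mu> \<eta> \<sigma>) = 0" if eta: "0 < \<eta>" "\<eta> < \<eta>0" and s: "norm \<sigma> = 1" for \<eta> \<sigma>
    proof -
      have "norm (- \<sigma>) = 1" using s by simp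
      then obtain P where P: "rotation P" "P \<sigma> = - \<sigma>" using rotation_exists_unit[OF s] by blast
      \<comment> \<open>The conjugate mode belongs to the opposite direction; a rotation brings it
        back to \<open>\<sigma>\<close>, where uniqueness identifies the two eigenvalues.\<close>
      have "fluid_mode \<beta> M Dt L \<eta> \<sigma> ((\<lambda>v. cnj (\<phi> \<eta> \<sigma> v)) \<circ> P) (cnj (\<mu> \<eta> \<sigma>))"
        by (rule fluid_mode_rotate[OF fluid_mode_cnj[OF fm[OF eta s]] P])
      then have "cnj (\<mu> \<eta> \<sigma>) = \<mu> \<eta> \<sigma>" using mu_ball[OF eta s] by (intro uniq[OF eta s]) auto
      then show ?thesis by (simp add: complex_eq_iff)
    qed
    obtain s0 s1 where s01: "s0 > 0" "s1 > 0" and asym: "\<And>\<eta> \<sigma> \<phi> \<mu>. 0 < \<eta> \<and> \<eta> \<le> 1 / 2 \<and> norm \<sigma> = 1 \<and>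
        fluid_mode \<beta> M Dt L \<eta> \<sigma> \<phi> \<mu> \<and> cmod \<mu> < lam / 2 \<and> Im \<mu> = 0 \<Longrightarrow>
        s0 * theta \<alpha> \<beta> \<eta> \<le> Re \<mu> \<and> Re \<mu> \<le> s1 * theta \<alpha> \<beta> \<eta>"
      using eigenvalue_asymptotics[OF assms(1) eq coll \<kappa> lv] by blast
    have b: "s0 * theta \<alpha> \<beta> \<eta> \<le> Re (\<mu> \<eta> \<sigma>)" "Re (\<mu> \<eta> \<sigma>) \<le> s1 * theta \<alpha> \<beta> \<eta>" "0 < theta \<alpha> \<beta> \<eta>"
      if eta: "0 < \<eta>" "\<eta> < \<eta>0" and s: "norm \<sigma> = 1" for \<eta> \<sigma>
    proof -
      have "\<eta> \<le> 1 / 2" using eta \<eta>0 by linarith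
      then show "s0 * theta \<alpha> \<beta> \<eta> \<le> Re (\<mu> \<eta> \<sigma>)" "Re (\<mu> \<eta> \<sigma>) \<le> s1 * theta \<alpha> \<beta> \<eta>" "0 < theta \<alpha> \<beta> \<eta>"
        using asym[of \<eta> \<sigma> "\<phi> \<eta> \<sigma>" "\<mu> \<eta> \<sigma>"] theta_pos[OF eta(1)] eta s fm[OF eta s] mu_ball[OF eta s] real[OF eta s]
        by auto
    qed
    have pos: "Re (\<mu> \<eta> \<sigma>) > 0" if "0 < \<eta>" "\<eta> < \<eta>0" "norm \<sigma> = 1" for \<eta> \<sigma>
      using less_le_trans[OF mult_pos_pos[OF s01(1) b(3)[OF that]] b(1)[OF that]] .
    define c where "c = sqrt (2 / lam)"
    have c: "c > 0" unfolding c_def using assms(2) by simp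
    have wn: "wnorm M (-\<beta>) (\<lambda>v. \<phi> \<eta> \<sigma> v - 1) \<le> c * sqrt (Re (\<mu> \<eta> \<sigma>))"
      if "0 < \<eta>" "\<eta> < \<eta>0" "norm \<sigma> = 1" for \<eta> \<sigma>
      unfolding c_def by (rule mode_bounds(2)[OF that(1,3) fm[OF that] mu_ball[OF that]])
    have near: "\<forall>\<^sub>F \<eta> in at_right 0. 0 < \<eta> \<and> \<eta> < \<eta>0"
      unfolding eventually_at_right_field using \<eta>0(1) by blast
    note th0 = theta_tendsto_0[OF assms(1)]
    show "\<exists>(\<phi> :: real \<Rightarrow> real^'n \<Rightarrow> real^'n \<Rightarrow> complex) (\<mu> :: real \<Rightarrow> real^'n \<Rightarrow> complex).
          (\<forall>\<eta>\<in>{0<..<\<eta>0}. \<forall>\<sigma>. norm \<sigma> = 1 \<longrightarrow>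
             \<mu> \<eta> \<sigma> \<in> ball 0 (lam / 2) \<and> fluid_mode \<beta> M Dt L \<eta> \<sigma> (\<phi> \<eta> \<sigma>) (\<mu> \<eta> \<sigma>) \<and>
             (\<forall>\<phi>' \<mu>'. \<mu>' \<in> ball 0 (lam / 2) \<and> fluid_mode \<beta> M Dt L \<eta> \<sigma> \<phi>' \<mu>' \<longrightarrow>
                \<mu>' = \<mu> \<eta> \<sigma> \<and> (AE v in lborel. \<phi>' v = \<phi> \<eta> \<sigma> v)) \<and>
             Im (\<mu> \<eta> \<sigma>) = 0 \<and> Re (\<mu> \<eta> \<sigma>) > 0) \<and>
          (\<forall>\<sigma>. norm \<sigma> = 1 \<longrightarrow>
             ((\<lambda>\<eta>. \<mu> \<eta> \<sigma>) \<longlongrightarrow> 0) (at_right 0) \<and>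
             ((\<lambda>\<eta>. wnorm M (-\<beta>) (\<lambda>v. \<phi> \<eta> \<sigma> v - 1)) \<longlongrightarrow> 0) (at_right 0)) \<and>
          (\<exists>c>0. \<exists>s0>0. \<exists>s1>s0. \<forall>\<eta>\<in>{0<..<\<eta>0}. \<forall>\<sigma>. norm \<sigma> = 1 \<longrightarrow>
             wnorm M (-\<beta>) (\<lambda>v. \<phi> \<eta> \<sigma> v - 1) \<le> c * sqrt (Re (\<mu> \<eta> \<sigma>)) \<and>
             s0 * theta \<alpha> \<beta> \<eta> < Re (\<mu> \<eta> \<sigma>) \<and> Re (\<mu> \<eta> \<sigma>) < s1 * theta \<alpha> \<beta> \<eta>)"
    proof (rule exI[of _ \<phi>], rule exI[of _ \<mu>], rule conjI[OF _ conjI])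
      show "\<forall>\<eta>\<in>{0<..<\<eta>0}. \<forall>\<sigma>. norm \<sigma> = 1 \<longrightarrow>
             \<mu> \<eta> \<sigma> \<in> ball 0 (lam / 2) \<and> fluid_mode \<beta> M Dt L \<eta> \<sigma> (\<phi> \<eta> \<sigma>) (\<mu> \<eta> \<sigma>) \<and>
             (\<forall>\<phi>' \<mu>'. \<mu>' \<in> ball 0 (lam / 2) \<and> fluid_mode \<beta> M Dt L \<eta> \<sigma> \<phi>' \<mu>' \<longrightarrow>
                \<mu>' = \<mu> \<eta> \<sigma> \<and> (AE v in lborel. \<phi>' v = \<phi> \<eta> \<sigma> v)) \<and>
             Im (\<mu> \<eta> \<sigma>) = 0 \<and> Re (\<mu> \<eta> \<sigma>) > 0"
      proof (intro ballI allI impI)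
        fix \<eta> and \<sigma> :: "real^'n" assume "\<eta> \<in> {0<..<\<eta>0}" and s: "norm \<sigma> = 1"
        then have eta: "0 < \<eta>" "\<eta> < \<eta>0" by auto
        show "\<mu> \<eta> \<sigma> \<in> ball 0 (lam / 2) \<and> fluid_mode \<beta> M Dt L \<eta> \<sigma> (\<phi> \<eta> \<sigma>) (\<mu> \<eta> \<sigma>) \<and>
             (\<forall>\<phi>' \<mu>'. \<mu>' \<in> ball 0 (lam / 2) \<and> fluid_mode \<beta> M Dt L \<eta> \<sigma> \<phi>' \<mu>' \<longrightarrow>
                \<mu>' = \<mu> \<eta> \<sigma> \<and> (AE v in lborel. \<phi>' v = \<phi> \<eta> \<sigma> v)) \<and>
             Im (\<mu> \<eta> \<sigma>) = 0 \<and> Re (\<mu> \<eta> \<sigma>) > 0"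
          using sol[OF eta s] real[OF eta s] pos[OF eta s] by blast
      qed
      show "\<forall>\<sigma>. norm \<sigma> = 1 \<longrightarrow> ((\<lambda>\<eta>. \<mu> \<eta> \<sigma>) \<longlongrightarrow> 0) (at_right 0) \<and>
             ((\<lambda>\<eta>. wnorm M (-\<beta>) (\<lambda>v. \<phi> \<eta> \<sigma> v - 1)) \<longlongrightarrow> 0) (at_right 0)"
      proof (intro allI impI conjI)
        fix \<sigma> :: "real^'n" assume s: "norm \<sigma> = 1"
        have lim_th: "((\<lambda>\<eta>. s1 * theta \<alpha> \<beta> \<eta>) \<longlongrightarrow> 0) (at_right 0)"
          using tendsto_mult_left[OF th0, of s1] by simp
        show "((\<lambda>\<eta>. \<mu> \<eta> \<sigma>) \<longlongrightarrow> 0) (at_right 0)"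
        proof (rule Lim_null_comparison[OF _ lim_th], use near in eventually_elim)
          fix \<eta> assume eta: "0 < \<eta> \<and> \<eta> < \<eta>0"
          then have "cmod (\<mu> \<eta> \<sigma>) = Re (\<mu> \<eta> \<sigma>)" using real[of \<eta> \<sigma>] pos[of \<eta> \<sigma>] s by (simp add: cmod_def)
          then show "cmod (\<mu> \<eta> \<sigma>) \<le> s1 * theta \<alpha> \<beta> \<eta>" using b(2)[of \<eta> \<sigma>] eta s by simp
        qed
        have lim_c: "((\<lambda>\<eta>. c * sqrt (s1 * theta \<alpha> \<beta> \<eta>)) \<longlongrightarrow> 0) (at_right 0)"
          using tendsto_mult_left[OF tendsto_real_sqrt[OF lim_th], of c] by simp
        show "((\<lambda>\<eta>. wnorm M (-\<beta>) (\<lambda>v. \<phi> \<eta> \<sigma> v - 1)) \<longlongrightarrow> 0) (at_right 0)"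
        proof (rule Lim_null_comparison[OF _ lim_c], use near in eventually_elim)
          fix \<eta> assume eta: "0 < \<eta> \<and> \<eta> < \<eta>0"
          have "0 \<le> wnorm M (-\<beta>) (\<lambda>v. \<phi> \<eta> \<sigma> v - 1)" by (simp add: wnorm_def)
          moreover have "c * sqrt (Re (\<mu> \<eta> \<sigma>)) \<le> c * sqrt (s1 * theta \<alpha> \<beta> \<eta>)"
            using b(2)[of \<eta> \<sigma>] eta s c by simp
          ultimately show "norm (wnorm M (-\<beta>) (\<lambda>v. \<phi> \<eta> \<sigma> v - 1)) \<le> c * sqrt (s1 * theta \<alpha> \<beta> \<eta>)"
            using wn[of \<eta> \<sigma>] eta s by simp
        qed
      qed
      \<comment> \<open>The estimates obtained so far are not strict. Since \<open>theta\<close> is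
        positive, halving \<open>s0\<close> and adding it to \<open>s1\<close> makes them strict and
        puts the constants in order.\<close>
      have "s0 / 2 < s0 + s1" using s01 by linarith
      moreover have "wnorm M (-\<beta>) (\<lambda>v. \<phi> \<eta> \<sigma> v - 1) \<le> c * sqrt (Re (\<mu> \<eta> \<sigma>)) \<and>
             s0 / 2 * theta \<alpha> \<beta> \<eta> < Re (\<mu> \<eta> \<sigma>) \<and> Re (\<mu> \<eta> \<sigma>) < (s0 + s1) * theta \<alpha> \<beta> \<eta>"
        if "\<eta> \<in> {0<..<\<eta>0}" "norm \<sigma> = 1" for \<eta> \<sigma>
      proof -
        have eta: "0 < \<eta>" "\<eta> < \<eta>0" using that by auto
        have "0 < s0 * theta \<alpha> \<beta> \<eta>" using s01 b(3)[OF eta that(2)] by simp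
        then show ?thesis using wn[OF eta that(2)] b[OF eta that(2)] by (simp add: distrib_right)
      qed
      ultimately show "\<exists>c>0. \<exists>s0>0. \<exists>s1>s0. \<forall>\<eta>\<in>{0<..<\<eta>0}. \<forall>\<sigma>. norm \<sigma> = 1 \<longrightarrow>
             wnorm M (-\<beta>) (\<lambda>v. \<phi> \<eta> \<sigma> v - 1) \<le> c * sqrt (Re (\<mu> \<eta> \<sigma>)) \<and>
             s0 * theta \<alpha> \<beta> \<eta> < Re (\<mu> \<eta> \<sigma>) \<and> Re (\<mu> \<eta> \<sigma>) < s1 * theta \<alpha> \<beta> \<eta>"
        using c s01(1) by (intro exI[of _ c] conjI exI[of _ "s0 / 2"] exI[of _ "s0 + s1"] ballI allI impI) simp_all
    qed
  qed
qed

end
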